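(* There exists an arrangement $\mathcal{CL}$ of $12$ irreducible conics in $\mathbb{P}^2_{\mathbb{C}}$, namely a Hesse (or Chilean) arrangement of conics, whose singular locus $\mathrm{Sing}(\mathcal{CL})$ consists of exactly $21$ points ($9$ points of multiplicity $8$ and $12$ nodes), such that $$\varepsilon(\mathbb{P}^2_{\mathbb{C}}, \mathcal{O}_{\mathbb{P}^2_{\mathbb{C}}}(1); \mathrm{Sing}(\mathcal{CL})) = \frac{1}{5},$$ and this multipoint Seshadri constant is computed by a line, i.e. there is a line $\ell \subset \mathbb{P}^2_{\mathbb{C}}$ with $\sum_{p \in \mathrm{Sing}(\mathcal{CL})} \mathrm{mult}_p(\ell) = 5$.
   Context: Work over the complex numbers. For a finite set of points $Z = \{x_1,\dots,x_r\} \subset \mathbb{P}^2_{\mathbb{C}}$, the multipoint Seshadri constant of $\mathcal{O}_{\mathbb{P}^2_{\mathbb{C}}}(1)$ at $Z$ is $$\varepsilon(\mathbb{P}^2_{\mathbb{C}}, \mathcal{O}_{\mathbb{P}^2_{\mathbb{C}}}(1); Z) = \inf_{C \cap Z \neq \emptyset} \frac{\deg C}{\sum_{i=1}^r \mathrm{mult}_{x_i} C},$$ where the infimum is over all irreducible and reduced curves $C \subset \mathbb{P}^2_{\mathbb{C}}$ passing through at least one of the points, and $\mathrm{mult}_{x}C$ is the multiplicity of $C$ at $x$. For an arrangement of curves, its singular locus $\mathrm{Sing}$ is the set of all singular points of the components together with all points where two or more of the curves intersect; the multiplicity of such a point is the multiplicity at it of the sum of the curves of the arrangement. Hesse (Chilean)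 arrangement of conics: the dual curve of a smooth plane cubic $\mathcal{E}$ is an irreducible sextic with exactly $9$ cusps, corresponding to the $9$ flexes of $\mathcal{E}$; the arrangement consists of the $12$ irreducible conics that each pass through exactly $6$ of these $9$ cusps. The $9$ cusps are the points of multiplicity $8$ of the arrangement, and the $12$ nodes are the triple points of a dual Hesse arrangement of $9$ lines (a line arrangement projectively equivalent to $(x^3-y^3)(y^3-z^3)(z^3-x^3)=0$); each conic passes through exactly $6$ of the points of multiplicity $8$ and exactly $2$ of the nodes. *)

theory Defs
  imports "HOL-Analysis.Analysis" "HOL-Library.Poly_Mapping"
begin

text \<open>
  A ternary polynomial is a finitely supported function from exponent vectors to coefficients.
\<close>

type_synonym poly3 = "(3 \<Rightarrow>\<^sub>0 nat) \<Rightarrow>\<^sub>0 complex"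

definition mdeg :: "(3 \<Rightarrow>\<^sub>0 nat) \<Rightarrow> nat" where
  "mdeg m = (\<Sum>i\<in>UNIV. Poly_Mapping.lookup m i)"

definition homogeneous :: "nat \<Rightarrow> poly3 \<Rightarrow> bool" where
  "homogeneous d F \<longleftrightarrow> (\<forall>m\<in>Poly_Mapping.keys F. mdeg m = d)"

definition total_degree :: "poly3 \<Rightarrow> nat" where
  "total_degree F = Max (mdeg ` Poly_Mapping.keys F)"

definition eval3 :: "poly3 \<Rightarrow> complex ^ 3 \<Rightarrow> complex" where
  "eval3 F v = (\<Sum>m\<in>Poly_Mapping.keys F. Poly_Mapping.lookup F m * (\<Prod>i\<in>UNIV. (v $ i) ^ Poly_Mapping.lookup m i))"

text \<open>
  The univariate polynomial \<open>F(p + t v)\<close> in \<open>t\<close>.  Its coefficient of \<open>t^k\<close>, as a function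
  of \<open>v\<close>, is the homogeneous part of degree \<open>k\<close> of the Taylor expansion of \<open>F\<close> at \<open>p\<close>.
\<close>

definition along :: "poly3 \<Rightarrow> complex ^ 3 \<Rightarrow> complex ^ 3 \<Rightarrow> complex poly" where
  "along F p v = (\<Sum>m\<in>Poly_Mapping.keys F. [:Poly_Mapping.lookup F m:] * (\<Prod>i\<in>UNIV. [:p $ i, v $ i:] ^ Poly_Mapping.lookup m i))"

definition taylor :: "nat \<Rightarrow> poly3 \<Rightarrow> complex ^ 3 \<Rightarrow> complex ^ 3 \<Rightarrow> complex" where
  "taylor k F p v = coeff (along F p v) k"

definition grad :: "poly3 \<Rightarrow> complex ^ 3 \<Rightarrow> complex ^ 3" where
  "grad F p = (\<chi> i. poly (pderiv (along F p (axis i 1))) 0)"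

definition bilin :: "complex ^ 3 \<Rightarrow> complex ^ 3 \<Rightarrow> complex" where
  "bilin a v = (\<Sum>i\<in>UNIV. a $ i * v $ i)"

text \<open>
  For a form \<open>F\<close> the expansion at a representative \<open>p\<close> of a point of the plane has, up to a
  nonzero factor, the same order and the same leading form as that of a local affine equation:
  dehomogenizing at \<open>p\<close> restricts \<open>v\<close> to a complement of the line spanned by \<open>p\<close>.
\<close>

definition mult3 :: "poly3 \<Rightarrow> complex ^ 3 \<Rightarrow> nat" where
  "mult3 F p = (LEAST k. \<exists>v. taylor k F p v \<noteq> 0)"

text \<open>A node is a double point whose tangent cone consists of two distinct lines.\<close>

definition node3 :: "poly3 \<Rightarrow> complex ^ 3 \<Rightarrow> bool" where
  "node3 F p \<longleftrightarrow> mult3 F p = 2 \<and>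
     (\<exists>a b. (\<forall>v. taylor 2 F p v = bilin a v * bilin b v) \<and> (\<forall>c. a \<noteq> c *s b))"

text \<open>
  A cusp is a double point whose tangent cone is a double line that meets the curve at the point
  with intersection multiplicity exactly 3.
\<close>

definition cusp3 :: "poly3 \<Rightarrow> complex ^ 3 \<Rightarrow> bool" where
  "cusp3 F p \<longleftrightarrow> mult3 F p = 2 \<and>
     (\<exists>a. (\<forall>v. taylor 2 F p v = (bilin a v)\<^sup>2) \<and> (\<exists>v. bilin a v = 0 \<and> taylor 3 F p v \<noteq> 0))"


subsection \<open>Points and curves in the complex projective plane\<close>

definition proj_rel :: "complex ^ 3 \<Rightarrow> complex ^ 3 \<Rightarrow> bool" where
  "proj_rel u v \<longleftrightarrow> u \<noteq> 0 \<and> v \<noteq> 0 \<and> (\<exists>c. c \<noteq> 0 \<and> v = c *s u)"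

lemma proj_rel_part_equivp: "part_equivp proj_rel"
proof (rule part_equivpI)
  show "\<exists>x. proj_rel x x"
    by (rule exI[of _ "axis 1 1"]) (auto simp: proj_rel_def intro!: exI[of _ 1])
  show "symp proj_rel"
  proof (rule sympI)
    fix u v assume "proj_rel u v"
    then obtain c where "u \<noteq> 0" "v \<noteq> 0" "c \<noteq> 0" "v = c *s u"
      by (auto simp: proj_rel_def)
    then show "proj_rel v u"
      by (auto simp: proj_rel_def vector_smult_assoc intro!: exI[of _ "inverse c"])
  qed
  show "transp proj_rel"
  proof (rule transpI)
    fix u v w assume "proj_rel u v" "proj_rel v w"
    then obtain c d where "u \<noteq> 0" "w \<noteq> 0" "c \<noteq> 0" "v = c *s u" "d \<noteq> 0" "w = d *s v"
      by (auto simp: proj_rel_def)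
    then show "proj_rel u w"
      by (auto simp: proj_rel_def vector_smult_assoc intro!: exI[of _ "d * c"])
  qed
qed

quotient_type point = "complex ^ 3" / partial: proj_rel
  by (rule proj_rel_part_equivp)

definition form_rel :: "poly3 \<Rightarrow> poly3 \<Rightarrow> bool" where
  "form_rel F G \<longleftrightarrow> F \<noteq> 0 \<and> G \<noteq> 0 \<and> (\<exists>d. homogeneous d F) \<and> (\<exists>d. homogeneous d G) \<and>
     (\<exists>c. c \<noteq> 0 \<and> G = Poly_Mapping.single 0 c * F)"

lemma form_rel_part_equivp: "part_equivp form_rel"
proof (rule part_equivpI)
  show "\<exists>x. form_rel x x"
    by (rule exI[of _ 1])
      (auto simp: form_rel_def homogeneous_def intro!: exI[of _ "1::complex"])
  show "symp form_rel"
  proof (rule sympI)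
    fix F G assume FG: "form_rel F G"
    then obtain c where c: "c \<noteq> 0" "G = Poly_Mapping.single 0 c * F"
      by (auto simp: form_rel_def)
    then have "F = Poly_Mapping.single 0 (inverse c) * G"
      by (simp add: mult.assoc[symmetric] mult_single)
    moreover have "inverse c \<noteq> 0" using c by simp
    ultimately show "form_rel G F"
      using FG unfolding form_rel_def by blast
  qed
  show "transp form_rel"
  proof (rule transpI)
    fix F G H assume FG: "form_rel F G" and GH: "form_rel G H"
    then obtain c d where "c \<noteq> 0" "G = Poly_Mapping.single 0 c * F"
      "d \<noteq> 0" "H = Poly_Mapping.single 0 d * G"
      by (auto simp: form_rel_def)
    then have "d * c \<noteq> 0" "H = Poly_Mapping.single 0 (d * c) * F"
      by (auto simp: mult.assoc[symmetric] mult_single)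
    with FG GH show "form_rel F H"
      unfolding form_rel_def by blast
  qed
qed

text \<open>
  Nonzero forms up to scalars are the effective divisors of the plane; their sum corresponds to the
  product of forms.  Irreducible and reduced curves are the classes of irreducible forms.
\<close>

quotient_type curve = poly3 / partial: form_rel
  by (rule form_rel_part_equivp)

lemma keys_scale: "c \<noteq> 0 \<Longrightarrow> Poly_Mapping.keys (Poly_Mapping.single 0 c * F) = Poly_Mapping.keys (F :: poly3)"
  for c :: complex
proof -
  assume c: "c \<noteq> 0"
  have sub: "Poly_Mapping.keys (Poly_Mapping.single 0 c * F) \<subseteq> Poly_Mapping.keys F" for c and F :: poly3
    using keys_mult[of "Poly_Mapping.single 0 c" F] by (auto split: if_splits)
  have "Poly_Mapping.single 0 (inverse c) * (Poly_Mapping.single 0 c * F) = F"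
    using c by (simp add: mult.assoc[symmetric] mult_single)
  with sub[of c F] sub[of "inverse c" "Poly_Mapping.single 0 c * F"] show ?thesis by auto
qed

lemma lookup_scale: "Poly_Mapping.lookup (Poly_Mapping.single 0 c * F) m = c * Poly_Mapping.lookup F m"
  for F :: poly3
  by (simp add: mult_map_scale_conv_mult[symmetric] Poly_Mapping.map.rep_eq when_def)

lemma eval3_scale: "eval3 (Poly_Mapping.single 0 c * F) v = c * eval3 F v"
proof (cases "c = 0")
  case False
  then show ?thesis
    by (simp add: eval3_def keys_scale lookup_scale sum_distrib_left mult.assoc)
qed (simp add: eval3_def)

lemma poly_along: "poly (along F p v) t = eval3 F (p + t *s v)"
  by (simp add: along_def eval3_def poly_sum poly_prod mult.commute)

lemma along_scale: "along (Poly_Mapping.single 0 c * F) p v = smult c (along F p v)"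
  by (simp add: poly_eq_poly_eq_iff[symmetric] fun_eq_iff poly_along eval3_scale)

lemma taylor_scale: "taylor k (Poly_Mapping.single 0 c * F) p v = c * taylor k F p v"
  by (simp add: taylor_def along_scale)

lemma homogeneous_eval3:
  assumes "homogeneous d F"
  shows "eval3 F (c *s v) = c ^ d * eval3 F v"
proof -
  have "(\<Prod>i\<in>UNIV. ((c *s v) $ i) ^ Poly_Mapping.lookup m i) = c ^ mdeg m * (\<Prod>i\<in>UNIV. (v $ i) ^ Poly_Mapping.lookup m i)" for m
    by (simp add: power_mult_distrib prod.distrib mdeg_def power_sum)
  then show ?thesis
    using assms by (auto simp: eval3_def homogeneous_def sum_distrib_left intro!: sum.cong)
qed

lemma homogeneous_mult:
  assumes "homogeneous d F" "homogeneous e G"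
  shows "homogeneous (d + e) (F * G)"
  unfolding homogeneous_def
proof
  fix m assume "m \<in> Poly_Mapping.keys (F * G)"
  then obtain a b where "m = a + b" "a \<in> Poly_Mapping.keys F" "b \<in> Poly_Mapping.keys G"
    using keys_mult[of F G] by blast
  then show "mdeg m = d + e"
    using assms by (simp add: homogeneous_def mdeg_def lookup_add sum.distrib)
qed

lemma homogeneous_along:
  assumes "homogeneous d F"
  shows "along F (c *s p) (c *s v) = smult (c ^ d) (along F p v)"
proof -
  have "poly (along F (c *s p) (c *s v)) t = poly (smult (c ^ d) (along F p v)) t" for t
  proof -
    have "c *s p + t *s (c *s v) = c *s (p + t *s v)"
      by (simp add: vec_eq_iff algebra_simps)
    then show ?thesis by (simp only: poly_along poly_smult homogeneous_eval3[OF assms])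
  qed
  then show ?thesis by (simp add: poly_eq_poly_eq_iff[symmetric] fun_eq_iff)
qed

lemma along_direction: "along F p (c *s v) = pcompose (along F p v) [:0, c:]"
  by (simp add: poly_eq_poly_eq_iff[symmetric] fun_eq_iff poly_along poly_pcompose
      vector_smult_assoc mult.commute)

lemma taylor_direction: "taylor k F p (c *s v) = c ^ k * taylor k F p v"
  by (simp add: taylor_def along_direction coeff_pcompose_linear)

lemma taylor_point:
  assumes "homogeneous d F" "c \<noteq> 0"
  shows "taylor k F (c *s p) v = c ^ d / c ^ k * taylor k F p v"
proof -
  have "c ^ k * taylor k F (c *s p) v = c ^ d * taylor k F p v"
    using homogeneous_along[OF assms(1), of c p v]
    by (simp add: taylor_direction[symmetric]) (simp add: taylor_def)
  then show ?thesis using assms(2) by (simp add: field_simps)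
qed

lemma form_rel_taylor:
  assumes "form_rel F G" "proj_rel p q"
  shows "\<exists>f. (\<forall>k. f k \<noteq> 0) \<and> (\<forall>k v. taylor k G q v = f k * taylor k F p v)"
proof -
  obtain c d e where *: "c \<noteq> 0" "G = Poly_Mapping.single 0 c * F" "homogeneous d F"
    "e \<noteq> 0" "q = e *s p"
    using assms by (auto simp: form_rel_def proj_rel_def)
  show ?thesis
    by (rule exI[of _ "\<lambda>k. c * (e ^ d / e ^ k)"])
      (use * in \<open>auto simp: taylor_scale taylor_point\<close>)
qed

lemma bilin_scale: "bilin (c *s a) v = c * bilin a v"
  by (simp add: bilin_def sum_distrib_left mult.assoc)

lemma form_rel_mult3:
  assumes "form_rel F G" "proj_rel p q"
  shows "mult3 F p = mult3 G q"
proof -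
  obtain f where "\<And>k. f k \<noteq> 0" "\<And>k v. taylor k G q v = f k * taylor k F p v"
    using form_rel_taylor[OF assms] by blast
  then show ?thesis by (simp add: mult3_def)
qed

lemma form_rel_sym: "form_rel F G \<Longrightarrow> form_rel G F"
  using form_rel_part_equivp by (meson part_equivp_symp sympD)

lemma proj_rel_sym: "proj_rel p q \<Longrightarrow> proj_rel q p"
  using proj_rel_part_equivp by (meson part_equivp_symp sympD)

lemma form_rel_node3:
  assumes "form_rel F G" "proj_rel p q" "node3 F p"
  shows "node3 G q"
proof -
  obtain f where f: "\<And>k. f k \<noteq> 0" "\<And>k v. taylor k G q v = f k * taylor k F p v"
    using form_rel_taylor[OF assms(1,2)] by blast
  obtain a b where ab: "\<forall>v. taylor 2 F p v = bilin a v * bilin b v" "\<forall>c. a \<noteq> c *s b"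
    using assms(3) by (auto simp: node3_def)
  have "\<forall>v. taylor 2 G q v = bilin (f 2 *s a) v * bilin b v"
    using f ab by (simp add: bilin_scale)
  moreover have "f 2 *s a \<noteq> c *s b" for c
  proof
    assume "f 2 *s a = c *s b"
    then have "inverse (f 2) *s (f 2 *s a) = inverse (f 2) *s (c *s b)" by simp
    then have "a = (inverse (f 2) * c) *s b" using f(1)[of 2] by (simp add: vector_smult_assoc)
    with ab(2) show False by blast
  qed
  ultimately have "\<exists>a b. (\<forall>v. taylor 2 G q v = bilin a v * bilin b v) \<and> (\<forall>c. a \<noteq> c *s b)"
    by blast
  then show ?thesis
    using assms(3) form_rel_mult3[OF assms(1,2)] by (simp add: node3_def)
qed

lemma grad_conv_taylor: "grad F p $ i = taylor 1 F p (axis i 1)"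
  by (simp add: grad_def taylor_def poly_0_coeff_0 coeff_pderiv)

lemma form_rel_tangent:
  assumes "form_rel F G" "proj_rel p q" "proj_rel l m"
    "eval3 F p = 0 \<and> (\<exists>c. c \<noteq> 0 \<and> grad F p = c *s l)"
  shows "eval3 G q = 0 \<and> (\<exists>c. c \<noteq> 0 \<and> grad G q = c *s m)"
proof -
  obtain f where f: "\<And>k. f k \<noteq> 0" "\<And>k v. taylor k G q v = f k * taylor k F p v"
    using form_rel_taylor[OF assms(1,2)] by blast
  obtain c where c: "c \<noteq> 0" "grad F p = c *s l"
    using assms(4) by blast
  obtain e where e: "e \<noteq> 0" "m = e *s l"
    using assms(3) by (auto simp: proj_rel_def)
  have "grad G q = f 1 *s grad F p"
    by (simp add: vec_eq_iff grad_conv_taylor f(2))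
  also have "\<dots> = (f 1 * c / e) *s m"
    using c e by (simp add: vector_smult_assoc)
  finally have "grad G q = (f 1 * c / e) *s m" .
  moreover have "f 1 * c / e \<noteq> 0"
    using f(1)[of 1] c e by simp
  moreover have "eval3 G q = 0"
    using assms by (auto simp: form_rel_def proj_rel_def eval3_scale homogeneous_eval3)
  ultimately show ?thesis by blast
qed

lemma form_rel_cusp3:
  assumes "form_rel F G" "proj_rel p q" "cusp3 F p"
  shows "cusp3 G q"
proof -
  obtain f where f: "\<And>k. f k \<noteq> 0" "\<And>k v. taylor k G q v = f k * taylor k F p v"
    using form_rel_taylor[OF assms(1,2)] by blast
  obtain a v where a: "\<forall>v. taylor 2 F p v = (bilin a v)\<^sup>2" "bilin a v = 0" "taylor 3 F p v \<noteq> 0"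
    using assms(3) by (auto simp: cusp3_def)
  have "\<forall>v. taylor 2 G q v = (bilin (csqrt (f 2) *s a) v)\<^sup>2"
    using f a(1) by (simp add: bilin_scale power_mult_distrib)
  moreover have "bilin (csqrt (f 2) *s a) v = 0" "taylor 3 G q v \<noteq> 0"
    using f a by (simp_all add: bilin_scale)
  ultimately have "\<exists>a. (\<forall>v. taylor 2 G q v = (bilin a v)\<^sup>2) \<and>
      (\<exists>v. bilin a v = 0 \<and> taylor 3 G q v \<noteq> 0)"
    by blast
  then show ?thesis
    using assms(3) form_rel_mult3[OF assms(1,2)] by (simp add: cusp3_def)
qed

lift_definition curve_degree :: "curve \<Rightarrow> nat" is total_degree
  by (auto simp: form_rel_def total_degree_def keys_scale)

lemma form_rel_irreducible:
  assumes "form_rel F G" "irreducible F"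
  shows "irreducible G"
proof (rule irreducibleI)
  show "G \<noteq> 0" using assms(1) by (simp add: form_rel_def)
  obtain c where c: "c \<noteq> 0" "G = Poly_Mapping.single 0 c * F"
    using assms(1) by (auto simp: form_rel_def)
  have inv: "Poly_Mapping.single 0 c * Poly_Mapping.single 0 (inverse c) = (1 :: poly3)"
    using c(1) by (simp add: mult_single)
  have F: "F = Poly_Mapping.single 0 (inverse c) * G"
    using c by (simp add: mult.assoc[symmetric] mult_single)
  show "\<not> G dvd 1"
  proof
    assume "G dvd 1"
    moreover have "F dvd G" by (simp add: c(2))
    ultimately have "F dvd 1" by (rule dvd_trans[rotated])
    with assms(2) show False by (simp add: irreducible_def)
  qed
  fix A B assume "G = A * B"
  then have "F = (Poly_Mapping.single 0 (inverse c) * A) * B"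
    using F by (simp add: mult.assoc)
  then have "Poly_Mapping.single 0 (inverse c) * A dvd 1 \<or> B dvd 1"
    using assms(2) by (rule irreducibleD[rotated])
  then show "A dvd 1 \<or> B dvd 1"
    using dvd_mult_right by blast
qed

lift_definition irreducible_curve :: "curve \<Rightarrow> bool" is irreducible
  using form_rel_irreducible form_rel_sym by blast

lift_definition on_curve :: "point \<Rightarrow> curve \<Rightarrow> bool" is "\<lambda>p F. eval3 F p = 0"
  by (auto simp: form_rel_def proj_rel_def eval3_scale homogeneous_eval3)

lift_definition mult_at :: "point \<Rightarrow> curve \<Rightarrow> nat" is "\<lambda>p F. mult3 F p"
  by (rule form_rel_mult3)

lift_definition is_node :: "point \<Rightarrow> curve \<Rightarrow> bool" is "\<lambda>p F. node3 F p"
  using form_rel_node3 form_rel_sym proj_rel_sym by blast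

lift_definition is_cusp :: "point \<Rightarrow> curve \<Rightarrow> bool" is "\<lambda>p F. cusp3 F p"
  using form_rel_cusp3 form_rel_sym proj_rel_sym by blast

text \<open>
  The dual plane is identified with the plane itself: \<open>[a : b : c]\<close> stands for the line
  \<open>a X + b Y + c Z = 0\<close>.  The predicate says that \<open>l\<close> is the tangent line of the curve at its
  nonsingular point \<open>p\<close>.
\<close>

lift_definition is_tangent :: "curve \<Rightarrow> point \<Rightarrow> point \<Rightarrow> bool"
  is "\<lambda>F p l. eval3 F p = 0 \<and> (\<exists>c. c \<noteq> 0 \<and> grad F p = c *s l)"
  using form_rel_tangent form_rel_sym proj_rel_sym by blast

lemma form_rel_mult:
  assumes FF: "form_rel F F'" and GG: "form_rel G G'"
  shows "form_rel (F * G) (F' * G')"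
proof -
  obtain c where c: "c \<noteq> 0" "F' = Poly_Mapping.single 0 c * F"
    using FF by (auto simp: form_rel_def)
  obtain d where d: "d \<noteq> 0" "G' = Poly_Mapping.single 0 d * G"
    using GG by (auto simp: form_rel_def)
  have "F' * G' = (Poly_Mapping.single 0 c * Poly_Mapping.single 0 d) * (F * G)"
    unfolding c(2) d(2) by (simp only: ac_simps)
  then have eq: "F' * G' = Poly_Mapping.single 0 (c * d) * (F * G)"
    by (simp only: mult_single add_0)
  have "F * G \<noteq> 0" "F' * G' \<noteq> 0"
    using FF GG by (simp_all add: form_rel_def)
  moreover have "\<exists>d. homogeneous d (F * G)" "\<exists>d. homogeneous d (F' * G')"
    using FF GG homogeneous_mult by (auto simp only: form_rel_def) blast+
  moreover have "c * d \<noteq> 0" using c d by simp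
  ultimately show ?thesis
    unfolding form_rel_def using eq by blast
qed

instantiation curve :: comm_monoid_add
begin

lift_definition zero_curve :: curve is 1
  by (auto simp: form_rel_def homogeneous_def intro!: exI[of _ "1::complex"])

lift_definition plus_curve :: "curve \<Rightarrow> curve \<Rightarrow> curve" is "\<lambda>F G. F * G"
  by (rule form_rel_mult)

instance
proof
  fix A B C :: curve
  show "A + B + C = A + (B + C)"
    by transfer (simp only: mult.assoc form_rel_mult)
  show "A + B = B + A"
    by transfer (subst mult.commute, rule form_rel_mult)
  show "0 + A = A"
    by transfer simp
qed

end

definition singular_point :: "point \<Rightarrow> curve \<Rightarrow> bool" where
  "singular_point p C \<longleftrightarrow> mult_at p C \<ge> 2"

definition Sing :: "curve set \<Rightarrow> point set" where
  "Sing A = {p. \<exists>C\<in>A. singular_point p C} \<union>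
     {p. \<exists>C\<in>A. \<exists>D\<in>A. C \<noteq> D \<and> on_curve p C \<and> on_curve p D}"

definition seshadri :: "point set \<Rightarrow> real" where
  "seshadri Z = Inf {real (curve_degree C) / real (\<Sum>p\<in>Z. mult_at p C) | C.
     irreducible_curve C \<and> (\<exists>p\<in>Z. on_curve p C)}"

definition is_line :: "curve \<Rightarrow> bool" where
  "is_line C \<longleftrightarrow> curve_degree C = 1"

definition irreducible_conic :: "curve \<Rightarrow> bool" where
  "irreducible_conic C \<longleftrightarrow> irreducible_curve C \<and> curve_degree C = 2"

definition smooth_cubic :: "curve \<Rightarrow> bool" where
  "smooth_cubic E \<longleftrightarrow> curve_degree E = 3 \<and> (\<forall>p. \<not> singular_point p E)"

text \<open>For a smooth curve the set of its tangent lines is already closed in the dual plane.\<close>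

definition is_dual_curve :: "curve \<Rightarrow> curve \<Rightarrow> bool" where
  "is_dual_curve E D \<longleftrightarrow> irreducible_curve D \<and> {l. on_curve l D} = {l. \<exists>p. is_tangent E p l}"

definition cusps :: "curve \<Rightarrow> point set" where
  "cusps D = {p. is_cusp p D}"

definition hesse_conic_arrangement :: "curve set \<Rightarrow> bool" where
  "hesse_conic_arrangement A \<longleftrightarrow>
     (\<exists>E D. smooth_cubic E \<and> is_dual_curve E D \<and>
        curve_degree D = 6 \<and> card (cusps D) = 9 \<and>
        A = {C. irreducible_conic C \<and> card {p \<in> cusps D. on_curve p C} = 6})"

end

theory Submission
  imports Defs
begin

text \<open>
  The proof is explicit.  For the cubic \<open>x^3 + y^3 + z^3 + 3 x y z = 0\<close> the dual sextic, its nine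
  cusps, the twelve conics and the twelve nodes have coordinates in the Eisenstein integers, and
  the incidences among them, together with the nine lines of the dual Hesse arrangement, are
  computed.  Every conic contains six cusps and two nodes; there are eight conics and one line
  through each cusp, and two conics and three lines through each node; every line contains five of
  the 21 points.

  The geometry then rests on one form of Bezout's theorem: on a line or smooth conic \<open>Q\<close>,
  parametrized by binary forms of degree \<open>e\<close>, a form \<open>F\<close> of degree \<open>d\<close> that is not divisible by \<open>Q\<close>
  restricts to a nonzero binary form of degree \<open>e d\<close>, with a zero of order at least the
  multiplicity of \<open>F\<close> at every point (\<open>rational_curve.bezout\<close>).  It is used four times.

  For the Seshadri constant (\<open>sum_mult_le\<close>) let \<open>C\<close> be an irreducible curve of degree \<open>d\<close> and let \<open>K\<close>
  and \<open>N\<close> be the sums of its multiplicities at the cusps and the nodes.  If \<open>C\<close> is none of the lines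
  and conics, summation over the lines and the conics gives \<open>K + 3 N \<le> 9 d\<close> and
  \<open>8 K + 2 N \<le> 24 d\<close>, so that \<open>K + N < 5 d\<close>.  The conics satisfy this as well, and the lines
  give equality.

  The singular locus (\<open>Sing_chilean\<close>) consists of the 21 points because any two conics have four of
  them in common.  A conic through exactly six cusps belongs to the arrangement (\<open>chilean_eq\<close>)
  because it shares five of them with one of the twelve.  Finally the sextic is irreducible
  (\<open>dual_irreducible\<close>): since cusps are unibranch, the cusps on a factor of degree \<open>a\<close> form a set that
  contains exactly \<open>a\<close> of the six cusps on each conic, and by double counting such a set is empty
  or everything.

  That the sextic is the dual curve follows in one direction from a polynomial identity, and in the
  other from the fact that it is the discriminant of the cubic restricted to a line
  (\<open>tangent_of_dual\<close>).  Its gradient at a tangent line is, by biduality, a multiple of the point of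
  contact, with a factor that vanishes only at the flexes (\<open>dual_partial_at_tangent\<close>); so it has
  no singular points apart from the nine cusps.
\<close>

section \<open>Evaluation of ternary polynomials\<close>

definition const3 :: "complex \<Rightarrow> poly3" where
  "const3 a = Poly_Mapping.single 0 a"

definition var3 :: "3 \<Rightarrow> poly3" where
  "var3 i = Poly_Mapping.single (Poly_Mapping.single i 1) 1"

lemma sum_monomials: "(\<Sum>m\<in>Poly_Mapping.keys F. Poly_Mapping.single m (Poly_Mapping.lookup F m)) = F"
  by (rule poly_mapping_eqI) (auto simp: lookup_sum lookup_single when_def in_keys_iff)

text \<open>
  Evaluation along a scalar embedding \<open>c\<close>.  Values at a vector, restriction to a parametrized
  curve, Taylor expansion, linear substitution and grading by degree are all of this shape, so that
  each of them is a ring homomorphism for one and the same reason.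
\<close>
definition ev :: "(complex \<Rightarrow> 'a::comm_ring_1) \<Rightarrow> (3 \<Rightarrow> 'a) \<Rightarrow> poly3 \<Rightarrow> 'a" where
  "ev c x F = (\<Sum>m\<in>Poly_Mapping.keys F. c (Poly_Mapping.lookup F m) * (\<Prod>i\<in>UNIV. x i ^ Poly_Mapping.lookup m i))"

locale scalar_hom =
  fixes c :: "complex \<Rightarrow> 'a::comm_ring_1"
  assumes c_add: "c (a + b) = c a + c b"
    and c_mult: "c (a * b) = c a * c b"
    and c_one: "c 1 = 1"
begin

lemma c_zero: "c 0 = 0"
  using c_add[of 0 0] by simp

lemma ev_superset:
  assumes "finite S" "Poly_Mapping.keys F \<subseteq> S"
  shows "ev c x F = (\<Sum>m\<in>S. c (Poly_Mapping.lookup F m) * (\<Prod>i\<in>UNIV. x i ^ Poly_Mapping.lookup m i))"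
  unfolding ev_def by (rule sum.mono_neutral_left[OF assms]) (auto simp: in_keys_iff c_zero)

lemma ev_zero [simp]: "ev c x 0 = 0"
  by (simp add: ev_def)

lemma ev_add: "ev c x (F + G) = ev c x F + ev c x G"
proof -
  let ?S = "Poly_Mapping.keys F \<union> Poly_Mapping.keys G"
  have "Poly_Mapping.keys (F + G) \<subseteq> ?S" by (rule keys_add)
  then show ?thesis
    by (simp add: ev_superset[of ?S] lookup_add c_add distrib_right sum.distrib)
qed

lemma ev_sum: "ev c x (\<Sum>a\<in>A. f a) = (\<Sum>a\<in>A. ev c x (f a))"
  by (induction A rule: infinite_finite_induct) (simp_all add: ev_add)

lemma ev_single: "ev c x (Poly_Mapping.single m a) = c a * (\<Prod>i\<in>UNIV. x i ^ Poly_Mapping.lookup m i)"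
  by (simp add: ev_def c_zero)

lemma ev_mult: "ev c x (F * G) = ev c x F * ev c x G"
proof -
  have single: "ev c x (Poly_Mapping.single m a * Poly_Mapping.single n b)
     = ev c x (Poly_Mapping.single m a) * ev c x (Poly_Mapping.single n b)" for m n a b
    by (simp add: mult_single ev_single c_mult lookup_add power_add prod.distrib algebra_simps)
  show ?thesis
    by (subst (1 2 3 4) sum_monomials[symmetric]) (simp only: sum_product ev_sum single)
qed

lemma ev_const [simp]: "ev c x (const3 a) = c a"
  by (simp add: const3_def ev_single)

lemma ev_one [simp]: "ev c x 1 = 1"
  by (metis ev_const const3_def single_one c_one)

lemma ev_var [simp]: "ev c x (var3 i) = x i"
proof -
  have "(\<Prod>j\<in>UNIV. x j ^ Poly_Mapping.lookup (Poly_Mapping.single i (1::nat)) j) = (\<Prod>j\<in>UNIV. if j = i then x j else 1)"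
    by (rule prod.cong) (auto simp: lookup_single when_def)
  then show ?thesis by (simp add: var3_def ev_single c_one)
qed

lemma ev_power: "ev c x (F ^ n) = ev c x F ^ n"
  by (induction n) (simp_all add: ev_mult)

lemma ev_uminus: "ev c x (- F) = - ev c x F"
  using ev_add[of x F "- F"] by (simp add: eq_neg_iff_add_eq_0 add.commute)

lemma ev_diff: "ev c x (F - G) = ev c x F - ev c x G"
  using ev_add[of x F "- G"] by (simp add: ev_uminus)

lemma ev_numeral: "ev c x (numeral k) = c (numeral k)"
  by (metis ev_const const3_def single_numeral)

lemmas ev_simps = ev_add ev_mult ev_power ev_uminus ev_diff ev_numeral

end

lemma monomial_expansion:
  "Poly_Mapping.single m a = const3 a * (\<Prod>i\<in>UNIV. var3 i ^ Poly_Mapping.lookup m i)"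
proof -
  have pw: "var3 i ^ n = Poly_Mapping.single (Poly_Mapping.single i n) 1" for i n
    by (induction n) (simp_all add: var3_def mult_single single_add[symmetric])
  have "(\<Prod>i\<in>A. Poly_Mapping.single (f i) (1::complex)) = Poly_Mapping.single (\<Sum>i\<in>A. f i) 1"
    for A :: "3 set" and f :: "3 \<Rightarrow> 3 \<Rightarrow>\<^sub>0 nat"
    by (induction A rule: infinite_finite_induct) (simp_all add: mult_single)
  moreover have "(\<Sum>i\<in>UNIV. Poly_Mapping.single i (Poly_Mapping.lookup m i)) = m"
    by (rule poly_mapping_eqI) (simp add: lookup_sum lookup_single when_def)
  ultimately show ?thesis
    by (simp add: pw const3_def mult_single)
qed

lemma poly3_induct [case_names const var add mult]:
  assumes const: "\<And>a. P (const3 a)" and var: "\<And>i. P (var3 i)"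
    and add: "\<And>F G. P F \<Longrightarrow> P G \<Longrightarrow> P (F + G)" and mult: "\<And>F G. P F \<Longrightarrow> P G \<Longrightarrow> P (F * G)"
  shows "P F"
proof -
  have one: "P 1" using const[of 1] by (simp add: const3_def)
  have zero: "P 0" using const[of 0] by (simp add: const3_def)
  have pow: "P (G ^ n)" if "P G" for G n
    using that by (induction n) (auto intro: one mult)
  have prod: "P (\<Prod>i\<in>A. var3 i ^ f i)" for A :: "3 set" and f
    by (induction A rule: infinite_finite_induct) (auto intro: one mult pow var)
  have "P (\<Sum>m\<in>A. Poly_Mapping.single m (Poly_Mapping.lookup F m))" for A
    by (induction A rule: infinite_finite_induct)
      (auto intro: zero add mult const prod simp: monomial_expansion)
  then show ?thesis by (metis sum_monomials)
qed

interpretation eval_id: scalar_hom "\<lambda>a. a :: complex"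
  by unfold_locales auto

interpretation eval_poly: scalar_hom "\<lambda>a. [:a:] :: complex poly"
  by unfold_locales auto

interpretation eval_poly2: scalar_hom "\<lambda>a. [:[:a:]:] :: complex poly poly"
  by unfold_locales (auto simp: one_pCons)

interpretation eval_poly3: scalar_hom const3
  by unfold_locales (auto simp: const3_def single_add mult_single)

lemma eval3_conv_ev: "eval3 F v = ev (\<lambda>a. a) (($) v) F"
  by (simp add: eval3_def ev_def)

lemma along_conv_ev: "along F p v = ev (\<lambda>a. [:a:]) (\<lambda>i. [:p $ i, v $ i:]) F"
  by (simp add: along_def ev_def)

lemma eval3_simps [simp]:
  "eval3 0 v = 0" "eval3 1 v = 1" "eval3 (const3 a) v = a" "eval3 (var3 i) v = v $ i"
  "eval3 (F + G) v = eval3 F v + eval3 G v" "eval3 (F * G) v = eval3 F v * eval3 G v"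
  "eval3 (F - G) v = eval3 F v - eval3 G v" "eval3 (- F) v = - eval3 F v"
  "eval3 (F ^ n) v = eval3 F v ^ n" "eval3 (numeral k) v = numeral k"
  by (simp_all add: eval3_conv_ev eval_id.ev_simps)

lemma along_mult: "along (F * G) p v = along F p v * along G p v"
  by (simp add: along_conv_ev eval_poly.ev_mult)

definition subst3 :: "(3 \<Rightarrow> poly3) \<Rightarrow> poly3 \<Rightarrow> poly3" where
  "subst3 = ev const3"

lemma subst3_simps [simp]:
  "subst3 G 0 = 0" "subst3 G 1 = 1" "subst3 G (const3 a) = const3 a" "subst3 G (var3 i) = G i"
  "subst3 G (F + H) = subst3 G F + subst3 G H" "subst3 G (F * H) = subst3 G F * subst3 G H"
  "subst3 G (F - H) = subst3 G F - subst3 G H" "subst3 G (F ^ n) = subst3 G F ^ n"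
  by (simp_all add: subst3_def eval_poly3.ev_simps)

lemma eval3_subst3 [simp]: "eval3 (subst3 G F) v = eval3 F (\<chi> i. eval3 (G i) v)"
  by (induction F rule: poly3_induct) simp_all

definition on_param :: "(3 \<Rightarrow> complex poly) \<Rightarrow> poly3 \<Rightarrow> complex poly" where
  "on_param = ev (\<lambda>a. [:a:])"

lemma poly_on_param: "poly (on_param X F) t = eval3 F (\<chi> i. poly (X i) t)"
  unfolding on_param_def
  by (induction F rule: poly3_induct) (simp_all add: eval_poly.ev_simps)

lemma keys_nonempty: "F \<noteq> 0 \<Longrightarrow> \<exists>m. m \<in> Poly_Mapping.keys F"
  by (rule ccontr) (auto simp: in_keys_iff poly_mapping_eq_iff fun_eq_iff)

lemma prod_3: "prod f (UNIV :: 3 set) = f 1 * f 2 * f 3"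
  unfolding UNIV_3 by (simp add: mult.assoc)

text \<open>
  Kronecker substitution: for \<open>N\<close> larger than all exponents, \<open>x = t\<close>, \<open>y = t^N\<close>,
  \<open>z = t^(N^2)\<close> sends distinct monomials of \<open>F\<close> to distinct powers of \<open>t\<close>, since an exponent
  vector is recovered from its digits in base \<open>N\<close>.  Hence polynomial identities may be checked on
  values.
\<close>
lemma eval3_eq_zero_imp:
  assumes "\<And>v. eval3 F v = 0"
  shows "F = 0"
proof (rule ccontr)
  assume "F \<noteq> 0"
  then obtain m0 where m0: "m0 \<in> Poly_Mapping.keys F"
    using keys_nonempty by blast
  define N where "N = Suc (Max ((\<lambda>(m, i). Poly_Mapping.lookup m i) ` (Poly_Mapping.keys F \<times> UNIV)))"
  have N: "Poly_Mapping.lookup m i < N" if "m \<in> Poly_Mapping.keys F" for m i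
  proof -
    have "Poly_Mapping.lookup m i \<in> (\<lambda>(m, i). Poly_Mapping.lookup m i) ` (Poly_Mapping.keys F \<times> UNIV)"
      using that by force
    then show ?thesis unfolding N_def
      by (meson Max_ge finite_SigmaI finite_code finite_imageI finite_keys le_imp_less_Suc)
  qed
  define e :: "(3 \<Rightarrow>\<^sub>0 nat) \<Rightarrow> nat" where "e m = Poly_Mapping.lookup m 1 + N * (Poly_Mapping.lookup m 2 + N * Poly_Mapping.lookup m 3)" for m
  have inj: "m = m'" if "m \<in> Poly_Mapping.keys F" "m' \<in> Poly_Mapping.keys F" "e m = e m'" for m m'
  proof -
    have "N > 0" by (simp add: N_def)
    have 1: "Poly_Mapping.lookup m 1 = Poly_Mapping.lookup m' 1"
      using arg_cong[OF that(3), of "\<lambda>n. n mod N"] N that by (simp add: e_def)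
    then have 2: "Poly_Mapping.lookup m 2 + N * Poly_Mapping.lookup m 3 = Poly_Mapping.lookup m' 2 + N * Poly_Mapping.lookup m' 3"
      using that(3) \<open>N > 0\<close> by (simp add: e_def)
    then have 3: "Poly_Mapping.lookup m 2 = Poly_Mapping.lookup m' 2"
      using N[OF that(1), of 2] N[OF that(2), of 2] by (metis mod_less mod_mult_self2)
    with 2 have 4: "Poly_Mapping.lookup m 3 = Poly_Mapping.lookup m' 3"
      using \<open>N > 0\<close> by simp
    have "Poly_Mapping.lookup m i = Poly_Mapping.lookup m' i" for i
      using 1 3 4 exhaust_3[of i] by auto
    then show ?thesis by (rule poly_mapping_eqI)
  qed
  define X :: "3 \<Rightarrow> complex poly" where "X i = monom 1 (if i = 1 then 1 else if i = 2 then N else N * N)" for i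
  have "on_param X F = 0"
    using assms by (simp add: poly_eq_poly_eq_iff[symmetric] fun_eq_iff poly_on_param)
  moreover have "on_param X F = (\<Sum>m\<in>Poly_Mapping.keys F. monom (Poly_Mapping.lookup F m) (e m))"
    unfolding on_param_def ev_def X_def e_def
    by (intro sum.cong) (simp_all add: prod_3 monom_power mult_monom monom_0[symmetric] algebra_simps)
  ultimately have "coeff (\<Sum>m\<in>Poly_Mapping.keys F. monom (Poly_Mapping.lookup F m) (e m)) (e m0) = 0"
    by simp
  moreover have "coeff (\<Sum>m\<in>Poly_Mapping.keys F. monom (Poly_Mapping.lookup F m) (e m)) (e m0)
      = (\<Sum>m\<in>Poly_Mapping.keys F. if m = m0 then Poly_Mapping.lookup F m else 0)"
    unfolding coeff_sum using inj m0 by (intro sum.cong) (auto simp: coeff_monom)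
  ultimately show False
    using m0 by (simp add: in_keys_iff)
qed

lemma poly3_eqI:
  assumes "\<And>v. eval3 F v = eval3 G v"
  shows "F = G"
  using eval3_eq_zero_imp[of "F - G"] assms by simp

section \<open>Forms\<close>

lemma homogeneous_const: "homogeneous 0 (const3 a)"
  by (simp add: homogeneous_def const3_def mdeg_def)

lemma homogeneous_var: "homogeneous 1 (var3 i)"
  by (simp add: homogeneous_def var3_def mdeg_def lookup_single when_def)

lemma homogeneous_zero [simp]: "homogeneous d 0"
  by (simp add: homogeneous_def)

lemma homogeneous_add: "homogeneous d F \<Longrightarrow> homogeneous d G \<Longrightarrow> homogeneous d (F + G)"
  using keys_add[of F G] by (auto simp: homogeneous_def)

lemma homogeneous_uminus: "homogeneous d F \<Longrightarrow> homogeneous d (- F)"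
  by (auto simp: homogeneous_def in_keys_iff)

lemma homogeneous_diff: "homogeneous d F \<Longrightarrow> homogeneous d G \<Longrightarrow> homogeneous d (F - G)"
  using homogeneous_add[of d F "- G"] homogeneous_uminus by simp

lemma homogeneous_sum: "(\<And>a. a \<in> A \<Longrightarrow> homogeneous d (f a)) \<Longrightarrow> homogeneous d (\<Sum>a\<in>A. f a)"
  by (induction A rule: infinite_finite_induct) (auto intro: homogeneous_add)

lemma homogeneous_one: "homogeneous 0 1"
  using homogeneous_const[of 1] by (simp add: const3_def)

lemma homogeneous_numeral: "homogeneous 0 (numeral k)"
  using homogeneous_const[of "numeral k"] by (simp add: const3_def)

lemma homogeneous_power: "homogeneous d F \<Longrightarrow> homogeneous (n * d) (F ^ n)"
  by (induction n) (auto intro: homogeneous_one homogeneous_mult)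

lemma homogeneous_degree_unique:
  "homogeneous d F \<Longrightarrow> homogeneous e F \<Longrightarrow> F \<noteq> 0 \<Longrightarrow> d = e"
  using keys_nonempty[of F] by (auto simp: homogeneous_def)

lemma total_degree_homogeneous:
  assumes "homogeneous d F" "F \<noteq> 0"
  shows "total_degree F = d"
proof -
  have "mdeg ` Poly_Mapping.keys F = {d}"
    using assms keys_nonempty[of F] by (force simp: homogeneous_def)
  then show ?thesis by (simp add: total_degree_def)
qed

lemma homogeneous_0_const: 
  assumes "homogeneous 0 F" obtains a where "F = const3 a"
proof
  show "F = const3 (eval3 F 0)"
    by (rule poly3_eqI) (metis homogeneous_eval3[OF assms] eval3_simps(3) mult_1 power_0 vector_smult_lzero)
qed

lemma degree_on_param:
  assumes "homogeneous d F" "\<And>i. degree (X i) \<le> e"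
  shows "degree (on_param X F) \<le> d * e"
  unfolding on_param_def ev_def
proof (rule degree_sum_le)
  fix m assume "m \<in> Poly_Mapping.keys F"
  then have d: "(\<Sum>i\<in>UNIV. Poly_Mapping.lookup m i) = d"
    using assms(1) by (simp add: homogeneous_def mdeg_def)
  have "degree ([:Poly_Mapping.lookup F m:] * (\<Prod>i\<in>UNIV. X i ^ Poly_Mapping.lookup m i))
      \<le> degree (\<Prod>i\<in>UNIV. X i ^ Poly_Mapping.lookup m i)"
    by simp
  also have "\<dots> \<le> (\<Sum>i\<in>UNIV. degree (X i ^ Poly_Mapping.lookup m i))"
    using degree_prod_sum_le[of "UNIV :: 3 set" "\<lambda>i. X i ^ Poly_Mapping.lookup m i"]
    by (simp add: comp_def)
  also have "\<dots> \<le> (\<Sum>i\<in>UNIV. Poly_Mapping.lookup m i * e)"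
    by (intro sum_mono order_trans[OF degree_power_le])
      (simp add: assms(2) mult.commute mult_le_mono2)
  finally show "degree ([:Poly_Mapping.lookup F m:] * (\<Prod>i\<in>UNIV. X i ^ Poly_Mapping.lookup m i)) \<le> d * e"
    by (simp add: sum_distrib_right[symmetric] d)
qed simp


section \<open>Multiplicities along parametrized curves\<close>

text \<open>
  With the direction \<open>V\<close> itself depending on a parameter, \<open>F(p + q V)\<close> is a polynomial in \<open>q\<close>
  over the polynomials in that parameter, and its coefficients are the Taylor terms of \<open>F\<close> at \<open>p\<close>
  evaluated along \<open>V\<close>.  This makes the Taylor terms polynomial in the direction, although they
  are only given as functions of it.
\<close>
lemma taylor_along_curve:
  fixes V :: "3 \<Rightarrow> complex poly" and p :: "complex ^ 3"
  defines "B \<equiv> ev (\<lambda>a. [:[:a:]:]) (\<lambda>i. [:[:p $ i:], V i:])"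
  shows "poly (B F) q = on_param (\<lambda>i. [:p $ i:] + q * V i) F"
    and "poly (coeff (B F) k) h = taylor k F p (\<chi> i. poly (V i) h)"
proof -
  show "poly (B F) q = on_param (\<lambda>i. [:p $ i:] + q * V i) F"
    unfolding B_def on_param_def
    by (induction F rule: poly3_induct) (simp_all add: eval_poly.ev_simps eval_poly2.ev_simps)
  show "poly (coeff (B F) k) h = taylor k F p (\<chi> i. poly (V i) h)"
    unfolding B_def taylor_def along_conv_ev
  proof (induction F arbitrary: k rule: poly3_induct)
    case (mult F G)
    then show ?case by (simp add: eval_poly.ev_mult eval_poly2.ev_mult coeff_mult poly_sum)
  qed (simp_all add: eval_poly.ev_add eval_poly2.ev_add coeff_pCons split: nat.split)
qed

lemma taylor_0: "taylor 0 F p v = eval3 F p"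
  using poly_along[of F p v 0] by (simp add: taylor_def poly_0_coeff_0)

lemma taylor_below_mult3: "k < mult3 F p \<Longrightarrow> taylor k F p v = 0"
  unfolding mult3_def using not_less_Least by blast

lemma taylor_mult3_nonzero:
  assumes "F \<noteq> 0"
  obtains v where "taylor (mult3 F p) F p v \<noteq> 0"
proof -
  have "\<exists>k v. taylor k F p v \<noteq> 0"
  proof (rule ccontr)
    assume "\<not> ?thesis"
    then have "along F p v = 0" for v
      by (simp add: poly_eq_iff taylor_def)
    then have "eval3 F v = 0" for v
      using poly_along[of F p "v - p" 1] by simp
    then show False using assms eval3_eq_zero_imp by blast
  qed
  then have "\<exists>v. taylor (mult3 F p) F p v \<noteq> 0"
    unfolding mult3_def by (rule LeastI_ex)
  then show ?thesis using that by blast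
qed

lemma mult3_eqI:
  assumes "\<And>k v. k < m \<Longrightarrow> taylor k F p v = 0" "taylor m F p v \<noteq> 0"
  shows "mult3 F p = m"
  unfolding mult3_def using assms by (intro Least_equality) (auto simp: not_less[symmetric])

lemma mult3_eq_0_iff: "F \<noteq> 0 \<Longrightarrow> mult3 F p = 0 \<longleftrightarrow> eval3 F p \<noteq> 0"
  using taylor_below_mult3[of 0 F p 0] taylor_mult3_nonzero[of F p] mult3_eqI[of 0 F p 0]
  by (metis less_nat_zero_code not_gr_zero taylor_0)

lemma mult3_ge2_iff:
  "F \<noteq> 0 \<Longrightarrow> mult3 F p \<ge> 2 \<longleftrightarrow> eval3 F p = 0 \<and> (\<forall>v. taylor 1 F p v = 0)"
proof -
  assume F: "F \<noteq> 0"
  show ?thesis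
  proof
    assume "mult3 F p \<ge> 2"
    then show "eval3 F p = 0 \<and> (\<forall>v. taylor 1 F p v = 0)"
      using taylor_below_mult3[of 0 F p] taylor_below_mult3[of 1 F p] by (auto simp: taylor_0)
  next
    assume *: "eval3 F p = 0 \<and> (\<forall>v. taylor 1 F p v = 0)"
    obtain v where v: "taylor (mult3 F p) F p v \<noteq> 0"
      using taylor_mult3_nonzero[OF F] .
    have "mult3 F p \<noteq> 0" using * v by (intro notI) (simp add: taylor_0)
    moreover have "mult3 F p \<noteq> 1" using * v by (intro notI) simp
    ultimately show "mult3 F p \<ge> 2" by linarith
  qed
qed

text \<open>
  The local half of Bezout's theorem.  Writing the curve as \<open>X = p + (t - \<tau>) V\<close>, the terms of
  order below the multiplicity vanish for every direction, in particular for \<open>V\<close>, and each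
  remaining term carries a sufficiently high power of \<open>t - \<tau>\<close>.
\<close>
lemma mult3_dvd_on_param:
  assumes "\<And>i. poly (X i) \<tau> = p $ i"
  shows "[:- \<tau>, 1:] ^ mult3 F p dvd on_param X F"
proof -
  have "\<exists>V. X i = [:p $ i:] + [:- \<tau>, 1:] * V" for i
  proof -
    have "poly (X i - [:p $ i:]) \<tau> = 0" using assms by simp
    then have "[:- \<tau>, 1:] dvd X i - [:p $ i:]" by (simp only: poly_eq_0_iff_dvd)
    then obtain V where "X i - [:p $ i:] = [:- \<tau>, 1:] * V" by (auto elim: dvdE)
    then have "X i = [:p $ i:] + [:- \<tau>, 1:] * V" by (simp add: algebra_simps)
    then show ?thesis ..
  qed
  then obtain V where V: "\<And>i. X i = [:p $ i:] + [:- \<tau>, 1:] * V i" by metis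
  define B where "B = ev (\<lambda>a. [:[:a:]:]) (\<lambda>i. [:[:p $ i:], V i:]) F"
  have "coeff B k = 0" if "k < mult3 F p" for k
  proof -
    have "poly (coeff B k) h = 0" for h
      unfolding B_def taylor_along_curve(2) by (rule taylor_below_mult3[OF that])
    then show ?thesis by (simp add: poly_eq_poly_eq_iff[symmetric] fun_eq_iff)
  qed
  then have "monom 1 (mult3 F p) dvd B"
    by (simp add: monom_1_dvd_iff')
  then obtain R where "B = monom 1 (mult3 F p) * R" by (auto elim: dvdE)
  moreover have "X = (\<lambda>i. [:p $ i:] + [:- \<tau>, 1:] * V i)"
    using V by (rule ext)
  then have "on_param X F = poly B [:- \<tau>, 1:]"
    unfolding B_def taylor_along_curve(1) by (rule arg_cong)
  ultimately show ?thesis by (simp add: poly_monom)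
qed

lemma sum_order_le_degree:
  fixes f :: "complex poly"
  assumes "f \<noteq> 0" "finite T"
  shows "(\<Sum>\<tau>\<in>T. order \<tau> f) \<le> degree f"
  using assms(2,1)
proof (induction T arbitrary: f rule: finite_induct)
  case (insert a T)
  obtain g where g: "f = [:- a, 1:] ^ order a f * g" "\<not> [:- a, 1:] dvd g"
    using order_decomp[OF insert.prems] by blast
  have "g \<noteq> 0" using g(1) insert.prems by auto
  have "order \<tau> f = order \<tau> g" if "\<tau> \<in> T" for \<tau>
  proof -
    have "\<tau> \<noteq> a" using that insert.hyps by auto
    then have "order \<tau> ([:- a, 1:] ^ order a f) = 0"
      by (intro order_0I) (simp add: poly_power)
    then show ?thesis
      using order_mult[of "[:- a, 1:] ^ order a f" g \<tau>] g(1) insert.prems by simp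
  qed
  then have "(\<Sum>\<tau>\<in>T. order \<tau> f) = (\<Sum>\<tau>\<in>T. order \<tau> g)" by (rule sum.cong[OF refl])
  also have "\<dots> \<le> degree g" by (rule insert.IH[OF \<open>g \<noteq> 0\<close>])
  finally have "(\<Sum>\<tau>\<in>insert a T. order \<tau> f) \<le> order a f + degree g"
    using insert.hyps by simp
  also have "\<dots> = degree f"
    by (subst (2) g(1)) (use \<open>g \<noteq> 0\<close> in \<open>simp add: degree_mult_eq degree_linear_power\<close>)
  finally show ?case .
qed simp

lemma sum_mult3_le_on_param:
  assumes "on_param X F \<noteq> 0" "finite T"
  shows "(\<Sum>\<tau>\<in>T. mult3 F (\<chi> i. poly (X i) \<tau>)) \<le> degree (on_param X F)"
proof -
  have "mult3 F (\<chi> i. poly (X i) \<tau>) \<le> order \<tau> (on_param X F)" for \<tau>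
    using mult3_dvd_on_param[of X \<tau> "\<chi> i. poly (X i) \<tau>" F] order_divides assms(1) by auto
  then have "(\<Sum>\<tau>\<in>T. mult3 F (\<chi> i. poly (X i) \<tau>)) \<le> (\<Sum>\<tau>\<in>T. order \<tau> (on_param X F))"
    by (rule sum_mono)
  with sum_order_le_degree[OF assms] show ?thesis by linarith
qed

lemma taylor_mult: "taylor k (F * G) p v = (\<Sum>i\<le>k. taylor i F p v * taylor (k - i) G p v)"
  by (simp add: taylor_def along_mult coeff_mult)

text \<open>
  The leading form of a product is the product of the leading forms.  It is not the zero function:
  on a line joining a direction where the first factor is nonzero to one where the second is, both
  are nonzero polynomials in one variable.
\<close>
lemma mult3_mult:
  assumes "F \<noteq> 0" "G \<noteq> 0"
  shows "mult3 (F * G) p = mult3 F p + mult3 G p"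
proof -
  let ?m = "mult3 F p" and ?n = "mult3 G p"
  obtain v where v: "taylor ?m F p v \<noteq> 0" using taylor_mult3_nonzero[OF assms(1)] .
  obtain v' where v': "taylor ?n G p v' \<noteq> 0" using taylor_mult3_nonzero[OF assms(2)] .
  define V where "V i = [:v $ i, v' $ i - v $ i:]" for i
  define f where "f = coeff (ev (\<lambda>a. [:[:a:]:]) (\<lambda>i. [:[:p $ i:], V i:]) F) ?m"
  define g where "g = coeff (ev (\<lambda>a. [:[:a:]:]) (\<lambda>i. [:[:p $ i:], V i:]) G) ?n"
  have f: "poly f h = taylor ?m F p (\<chi> i. poly (V i) h)" for h
    unfolding f_def by (rule taylor_along_curve)
  have g: "poly g h = taylor ?n G p (\<chi> i. poly (V i) h)" for h
    unfolding g_def by (rule taylor_along_curve)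
  have "poly f 0 \<noteq> 0" "poly g 1 \<noteq> 0"
    using v v' by (simp_all add: f g V_def vec_eq_iff)
  then have "f * g \<noteq> 0" by auto
  then obtain h where "poly (f * g) h \<noteq> 0"
    by (metis poly_0 poly_eq_poly_eq_iff ext)
  then obtain u where u: "taylor ?m F p u \<noteq> 0" "taylor ?n G p u \<noteq> 0"
    by (auto simp: f g)
  show ?thesis
  proof (rule mult3_eqI)
    fix k u assume "k < ?m + ?n"
    then have "taylor i F p u * taylor (k - i) G p u = 0" if "i \<le> k" for i
      using that by (cases "i < ?m") (auto simp: taylor_below_mult3)
    then show "taylor k (F * G) p u = 0" unfolding taylor_mult by (intro sum.neutral) simp
  next
    have "taylor i F p u * taylor (?m + ?n - i) G p u
        = (if i = ?m then taylor ?m F p u * taylor ?n G p u else 0)" if "i \<le> ?m + ?n" for i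
    proof (cases i ?m rule: linorder_cases)
      case greater
      then have "?m + ?n - i < ?n" using that by linarith
      then show ?thesis using greater by (simp add: taylor_below_mult3)
    qed (simp_all add: taylor_below_mult3)
    then have "taylor (?m + ?n) (F * G) p u = taylor ?m F p u * taylor ?n G p u"
      unfolding taylor_mult by (subst sum.cong[OF refl]) auto
    then show "taylor (?m + ?n) (F * G) p u \<noteq> 0" using u by simp
  qed
qed

section \<open>Factors of forms\<close>

interpretation eval_graded: scalar_hom "\<lambda>a. [:const3 a:]"
  by unfold_locales (simp_all add: const3_def single_add mult_single mult.commute one_pCons)

text \<open>
  The variables are tagged by a further variable \<open>T\<close>, so that the coefficient of \<open>T^d\<close> is the
  homogeneous part of degree \<open>d\<close>, and forms are exactly the polynomials with a monomial as image.
\<close>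
definition graded :: "poly3 \<Rightarrow> poly3 poly" where
  "graded = ev (\<lambda>a. [:const3 a:]) (\<lambda>i. monom (var3 i) 1)"

lemma graded_conv_sum:
  "graded F = (\<Sum>m\<in>Poly_Mapping.keys F. monom (Poly_Mapping.single m (Poly_Mapping.lookup F m)) (mdeg m))"
proof -
  have "(\<Prod>i\<in>A. monom (var3 i) 1 ^ f i) = monom (\<Prod>i\<in>A. var3 i ^ f i) (\<Sum>i\<in>A. f i)"
    for A :: "3 set" and f
    by (induction A rule: infinite_finite_induct) (simp_all add: monom_power mult_monom)
  then show ?thesis
    unfolding graded_def ev_def mdeg_def
    by (intro sum.cong refl) (subst monomial_expansion, simp add: smult_monom)
qed

lemma graded_homogeneous: "homogeneous d F \<Longrightarrow> graded F = monom F d"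
proof -
  assume d: "homogeneous d F"
  have "graded F = (\<Sum>m\<in>Poly_Mapping.keys F. monom (Poly_Mapping.single m (Poly_Mapping.lookup F m)) d)"
    unfolding graded_conv_sum using d by (intro sum.cong) (auto simp: homogeneous_def)
  also have "\<dots> = monom (\<Sum>m\<in>Poly_Mapping.keys F. Poly_Mapping.single m (Poly_Mapping.lookup F m)) d"
    by (induction "Poly_Mapping.keys F" rule: infinite_finite_induct) (simp_all add: monom_sum)
  also have "(\<Sum>m\<in>Poly_Mapping.keys F. Poly_Mapping.single m (Poly_Mapping.lookup F m)) = F"
    by (rule sum_monomials)
  finally show ?thesis .
qed

lemma homogeneous_graded: 
  assumes "graded F = monom G d" shows "homogeneous d F"
  unfolding homogeneous_def
proof
  fix m assume m: "m \<in> Poly_Mapping.keys F"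
  have "Poly_Mapping.lookup (coeff (graded F) (mdeg m)) m = 
     (\<Sum>m'\<in>Poly_Mapping.keys F. if m' = m then Poly_Mapping.lookup F m else 0)"
    unfolding graded_conv_sum coeff_sum lookup_sum
    by (intro sum.cong) (auto simp: coeff_monom lookup_single when_def)
  also have "\<dots> \<noteq> 0" using m by (simp add: in_keys_iff)
  finally show "mdeg m = d" using assms by (auto simp: coeff_monom split: if_splits)
qed

text \<open>
  Over a domain both the degree and the order at zero of a product are sums, and a monomial is
  characterized by the equality of the two.
\<close>
lemma mult_eq_monom:
  fixes f g :: "'a::idom poly"
  assumes "f * g = monom c d" "c \<noteq> 0"
  obtains a b i j where "f = monom a i" "g = monom b j" "i + j = d"
proof -
  have "f \<noteq> 0" "g \<noteq> 0" using assms by auto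
  define i j where "i = order 0 f" and "j = order 0 g"
  obtain f' where f': "f = monom 1 i * f'" "poly f' 0 \<noteq> 0"
    using order_decomp[OF \<open>f \<noteq> 0\<close>, of 0] by (auto simp: i_def monom_altdef poly_eq_0_iff_dvd)
  obtain g' where g': "g = monom 1 j * g'" "poly g' 0 \<noteq> 0"
    using order_decomp[OF \<open>g \<noteq> 0\<close>, of 0] by (auto simp: j_def monom_altdef poly_eq_0_iff_dvd)
  have fg: "monom c d = monom 1 (i + j) * (f' * g')"
  proof -
    have "monom (1::'a) (i + j) = monom 1 i * monom 1 j" by (simp add: mult_monom)
    then show ?thesis by (simp only: assms(1)[symmetric] f'(1)[symmetric] g'(1)[symmetric] ac_simps)
        (subst f'(1), subst g'(1), simp only: ac_simps)
  qed
  have "coeff (monom c d) (i + j) = coeff (f' * g') 0"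
    unfolding fg by (simp add: coeff_monom_mult)
  also have "\<dots> \<noteq> 0" using f'(2) g'(2) by (simp add: poly_0_coeff_0 coeff_mult)
  finally have d: "i + j = d" by (simp add: coeff_monom split: if_splits)
  have "monom 1 d * (f' * g') = monom 1 d * [:c:]"
    using fg d by (simp add: monom_0[symmetric] mult_monom)
  then have "f' * g' = [:c:]"
    by (subst (asm) mult_cancel_left) simp
  moreover have "f' \<noteq> 0" "g' \<noteq> 0" using f'(2) g'(2) by auto
  ultimately have "degree f' + degree g' = 0"
    using degree_mult_eq[of f' g'] by simp
  then obtain a b where "f' = [:a:]" "g' = [:b:]" by (auto elim!: degree_eq_zeroE)
  then have "f = monom a i" "g = monom b j"
    using f'(1) g'(1) by (simp_all add: monom_0[symmetric] mult_monom)
  then show ?thesis using d that by blast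
qed

lemma homogeneous_factors:
  assumes "homogeneous d (F * G)" "F * G \<noteq> 0"
  obtains a b where "homogeneous a F" "homogeneous b G" "a + b = d"
proof -
  have "graded F * graded G = monom (F * G) d"
    using graded_homogeneous[OF assms(1)] by (simp add: graded_def eval_graded.ev_mult)
  then obtain A B a b where "graded F = monom A a" "graded G = monom B b" "a + b = d"
    using mult_eq_monom assms(2) by metis
  then show ?thesis using that homogeneous_graded by blast
qed


section \<open>Rational curves and an inequality of Bezout\<close>

lemma mult3_scale:
  assumes "homogeneous d F" "c \<noteq> 0"
  shows "mult3 F (c *s p) = mult3 F p"
  unfolding mult3_def using assms by (simp add: taylor_point)

lemma vec3_eqI: "x $ 1 = y $ 1 \<Longrightarrow> x $ 2 = y $ 2 \<Longrightarrow> x $ 3 = y $ 3 \<Longrightarrow> x = (y :: complex ^ 3)"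
  by (simp add: vec_eq_iff forall_3)

text \<open>
  The two parameters occupy the first two coordinates; the third coordinate is set to zero so that
  binary forms can be ternary polynomials, to which the substitution lemmas apply.
\<close>
definition param3 :: "(3 \<Rightarrow> poly3) \<Rightarrow> complex \<Rightarrow> complex \<Rightarrow> complex ^ 3" where
  "param3 \<phi> s r = (\<chi> i. eval3 (\<phi> i) (vector [s, r, 0]))"

text \<open>
  A curve \<open>Q = 0\<close> with a parametrization by binary forms of degree \<open>e\<close> which is onto and detects
  divisibility by \<open>Q\<close>.  The condition on the kernel plays the role of the Nullstellensatz for
  \<open>Q\<close>.
\<close>
locale rational_curve =
  fixes Q :: poly3 and \<phi> :: "3 \<Rightarrow> poly3" and e :: nat
  assumes nonzero: "Q \<noteq> 0"
    and forms: "homogeneous e (\<phi> i)"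
    and binary: "eval3 (\<phi> i) v = eval3 (\<phi> i) (vector [v $ 1, v $ 2, 0])"
    and kernel: "subst3 \<phi> F = 0 \<longleftrightarrow> Q dvd F"
    and onto: "x \<noteq> 0 \<Longrightarrow> eval3 Q x = 0 \<Longrightarrow> \<exists>s r k. (s \<noteq> 0 \<or> r \<noteq> 0) \<and> k \<noteq> 0 \<and> x = k *s param3 \<phi> s r"
begin

lemma not_dvd_one: "\<not> Q dvd 1"
  by (simp add: kernel[symmetric])

lemma dvd_mult_iff: "Q dvd F * G \<longleftrightarrow> Q dvd F \<or> Q dvd G"
  by (simp add: kernel[symmetric])

lemma irreducible_Q: "irreducible Q"
proof (rule irreducibleI)
  have unit: "G dvd 1" if FG: "Q = F * G" and dvd: "Q dvd F" for F G
  proof -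
    obtain H where H: "F = Q * H" using dvd by (rule dvdE)
    have "Q * (H * G) = F * G" unfolding H by (rule mult.assoc[symmetric])
    also have "\<dots> = Q * 1" using FG by simp
    finally have "Q * (H * G) = Q * 1" .
    then have "H * G = 1" using nonzero by (subst (asm) mult_cancel_left) simp
    then show ?thesis by (metis dvd_triv_right)
  qed
  fix F G assume FG: "Q = F * G"
  then have "Q dvd F \<or> Q dvd G" using dvd_mult_iff by (metis dvd_refl)
  then show "F dvd 1 \<or> G dvd 1" using unit[of F G] unit[of G F] FG by (auto simp: mult.commute)
qed (simp_all add: nonzero not_dvd_one)

lemma param3_scale: "param3 \<phi> (c * s) (c * r) = c ^ e *s param3 \<phi> s r"
proof -
  have "vector [c * s, c * r, 0] = c *s (vector [s, r, 0] :: complex ^ 3)"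
    by (rule vec3_eqI) simp_all
  then show ?thesis
    by (simp add: param3_def vec_eq_iff[of "\<chi> i. _ i"] homogeneous_eval3[OF forms])
qed

text \<open>
  The restriction of \<open>F\<close> to the curve is a form of degree \<open>e * d\<close> in two variables, and it has at
  the parameter of a point a zero of order at least the multiplicity of \<open>F\<close> there.
\<close>
lemma bezout:
  assumes F: "homogeneous d F" and ndvd: "\<not> Q dvd F"
    and S: "finite S" "\<And>x. x \<in> S \<Longrightarrow> x \<noteq> 0" "\<And>x. x \<in> S \<Longrightarrow> eval3 Q x = 0"
    and distinct: "\<And>x y. x \<in> S \<Longrightarrow> y \<in> S \<Longrightarrow> proj_rel x y \<Longrightarrow> x = y"
  shows "(\<Sum>x\<in>S. mult3 F x) \<le> e * d"
proof -
  have "\<forall>x\<in>S. \<exists>s r k. (s \<noteq> 0 \<or> r \<noteq> 0) \<and> k \<noteq> 0 \<and> x = k *s param3 \<phi> s r"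
    using S onto by blast
  then obtain s r k where srk: "\<And>x. x \<in> S \<Longrightarrow> s x \<noteq> 0 \<or> r x \<noteq> 0" "\<And>x. x \<in> S \<Longrightarrow> k x \<noteq> 0"
    "\<And>x. x \<in> S \<Longrightarrow> x = k x *s param3 \<phi> (s x) (r x)"
    by metis
  \<comment> \<open>The affine chart \<open>(t, 1 - \<beta> t)\<close> of the parameter line omits only the point \<open>(1, - \<beta>)\<close>;
    \<open>\<beta>\<close> is chosen so that this is not the parameter of a point of \<open>S\<close>.\<close>
  obtain \<beta> where \<beta>: "\<beta> \<notin> (\<lambda>x. - r x / s x) ` S"
    using ex_new_if_finite[OF infinite_UNIV_char_0] S(1) by (metis finite_imageI)
  have nz: "r x + \<beta> * s x \<noteq> 0" if "x \<in> S" for x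
  proof
    assume *: "r x + \<beta> * s x = 0"
    then have "s x \<noteq> 0" using srk(1)[OF that] by auto
    then have "\<beta> = - r x / s x" using * by (simp add: field_simps add_eq_0_iff)
    with \<beta> that show False by blast
  qed
  define \<tau> where "\<tau> x = s x / (r x + \<beta> * s x)" for x
  define X where "X i = on_param (\<lambda>j. if j = 1 then [:0, 1:] else if j = 2 then [:1, - \<beta>:] else 0) (\<phi> i)" for i
  have vecX: "(\<chi> i. poly (X i) t) = param3 \<phi> t (1 - \<beta> * t)" for t
  proof -
    have "(\<chi> j. poly (if j = 1 then [:0, 1:] else if j = 2 then [:1, - \<beta>:] else 0) t) = (vector [t, 1 - \<beta> * t, 0] :: complex ^ 3)"
      by (rule vec3_eqI) simp_all
    then show ?thesis by (simp add: X_def poly_on_param param3_def vec_eq_iff)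
  qed
  have X\<tau>: "\<exists>c. c \<noteq> 0 \<and> param3 \<phi> (\<tau> x) (1 - \<beta> * \<tau> x) = c *s x" if x: "x \<in> S" for x
  proof -
    define c where "c = 1 / (r x + \<beta> * s x)"
    have "c \<noteq> 0" using nz[OF x] by (simp add: c_def)
    have "\<tau> x = c * s x" "1 - \<beta> * \<tau> x = c * r x"
      using nz[OF x] by (simp_all add: \<tau>_def c_def field_simps)
    then have "param3 \<phi> (\<tau> x) (1 - \<beta> * \<tau> x) = c ^ e *s param3 \<phi> (s x) (r x)"
      by (simp add: param3_scale)
    also have "\<dots> = (c ^ e / k x) *s (k x *s param3 \<phi> (s x) (r x))"
      using srk(2)[OF x] by (simp add: vector_smult_assoc)
    also have "k x *s param3 \<phi> (s x) (r x) = x" using srk(3)[OF x] by simp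
    finally show ?thesis using \<open>c \<noteq> 0\<close> srk(2)[OF x] by (intro exI[of _ "c ^ e / k x"]) auto
  qed
  have inj: "inj_on \<tau> S"
  proof (rule inj_onI)
    fix x y assume x: "x \<in> S" and y: "y \<in> S" and eq: "\<tau> x = \<tau> y"
    obtain a b where "a \<noteq> 0" "b \<noteq> 0" "a *s x = b *s y"
      using X\<tau>[OF x] X\<tau>[OF y] eq by auto
    then have "y = (a / b) *s x" "a / b \<noteq> 0"
      by (auto simp: vec_eq_iff field_simps)
    then have "proj_rel x y" using S(2) x y by (auto simp: proj_rel_def)
    then show "x = y" by (rule distinct[OF x y])
  qed
  have "on_param X F \<noteq> 0"
  proof
    assume 0: "on_param X F = 0"
    \<comment> \<open>The factor kills the parameters outside of the chart, where nothing is known about \<open>F\<close>.\<close>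
    have "eval3 (subst3 \<phi> F * (var3 2 + const3 \<beta> * var3 1)) v = 0" for v
    proof (cases "v $ 2 + \<beta> * v $ 1 = 0")
      case False
      define c where "c = v $ 2 + \<beta> * v $ 1"
      define t where "t = v $ 1 / c"
      have "c \<noteq> 0" using False by (simp add: c_def)
      have v: "v $ 1 = c * t" "v $ 2 = c * (1 - \<beta> * t)"
        using \<open>c \<noteq> 0\<close> by (simp_all add: t_def field_simps c_def)
      have "(\<chi> i. eval3 (\<phi> i) v) = param3 \<phi> (v $ 1) (v $ 2)"
        by (simp add: param3_def vec_eq_iff binary[of _ v])
      also have "\<dots> = c ^ e *s param3 \<phi> t (1 - \<beta> * t)"
        unfolding v by (rule param3_scale)
      finally have "eval3 (subst3 \<phi> F) v = (c ^ e) ^ d * poly (on_param X F) t"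
        by (simp add: homogeneous_eval3[OF F] poly_on_param vecX)
      then show ?thesis using 0 by simp
    qed simp
    then have "subst3 \<phi> F * (var3 2 + const3 \<beta> * var3 1) = 0"
      by (rule eval3_eq_zero_imp)
    moreover have "eval3 (var3 2 + const3 \<beta> * var3 1) (vector [0, 1, 0]) \<noteq> 0" by simp
    then have "var3 2 + const3 \<beta> * var3 1 \<noteq> 0" by fastforce
    ultimately show False using ndvd kernel by simp
  qed
  then have "(\<Sum>t\<in>\<tau> ` S. mult3 F (\<chi> i. poly (X i) t)) \<le> degree (on_param X F)"
    using S(1) by (intro sum_mult3_le_on_param) auto
  also have "\<dots> \<le> d * e"
  proof (rule degree_on_param[OF F])
    show "degree (X i) \<le> e" for i
      unfolding X_def by (rule order_trans[OF degree_on_param[OF forms, where e = 1]]) simp_all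
  qed
  also have "(\<Sum>t\<in>\<tau> ` S. mult3 F (\<chi> i. poly (X i) t)) = (\<Sum>x\<in>S. mult3 F x)"
    unfolding sum.reindex[OF inj]
  proof (rule sum.cong[OF refl])
    fix x assume "x \<in> S"
    then obtain c where "c \<noteq> 0" "param3 \<phi> (\<tau> x) (1 - \<beta> * \<tau> x) = c *s x" using X\<tau> by blast
    then have "param3 \<phi> (\<tau> x) (1 - \<beta> * \<tau> x) = c *s x" "mult3 F (c *s x) = mult3 F x"
      using mult3_scale[OF F] by auto
    then show "((\<lambda>t. mult3 F (\<chi> i. poly (X i) t)) \<circ> \<tau>) x = mult3 F x"
      by (simp only: comp_def vecX)
  qed
  finally show ?thesis by (simp add: mult.commute)
qed

end

definition lin3 :: "complex ^ 3 ^ 3 \<Rightarrow> 3 \<Rightarrow> poly3" where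
  "lin3 A i = (\<Sum>j\<in>UNIV. const3 (A $ i $ j) * var3 j)"

lemma eval3_sum [simp]: "eval3 (sum f S) v = (\<Sum>a\<in>S. eval3 (f a) v)"
  by (induction S rule: infinite_finite_induct) simp_all

lemma eval3_lin3: "(\<chi> i. eval3 (lin3 A i) v) = A *v v"
  by (simp add: lin3_def matrix_vector_mult_def)

lemma eval3_subst3_lin3 [simp]: "eval3 (subst3 (lin3 A) F) v = eval3 F (A *v v)"
  by (simp add: eval3_lin3)

lemma const3_eq_0_iff: "const3 a = 0 \<longleftrightarrow> a = 0"
  by (metis eval3_simps(1,3) const3_def single_zero)

text \<open>
  All lines, and all smooth conics, are projectively equivalent; it therefore suffices to
  parametrize one of each.
\<close>
lemma rational_curve_transport:
  assumes rc: "rational_curve Q \<psi> e"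
    and AB: "A ** B = mat 1" and R: "\<And>x. eval3 R (A *v x) = \<kappa> * eval3 Q x" and \<kappa>: "\<kappa> \<noteq> 0"
  shows "rational_curve R (\<lambda>i. subst3 \<psi> (lin3 A i)) e"
proof -
  interpret rational_curve Q \<psi> e by (rule rc)
  have ABx: "A *v (B *v x) = x" for x
    by (simp add: matrix_vector_mul_assoc AB)
  have Rs: "subst3 (lin3 A) R = const3 \<kappa> * Q"
    by (rule poly3_eqI) (simp add: R del: eval3_subst3)
  have Qs: "R = const3 \<kappa> * subst3 (lin3 B) Q"
    by (rule poly3_eqI) (simp add: R[symmetric] ABx del: eval3_subst3)
  have roundtrip: "F = subst3 (lin3 B) (subst3 (lin3 A) F)" for F
    by (rule poly3_eqI) (simp add: ABx del: eval3_subst3)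
  have comp: "subst3 (\<lambda>i. subst3 \<psi> (lin3 A i)) F = subst3 \<psi> (subst3 (lin3 A) F)" for F
    by (rule poly3_eqI) (simp only: eval3_subst3 vec_lambda_beta)
  have param: "param3 (\<lambda>i. subst3 \<psi> (lin3 A i)) s r = A *v param3 \<psi> s r" for s r
    by (simp add: param3_def lin3_def matrix_vector_mult_def)
  show ?thesis
  proof
    show "R \<noteq> 0"
    proof
      assume "R = 0"
      then have "const3 \<kappa> * Q = 0" using Rs by simp
      then show False using \<kappa> nonzero by (simp add: const3_eq_0_iff)
    qed
    fix i
    show "homogeneous e (subst3 \<psi> (lin3 A i))"
      unfolding lin3_def subst3_def eval_poly3.ev_sum
      using homogeneous_mult[OF homogeneous_const forms]
      by (intro homogeneous_sum) (simp add: eval_poly3.ev_mult)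
    show "eval3 (subst3 \<psi> (lin3 A i)) v = eval3 (subst3 \<psi> (lin3 A i)) (vector [v $ 1, v $ 2, 0])" for v
      by (simp add: binary[of _ v])
  next
    fix F
    show "subst3 (\<lambda>i. subst3 \<psi> (lin3 A i)) F = 0 \<longleftrightarrow> R dvd F"
    proof
      assume "subst3 (\<lambda>i. subst3 \<psi> (lin3 A i)) F = 0"
      then obtain G where "subst3 (lin3 A) F = Q * G" by (auto simp: comp kernel elim: dvdE)
      then have "F = subst3 (lin3 B) Q * subst3 (lin3 B) G" using roundtrip[of F] by simp
      moreover have "const3 \<kappa> * const3 (1 / \<kappa>) = 1"
        using \<kappa> by (simp add: const3_def mult_single)
      ultimately have "F = (const3 \<kappa> * const3 (1 / \<kappa>)) * (subst3 (lin3 B) Q * subst3 (lin3 B) G)"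
        by simp
      also have "\<dots> = R * (const3 (1 / \<kappa>) * subst3 (lin3 B) G)"
        unfolding Qs by (simp only: ac_simps)
      finally have "F = R * (const3 (1 / \<kappa>) * subst3 (lin3 B) G)" .
      then show "R dvd F" by (rule dvdI)
    next
      assume "R dvd F"
      then obtain G where "F = R * G" ..
      then have "Q dvd subst3 (lin3 A) F" by (simp add: Rs)
      then show "subst3 (\<lambda>i. subst3 \<psi> (lin3 A i)) F = 0" by (simp add: comp kernel)
    qed
  next
    fix x :: "complex ^ 3" assume x: "x \<noteq> 0" "eval3 R x = 0"
    have "B *v x \<noteq> 0" using x(1) ABx[of x] by (metis matrix_vector_mult_0_right)
    moreover have "eval3 Q (B *v x) = 0" using R[of "B *v x"] x(2) \<kappa> by (simp add: ABx)
    ultimately obtain s r k where *: "s \<noteq> 0 \<or> r \<noteq> 0" "k \<noteq> 0" "B *v x = k *s param3 \<psi> s r"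
      using onto by blast
    have "x = A *v (k *s param3 \<psi> s r)" using ABx[of x] *(3) by simp
    then have "x = k *s param3 (\<lambda>i. subst3 \<psi> (lin3 A i)) s r"
      by (simp add: param vector_scalar_commute)
    with * show "\<exists>s r k. (s \<noteq> 0 \<or> r \<noteq> 0) \<and> k \<noteq> 0 \<and> x = k *s param3 (\<lambda>i. subst3 \<psi> (lin3 A i)) s r"
      by blast
  qed
qed

text \<open>
  Dropping all monomials that contain \<open>x\<close> changes \<open>F\<close> by a multiple of \<open>x\<close>, and the remaining
  polynomial in \<open>y\<close> and \<open>z\<close> is the restriction to the line.
\<close>
lemma rational_curve_line:
  "rational_curve (var3 1) (\<lambda>i. if i = 1 then 0 else if i = 2 then var3 1 else var3 2) 1"
  (is "rational_curve _ ?\<psi> _")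
proof
  show "var3 1 \<noteq> 0" by (metis eval3_simps(1,4) vector_3(1) zero_neq_one)
  show "homogeneous 1 (?\<psi> i)" for i using homogeneous_var by simp
  show "eval3 (?\<psi> i) v = eval3 (?\<psi> i) (vector [v $ 1, v $ 2, 0])" for i v by simp
next
  fix F
  show "subst3 ?\<psi> F = 0 \<longleftrightarrow> var3 1 dvd F"
  proof
    assume 0: "subst3 ?\<psi> F = 0"
    define N where "N = subst3 (\<lambda>i. if i = 1 then 0 else var3 i)"
    have "var3 1 dvd F - N F" for F
    proof (induction F rule: poly3_induct)
      case (add F G)
      then have "var3 1 dvd (F - N F) + (G - N G)" by (rule dvd_add)
      then show ?case by (simp add: N_def algebra_simps)
    next
      case (mult F G)
      then have "var3 1 dvd (F - N F) * G + N F * (G - N G)"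
        by (intro dvd_add[OF dvd_mult2 dvd_mult])
      then show ?case by (simp add: N_def algebra_simps)
    qed (auto simp: N_def)
    moreover have "N F = 0"
    proof (rule eval3_eq_zero_imp)
      fix v :: "complex ^ 3"
      have "(\<chi> i. eval3 (if i = 1 then 0 else var3 i) v) = (\<chi> i. eval3 (?\<psi> i) (vector [v $ 2, v $ 3, 0]))"
        by (rule vec3_eqI) simp_all
      then have "eval3 (N F) v = eval3 (subst3 ?\<psi> F) (vector [v $ 2, v $ 3, 0])"
        by (simp add: N_def)
      then show "eval3 (N F) v = 0" using 0 by simp
    qed
    ultimately show "var3 1 dvd F" by (metis diff_zero)
  qed (auto elim!: dvdE)
next
  fix x :: "complex ^ 3" assume x: "x \<noteq> 0" "eval3 (var3 1) x = 0"
  then have "x = 1 *s param3 ?\<psi> (x $ 2) (x $ 3)" (is "_ = _ *s ?y")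
    by (intro vec3_eqI) (simp_all add: param3_def)
  moreover have "x $ 2 \<noteq> 0 \<or> x $ 3 \<noteq> 0"
    using x by (auto simp: vec_eq_iff forall_3)
  ultimately show "\<exists>s r k. (s \<noteq> 0 \<or> r \<noteq> 0) \<and> k \<noteq> 0 \<and> x = k *s param3 ?\<psi> s r"
    by (intro exI[of _ "x $ 2"] exI[of _ "x $ 3"] exI[of _ 1]) simp
qed

text \<open>
  Modulo \<open>y^2 - xz\<close> every polynomial is \<open>A + y B\<close> with \<open>A\<close> and \<open>B\<close> free of \<open>y\<close>.  On
  \<open>(s^2, s r, r^2)\<close> the two summands are the even and the odd part with respect to \<open>s\<close>, so that if
  the sum vanishes both do.
\<close>
lemma rational_curve_conic:
  "rational_curve ((var3 2)\<^sup>2 - var3 1 * var3 3)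
     (\<lambda>i. if i = 1 then (var3 1)\<^sup>2 else if i = 2 then var3 1 * var3 2 else (var3 2)\<^sup>2) 2"
  (is "rational_curve ?Q ?\<psi> _")
proof
  have "eval3 ?Q (vector [0, 1, 0]) \<noteq> 0" by simp
  then show "?Q \<noteq> 0" by fastforce
  show "homogeneous 2 (?\<psi> i)" for i
    using homogeneous_power[OF homogeneous_var, of 2] homogeneous_mult[OF homogeneous_var homogeneous_var]
    by (simp add: numeral_2_eq_2)
  show "eval3 (?\<psi> i) v = eval3 (?\<psi> i) (vector [v $ 1, v $ 2, 0])" for i v by simp
next
  fix F
  have param: "(\<chi> i. eval3 (?\<psi> i) v) = vector [(v $ 1)\<^sup>2, v $ 1 * v $ 2, (v $ 2)\<^sup>2]" for v
    by (rule vec3_eqI) simp_all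
  have Q0: "subst3 ?\<psi> ?Q = 0" by (simp add: power_mult_distrib)
  show "subst3 ?\<psi> F = 0 \<longleftrightarrow> ?Q dvd F"
  proof
    assume 0: "subst3 ?\<psi> F = 0"
    define flat where "flat A \<longleftrightarrow> (\<forall>v. eval3 A v = eval3 A (vector [v $ 1, 0, v $ 3]))" for A
    have ring_id: "(f - (a + y * b)) * g + (a + y * b) * (g - (a' + y * b')) + (y\<^sup>2 - x * z) * (b * b')
        = f * g - ((a * a' + x * z * b * b') + y * (a * b' + a' * b))" for f g a b a' b' x y z :: poly3
      by (simp add: algebra_simps power2_eq_square)
    have "\<exists>A B. flat A \<and> flat B \<and> ?Q dvd F - (A + var3 2 * B)"
    proof (induction F rule: poly3_induct)
      case (const a)
      show ?case by (intro exI[of _ "const3 a"] exI[of _ 0]) (simp add: flat_def)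
    next
      case (var i)
      show ?case
      proof (cases "i = 2")
        case True
        then show ?thesis by (intro exI[of _ 0] exI[of _ 1]) (simp add: flat_def)
      next
        case False
        then have "flat (var3 i)" using exhaust_3[of i] by (auto simp: flat_def)
        then show ?thesis by (intro exI[of _ "var3 i"] exI[of _ 0]) (simp add: flat_def)
      qed
    next
      case (add F G)
      then obtain A B A' B' where *: "flat A" "flat B" "?Q dvd F - (A + var3 2 * B)"
        "flat A'" "flat B'" "?Q dvd G - (A' + var3 2 * B')" by blast
      have "?Q dvd (F - (A + var3 2 * B)) + (G - (A' + var3 2 * B'))" using * by (intro dvd_add)
      also have "\<dots> = F + G - ((A + A') + var3 2 * (B + B'))" by (simp add: algebra_simps)
      finally show ?case using * by (intro exI[of _ "A + A'"] exI[of _ "B + B'"]) (simp add: flat_def)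
    next
      case (mult F G)
      then obtain A B A' B' where *: "flat A" "flat B" "?Q dvd F - (A + var3 2 * B)"
        "flat A'" "flat B'" "?Q dvd G - (A' + var3 2 * B')" by blast
      have "?Q dvd (F - (A + var3 2 * B)) * G + (A + var3 2 * B) * (G - (A' + var3 2 * B')) + ?Q * (B * B')"
        by (rule dvd_add[OF dvd_add[OF dvd_mult2[OF *(3)] dvd_mult[OF *(6)]] dvd_triv_left])
      also have "\<dots> = F * G - ((A * A' + var3 1 * var3 3 * B * B') + var3 2 * (A * B' + A' * B))"
        by (rule ring_id)
      finally show ?case using *
        by (intro exI[of _ "A * A' + var3 1 * var3 3 * B * B'"] exI[of _ "A * B' + A' * B"])
          (simp add: flat_def)
    qed
    then obtain A B where AB: "flat A" "flat B" "?Q dvd F - (A + var3 2 * B)" by blast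
    obtain C where C: "F - (A + var3 2 * B) = ?Q * C" using AB(3) by (rule dvdE)
    have "subst3 ?\<psi> (F - (A + var3 2 * B)) = 0"
      by (simp only: C subst3_simps(6) Q0 mult_zero_left)
    then have sum: "subst3 ?\<psi> (A + var3 2 * B) = 0"
      using 0 by (simp only: subst3_simps(7) diff_0 neg_equal_0_iff_equal)
    have both: "eval3 A (vector [s\<^sup>2, 0, r\<^sup>2]) = 0 \<and> s * r * eval3 B (vector [s\<^sup>2, 0, r\<^sup>2]) = 0" for s r
    proof -
      have "eval3 A (vector [s\<^sup>2, 0, r\<^sup>2]) + s * r * eval3 B (vector [s\<^sup>2, 0, r\<^sup>2]) = 0" for s
      proof -
        have "eval3 (subst3 ?\<psi> (A + var3 2 * B)) (vector [s, r, 0]) = 0" using sum by simp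
        moreover have "eval3 C (vector [s\<^sup>2, s * r, r\<^sup>2]) = eval3 C (vector [s\<^sup>2, 0, r\<^sup>2])" if "flat C" for C
          using that[unfolded flat_def, rule_format, of "vector [s\<^sup>2, s * r, r\<^sup>2]"] by simp
        ultimately show ?thesis using AB(1,2) by (simp add: param)
      qed
      \<comment> \<open>Changing the sign of \<open>s\<close> separates the even from the odd part.\<close>
      from this[of s] this[of "- s"] show ?thesis by (simp add: algebra_simps)
    qed
    have "A = 0"
    proof (rule eval3_eq_zero_imp)
      fix v :: "complex ^ 3"
      show "eval3 A v = 0"
        using both[of "csqrt (v $ 1)" "csqrt (v $ 3)"] AB(1)[unfolded flat_def, rule_format, of v] by simp
    qed
    have "var3 1 * var3 3 * B = 0"
    proof (rule eval3_eq_zero_imp)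
      fix v :: "complex ^ 3"
      have "csqrt (v $ 1) * csqrt (v $ 3) * (csqrt (v $ 1) * csqrt (v $ 3) * eval3 B v) = 0"
        using both[of "csqrt (v $ 1)" "csqrt (v $ 3)"] AB(2)[unfolded flat_def, rule_format, of v] by simp
      also have "csqrt (v $ 1) * csqrt (v $ 3) * (csqrt (v $ 1) * csqrt (v $ 3) * eval3 B v) = (csqrt (v $ 1))\<^sup>2 * (csqrt (v $ 3))\<^sup>2 * eval3 B v"
        by (simp only: power2_eq_square ac_simps)
      finally show "eval3 (var3 1 * var3 3 * B) v = 0" by simp
    qed
    moreover have "eval3 (var3 1 * var3 3) (vector [1, 1, 1]) \<noteq> 0" by simp
    then have "var3 1 * var3 3 \<noteq> 0" by fastforce
    ultimately have "B = 0" by simp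
    with \<open>A = 0\<close> AB(3) show "?Q dvd F" by simp
  next
    assume "?Q dvd F"
    then obtain G where "F = ?Q * G" ..
    then show "subst3 ?\<psi> F = 0" by (simp only: subst3_simps(6) Q0 mult_zero_left)
  qed
next
  have param: "param3 ?\<psi> s r = vector [s\<^sup>2, s * r, r\<^sup>2]" for s r
    by (rule vec3_eqI) (simp_all add: param3_def)
  fix x :: "complex ^ 3" assume x: "x \<noteq> 0" "eval3 ?Q x = 0"
  show "\<exists>s r k. (s \<noteq> 0 \<or> r \<noteq> 0) \<and> k \<noteq> 0 \<and> x = k *s param3 ?\<psi> s r"
  proof (cases "x $ 1 = 0")
    case True
    then have "x $ 2 = 0" using x(2) by simp
    with True have "x $ 3 \<noteq> 0" using x(1) by (auto simp: vec_eq_iff forall_3)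
    moreover have "x = x $ 3 *s param3 ?\<psi> 0 1"
      by (rule vec3_eqI) (simp_all add: param True \<open>x $ 2 = 0\<close>)
    ultimately show ?thesis by (intro exI[of _ 0] exI[of _ 1] exI[of _ "x $ 3"]) simp
  next
    case False
    have "x = (1 / x $ 1) *s param3 ?\<psi> (x $ 1) (x $ 2)"
      by (rule vec3_eqI) (use False x(2) in \<open>simp_all add: param field_simps power2_eq_square\<close>)
    moreover have "1 / x $ 1 \<noteq> 0" using False by simp
    ultimately show ?thesis using False by blast
  qed
qed


section \<open>The configuration over the Eisenstein integers\<close>

text \<open>
  The Eisenstein integers \<open>a + b \<omega>\<close> with \<open>\<omega>^2 = - 1 - \<omega>\<close>.  All points, lines and conics of the
  configuration have coordinates in this ring, in which incidences are decided by computation.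
\<close>
datatype eis = Eis int int

instantiation eis :: comm_ring_1
begin

definition zero_eis :: eis where "zero_eis = Eis 0 0"
definition one_eis :: eis where "one_eis = Eis 1 0"

fun plus_eis :: "eis \<Rightarrow> eis \<Rightarrow> eis" where "Eis a b + Eis c d = Eis (a + c) (b + d)"
fun minus_eis :: "eis \<Rightarrow> eis \<Rightarrow> eis" where "Eis a b - Eis c d = Eis (a - c) (b - d)"
fun uminus_eis :: "eis \<Rightarrow> eis" where "- Eis a b = Eis (- a) (- b)"
fun times_eis :: "eis \<Rightarrow> eis \<Rightarrow> eis" where
  "Eis a b * Eis c d = Eis (a * c - b * d) (a * d + b * c - b * d)"

instance
proof
  fix a b c :: eis
  show "a * b * c = a * (b * c)" by (cases a; cases b; cases c) (simp add: algebra_simps)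
  show "a * b = b * a" by (cases a; cases b) (simp add: algebra_simps)
  show "1 * a = a" by (cases a) (simp add: one_eis_def)
  show "(a + b) * c = a * c + b * c" by (cases a; cases b; cases c) (simp add: algebra_simps)
  show "a + b + c = a + (b + c)" by (cases a; cases b; cases c) simp
  show "a + b = b + a" by (cases a; cases b) simp
  show "0 + a = a" by (cases a) (simp add: zero_eis_def)
  show "- a + a = 0" by (cases a) (simp add: zero_eis_def)
  show "a - b = a + - b" by (cases a; cases b) simp
  show "(0::eis) \<noteq> 1" by (simp add: zero_eis_def one_eis_def)
qed

end

definition omega :: complex where "omega = Complex (- 1 / 2) (sqrt 3 / 2)"

lemma omega_square: "omega * omega = - 1 - omega"
  by (simp add: omega_def complex_eq_iff)

fun cx :: "eis \<Rightarrow> complex" where "cx (Eis a b) = of_int a + of_int b * omega"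

lemma cx_hom [simp]:
  "cx 0 = 0" "cx 1 = 1" "cx (x + y) = cx x + cx y" "cx (x - y) = cx x - cx y" "cx (- x) = - cx x"
  "cx (x * y) = cx x * cx y"
proof -
  show "cx 0 = 0" "cx 1 = 1" by (simp_all add: zero_eis_def one_eis_def)
  show "cx (x + y) = cx x + cx y" "cx (x - y) = cx x - cx y" "cx (- x) = - cx x"
    by (cases x; cases y; simp add: algebra_simps)+
  obtain a b c d where xy: "x = Eis a b" "y = Eis c d" by (cases x; cases y)
  have "cx x * cx y = of_int a * of_int c + (of_int a * of_int d + of_int b * of_int c) * omega
      + of_int b * of_int d * (omega * omega)"
    by (simp add: xy algebra_simps)
  also have "\<dots> = cx (x * y)" by (simp add: xy omega_square algebra_simps)
  finally show "cx (x * y) = cx x * cx y" by simp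
qed

lemma cx_numeral [simp]: "cx (numeral k) = numeral k"
proof -
  have "cx (of_nat n) = of_nat n" for n by (induction n) simp_all
  from this[of "numeral k"] show ?thesis by simp
qed

lemma cx_eq_0_iff [simp]: "cx x = 0 \<longleftrightarrow> x = 0"
proof (cases x)
  case (Eis a b)
  have "cx x = 0 \<longleftrightarrow> b = 0 \<and> a = 0"
    by (auto simp: Eis omega_def complex_eq_iff)
  then show ?thesis by (auto simp: Eis zero_eis_def)
qed

type_synonym 'a triple = "'a \<times> 'a \<times> 'a"
text \<open>
  The conic \<open>(a, b, c, d, e, f)\<close> is \<open>a x^2 + b y^2 + c z^2 + d y z + e z x + f x y\<close>.
\<close>
type_synonym 'a sextuple = "'a \<times> 'a \<times> 'a \<times> 'a \<times> 'a \<times> 'a"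

fun dot :: "'a::comm_ring_1 triple \<Rightarrow> 'a triple \<Rightarrow> 'a" where
  "dot (a, b, c) (x, y, z) = a * x + b * y + c * z"

fun cross :: "'a::comm_ring_1 triple \<Rightarrow> 'a triple \<Rightarrow> 'a triple" where
  "cross (a, b, c) (x, y, z) = (b * z - c * y, c * x - a * z, a * y - b * x)"

fun qgrad :: "'a::comm_ring_1 sextuple \<Rightarrow> 'a triple \<Rightarrow> 'a triple" where
  "qgrad (a, b, c, d, e, f) (x, y, z) = 
    (a * x + a * x + f * y + e * z, f * x + b * y + b * y + d * z, e * x + d * y + c * z + c * z)"

fun qval :: "'a::comm_ring_1 sextuple \<Rightarrow> 'a triple \<Rightarrow> 'a" where
  "qval (a, b, c, d, e, f) (x, y, z) = a * x * x + b * y * y + c * z * z + d * y * z + e * z * x + f * x * y"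

definition zeta :: eis where "zeta = Eis 0 1"
definition units3 :: "eis list" where "units3 = [1, zeta, zeta * zeta]"

text \<open>
  The tangent lines of \<open>x^3 + y^3 + z^3 + 3 x y z = 0\<close> at its flexes, as points of the dual plane:
  \<open>(-1, u, u^2)\<close> is the tangent at the flex \<open>(0 : -u : 1)\<close>, and the cyclic shifts belong to the
  other two coordinate lines.
\<close>
definition cusp_list :: "eis triple list" where
  "cusp_list = concat (map (\<lambda>u. [(- 1, u, u * u), (u * u, - 1, u), (u, u * u, - 1)]) units3)"

text \<open>
  The triple points of the dual Hesse arrangement \<open>(x^3 - y^3) (y^3 - z^3) (z^3 - x^3) = 0\<close>.
\<close>
definition node_list :: "eis triple list" where
  "node_list = [(1, 0, 0), (0, 1, 0), (0, 0, 1)] @ concat (map (\<lambda>u. map (\<lambda>v. (1, u, v)) units3) units3)"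

text \<open>
  Besides \<open>x^2 + y z\<close> and its cyclic shifts, the list consists of the pull-backs of
  \<open>x^2 + y^2 + z^2 + (1 - g) (x y + y z + z x)\<close> by the diagonal matrices \<open>(1, u, u^2 g)\<close>, where
  \<open>g\<close> and \<open>u\<close> are cube roots of unity.  The four families of three correspond to the four classes of
  parallel lines in the affine plane over the field with three elements whose points are the flexes:
  each conic passes through the cusps outside of one line.
\<close>
definition conic_list :: "eis sextuple list" where
  "conic_list = [(1, 0, 0, 1, 0, 0), (0, 1, 0, 0, 1, 0), (0, 0, 1, 0, 0, 1)] @
     concat (map (\<lambda>g. map (\<lambda>u. (1, u * u, u * g * g, (1 - g) * g, (1 - g) * u * u * g, (1 - g) * u)) units3) units3)"

text \<open>
  The lines \<open>x = u y\<close>, \<open>y = u z\<close>, \<open>z = u x\<close> of the dual Hesse arrangement.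
\<close>
definition line_list :: "eis triple list" where
  "line_list = concat (map (\<lambda>u. [(1, - u, 0), (0, 1, - u), (- u, 0, 1)]) units3)"


section \<open>Lines and conics of the configuration as rational curves\<close>

fun cvec :: "eis triple \<Rightarrow> complex ^ 3" where
  "cvec (x, y, z) = vector [cx x, cx y, cx z]"

fun conic_form :: "eis sextuple \<Rightarrow> poly3" where
  "conic_form (a, b, c, d, e, f) = const3 (cx a) * (var3 1 * var3 1) + const3 (cx b) * (var3 2 * var3 2)
     + const3 (cx c) * (var3 3 * var3 3) + const3 (cx d) * (var3 2 * var3 3)
     + const3 (cx e) * (var3 3 * var3 1) + const3 (cx f) * (var3 1 * var3 2)"

fun line_form :: "eis triple \<Rightarrow> poly3" where
  "line_form (a, b, c) = const3 (cx a) * var3 1 + const3 (cx b) * var3 2 + const3 (cx c) * var3 3"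

lemma eval3_conic_form: "eval3 (conic_form c) (cvec p) = cx (qval c p)"
  by (cases c; cases p) (simp add: algebra_simps)

lemma eval3_line_form: "eval3 (line_form l) (cvec p) = cx (dot l p)"
  by (cases l; cases p) simp

lemma homogeneous_conic_form: "homogeneous 2 (conic_form c)"
proof -
  have "homogeneous 2 (const3 a * (var3 i * var3 j))" for a i j
    using homogeneous_mult[OF homogeneous_const homogeneous_mult[OF homogeneous_var homogeneous_var]]
    by (simp add: numeral_2_eq_2)
  then show ?thesis by (cases c) (simp add: homogeneous_add)
qed

lemma homogeneous_line_form: "homogeneous 1 (line_form l)"
proof -
  have "homogeneous 1 (const3 a * var3 i)" for a i
    using homogeneous_mult[OF homogeneous_const homogeneous_var] by simp
  then show ?thesis by (cases l) (simp add: homogeneous_add)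
qed

definition polar :: "eis sextuple \<Rightarrow> complex ^ 3 \<Rightarrow> complex ^ 3 \<Rightarrow> complex" where
  "polar c x y = eval3 (conic_form c) (x + y) - eval3 (conic_form c) x - eval3 (conic_form c) y"

lemma polar_cvec: "polar c (cvec p) (cvec q) = cx (dot (qgrad c p) q)"
  by (cases c; cases p; cases q) (simp add: polar_def algebra_simps)

lemma conic_combination:
  "eval3 (conic_form c) (x *s p + y *s q + z *s r) =
     x\<^sup>2 * eval3 (conic_form c) p + y\<^sup>2 * eval3 (conic_form c) q + z\<^sup>2 * eval3 (conic_form c) r
     + x * y * polar c p q + x * z * polar c p r + y * z * polar c q r"
  by (cases c) (simp add: polar_def algebra_simps power2_eq_square)

lemma cvec_det:
  "cvec p $ 1 * cvec q $ 2 * cvec r $ 3 + cvec p $ 2 * cvec q $ 3 * cvec r $ 1 + cvec p $ 3 * cvec q $ 1 * cvec r $ 2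
    - cvec p $ 1 * cvec q $ 3 * cvec r $ 2 - cvec p $ 2 * cvec q $ 1 * cvec r $ 3 - cvec p $ 3 * cvec q $ 2 * cvec r $ 1
   = cx (dot (cross p q) r)"
  by (cases p; cases q; cases r) (simp add: algebra_simps)

definition columns3 :: "complex ^ 3 \<Rightarrow> complex ^ 3 \<Rightarrow> complex ^ 3 \<Rightarrow> complex ^ 3 ^ 3" where
  "columns3 u v w = (\<chi> i j. if j = 1 then u $ i else if j = 2 then v $ i else w $ i)"

lemma columns3_mult: "columns3 u v w *v x = x $ 1 *s u + x $ 2 *s v + x $ 3 *s w"
  by (simp add: vec_eq_iff columns3_def matrix_vector_mult_def sum_3 algebra_simps)

lemma det_columns3: "det (columns3 u v w) =
    u $ 1 * v $ 2 * w $ 3 + u $ 2 * v $ 3 * w $ 1 + u $ 3 * v $ 1 * w $ 2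
    - u $ 1 * v $ 3 * w $ 2 - u $ 2 * v $ 1 * w $ 3 - u $ 3 * v $ 2 * w $ 1"
  by (simp add: det_3 columns3_def algebra_simps)

lemma det_nonzero_right_inverse:
  fixes A :: "complex ^ 3 ^ 3"
  assumes "det A \<noteq> 0" obtains B where "A ** B = mat 1"
  using assms unfolding invertible_det_nz[symmetric] invertible_def by blast

text \<open>
  In coordinates with respect to three of its points a conic is
  \<open>\<gamma> x y + \<beta> x z + \<alpha> y z = 0\<close>, which the Cremona involution turns into a line.  The
  columns of \<open>A\<close> are the coefficients of \<open>s^2\<close>, \<open>s r\<close>, \<open>r^2\<close> in the resulting
  parametrization \<open>(- \<alpha> r (s + r), - \<beta> s (s + r), \<gamma> s r)\<close>.
\<close>
lemma rational_conic:
  assumes on: "qval c p = 0" "qval c q = 0" "qval c r = 0"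
    and polar: "dot (qgrad c p) q \<noteq> 0" "dot (qgrad c p) r \<noteq> 0" "dot (qgrad c q) r \<noteq> 0"
    and indep: "dot (cross p q) r \<noteq> 0"
  shows "\<exists>\<phi>. rational_curve (conic_form c) \<phi> 2"
proof -
  define \<alpha> where "\<alpha> = polar c (cvec q) (cvec r)"
  define \<beta> where "\<beta> = polar c (cvec p) (cvec r)"
  define \<gamma> where "\<gamma> = polar c (cvec p) (cvec q)"
  have nz: "\<alpha> \<noteq> 0" "\<beta> \<noteq> 0" "\<gamma> \<noteq> 0"
    using polar by (simp_all add: \<alpha>_def \<beta>_def \<gamma>_def polar_cvec)
  define A where "A = columns3 (- \<beta> *s cvec q) (- \<alpha> *s cvec p + - \<beta> *s cvec q + \<gamma> *s cvec r) (- \<alpha> *s cvec p)"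
  have "det A = \<alpha> * \<beta> * \<gamma> * cx (dot (cross p q) r)"
    unfolding A_def det_columns3 cvec_det[symmetric] by (simp add: algebra_simps)
  then have "det A \<noteq> 0" using nz indep by simp
  then obtain B where AB: "A ** B = mat 1" by (rule det_nonzero_right_inverse)
  have "eval3 (conic_form c) (A *v x) = - (\<alpha> * \<beta> * \<gamma>) * eval3 ((var3 2)\<^sup>2 - var3 1 * var3 3) x" for x
  proof -
    have Ax: "A *v x = (- \<alpha> * (x $ 2 + x $ 3)) *s cvec p + (- \<beta> * (x $ 1 + x $ 2)) *s cvec q + (\<gamma> * x $ 2) *s cvec r"
      by (simp add: A_def columns3_mult vec_eq_iff algebra_simps)
    show ?thesis
      unfolding Ax conic_combination by (simp add: eval3_conic_form on \<alpha>_def[symmetric] \<beta>_def[symmetric] \<gamma>_def[symmetric])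
        (simp add: algebra_simps power2_eq_square)
  qed
  moreover have "- (\<alpha> * \<beta> * \<gamma>) \<noteq> 0" using nz by simp
  ultimately show ?thesis
    using rational_curve_transport[OF rational_curve_conic AB] by blast
qed

lemma rational_line:
  assumes on: "dot l q = 0" "dot l r = 0" and off: "dot l p \<noteq> 0"
    and indep: "dot (cross p q) r \<noteq> 0"
  shows "\<exists>\<phi>. rational_curve (line_form l) \<phi> 1"
proof -
  define A where "A = columns3 (cvec p) (cvec q) (cvec r)"
  have "det A = cx (dot (cross p q) r)"
    unfolding A_def det_columns3 by (rule cvec_det)
  then have "det A \<noteq> 0" using indep by simp
  then obtain B where AB: "A ** B = mat 1" by (rule det_nonzero_right_inverse)
  have "eval3 (line_form l) (A *v x) = cx (dot l p) * eval3 (var3 1) x" for x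
  proof -
    have "eval3 (line_form l) (A *v x) = x $ 1 * eval3 (line_form l) (cvec p)
        + x $ 2 * eval3 (line_form l) (cvec q) + x $ 3 * eval3 (line_form l) (cvec r)"
      by (cases l) (simp add: A_def columns3_mult algebra_simps)
    then show ?thesis by (simp add: eval3_line_form on)
  qed
  moreover have "cx (dot l p) \<noteq> 0" using off by simp
  ultimately show ?thesis
    using rational_curve_transport[OF rational_curve_line AB] by blast
qed

lemma taylor1_conic_form: "taylor 1 (conic_form c) x v = polar c x v"
proof -
  have "along (conic_form c) x v = [:eval3 (conic_form c) x, polar c x v, eval3 (conic_form c) v:]"
  proof (subst poly_eq_poly_eq_iff[symmetric], rule ext)
    fix t
    show "poly (along (conic_form c) x v) t = poly [:eval3 (conic_form c) x, polar c x v, eval3 (conic_form c) v:] t"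
      using conic_combination[of c 1 x t v 0 0] by (simp add: poly_along algebra_simps power2_eq_square)
  qed
  then show ?thesis by (simp add: taylor_def)
qed

lemma taylor1_line_form: "taylor 1 (line_form l) x v = eval3 (line_form l) v"
proof -
  have "along (line_form l) x v = [:eval3 (line_form l) x, eval3 (line_form l) v:]"
  proof (subst poly_eq_poly_eq_iff[symmetric], rule ext)
    fix t
    show "poly (along (line_form l) x v) t = poly [:eval3 (line_form l) x, eval3 (line_form l) v:] t"
      by (cases l) (simp add: poly_along algebra_simps)
  qed
  then show ?thesis by (simp add: taylor_def)
qed

definition hessian_det :: "eis sextuple \<Rightarrow> eis" where
  "hessian_det c = dot (cross (qgrad c (1, 0, 0)) (qgrad c (0, 1, 0))) (qgrad c (0, 0, 1))"

text \<open>
  A singular point is a vector in the kernel of the symmetric matrix of the conic.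
\<close>
lemma conic_smooth:
  assumes det: "hessian_det c \<noteq> 0" and x: "x \<noteq> 0"
  shows "\<exists>v. polar c x v \<noteq> 0"
proof (rule ccontr)
  assume "\<not> ?thesis"
  then have 0: "polar c x v = 0" for v by blast
  obtain a1 a2 a3 a4 a5 a6 where c: "c = (a1, a2, a3, a4, a5, a6)" by (cases c)
  define a b d e f g where "a = cx a1" and "b = cx a2" and "d = cx a3" and "e = cx a4" and "f = cx a5" and "g = cx a6"
  note defs = a_def b_def d_def e_def f_def g_def
  define D where "D = cx (hessian_det c)"
  have "D \<noteq> 0" using det by (simp add: D_def)
  have D: "D = 8 * a * b * d + 2 * e * f * g - 2 * a * e\<^sup>2 - 2 * b * f\<^sup>2 - 2 * d * g\<^sup>2"
    by (simp add: D_def hessian_det_def c defs power2_eq_square algebra_simps)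
  have rows: "2 * a * x $ 1 + g * x $ 2 + f * x $ 3 = 0" "g * x $ 1 + 2 * b * x $ 2 + e * x $ 3 = 0"
    "f * x $ 1 + e * x $ 2 + 2 * d * x $ 3 = 0"
    using 0[of "vector [1, 0, 0]"] 0[of "vector [0, 1, 0]"] 0[of "vector [0, 0, 1]"]
    by (simp_all add: polar_def c defs algebra_simps)
  have "D * x $ 1 = 0" "D * x $ 2 = 0" "D * x $ 3 = 0"
    unfolding D using rows by algebra+
  then have "x = 0" using \<open>D \<noteq> 0\<close> by (intro vec3_eqI) simp_all
  with x show False by simp
qed

section \<open>Incidences\<close>

abbreviation config_list :: "eis triple list" where
  "config_list \<equiv> cusp_list @ node_list"

text \<open>
  The incidences of the configuration of 9 cusps, 12 nodes, 12 conics and 9 lines are a finite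
  computation with Eisenstein integers.
\<close>
lemma config_distinct: "\<forall>p\<in>set config_list. \<forall>q\<in>set config_list. p \<noteq> q \<longrightarrow> cross p q \<noteq> (0, 0, 0)"
  by code_simp

lemma distinct_lists: "distinct config_list" "distinct conic_list" "distinct line_list"
  by code_simp+

lemma lengths: "length cusp_list = 9" "length node_list = 12" "length conic_list = 12"
  by code_simp+

text \<open>
  The first three cusps on a conic serve as the coordinate triangle of its parametrization.
\<close>
lemma conic_frames:
  "\<forall>c\<in>set conic_list. hessian_det c \<noteq> 0 \<and> (case filter (\<lambda>p. qval c p = 0) cusp_list of
     p # q # r # _ \<Rightarrow> dot (qgrad c p) q \<noteq> 0 \<and> dot (qgrad c p) r \<noteq> 0 \<and> dot (qgrad c q) r \<noteq> 0
       \<and> dot (cross p q) r \<noteq> 0 | _ \<Rightarrow> False)"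
  by code_simp

lemma line_frames:
  "\<forall>l\<in>set line_list. case filter (\<lambda>p. dot l p = 0) config_list of
     q # r # _ \<Rightarrow> list_ex (\<lambda>p. dot l p \<noteq> 0 \<and> dot (cross p q) r \<noteq> 0) node_list | _ \<Rightarrow> False"
  by code_simp

lemma conic_counts:
  "\<forall>c\<in>set conic_list. length (filter (\<lambda>p. qval c p = 0) cusp_list) = 6 \<and>
     length (filter (\<lambda>p. qval c p = 0) node_list) = 2"
  by code_simp

lemma conic_pairs:
  "\<forall>c\<in>set conic_list. \<forall>c'\<in>set conic_list. c \<noteq> c' \<longrightarrow>
     length (filter (\<lambda>p. qval c p = 0 \<and> qval c' p = 0) config_list) = 4"
  by code_simp

lemma conics_through:
  "\<forall>p\<in>set cusp_list. length (filter (\<lambda>c. qval c p = 0) conic_list) = 8"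
  "\<forall>p\<in>set node_list. length (filter (\<lambda>c. qval c p = 0) conic_list) = 2"
  by code_simp+

text \<open>
  In terms of the affine plane over the field with three elements: of the twelve lines five miss
  two given points, and one contains both.
\<close>
lemma conics_through_two_cusps:
  "\<forall>p\<in>set cusp_list. \<forall>q\<in>set cusp_list. p \<noteq> q \<longrightarrow>
     length (filter (\<lambda>c. qval c p = 0 \<and> qval c q = 0) conic_list) = 5 \<and>
     list_ex (\<lambda>c. qval c p \<noteq> 0 \<and> qval c q \<noteq> 0) conic_list"
  by code_simp

lemma conics_transversal:
  "\<forall>p\<in>set node_list. \<forall>c\<in>set conic_list. \<forall>c'\<in>set conic_list. c \<noteq> c' \<longrightarrow>
     qval c p = 0 \<longrightarrow> qval c' p = 0 \<longrightarrow> cross (qgrad c p) (qgrad c' p) \<noteq> (0, 0, 0)"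
  by code_simp

lemma line_counts:
  "\<forall>l\<in>set line_list. length (filter (\<lambda>p. dot l p = 0) config_list) = 5"
  "\<forall>p\<in>set cusp_list. length (filter (\<lambda>l. dot l p = 0) line_list) = 1"
  "\<forall>p\<in>set node_list. length (filter (\<lambda>l. dot l p = 0) line_list) = 3"
  by code_simp+

lemma rational_conics:
  assumes "c \<in> set conic_list"
  shows "\<exists>\<phi>. rational_curve (conic_form c) \<phi> 2"
proof -
  obtain p q r ps where ps: "filter (\<lambda>p. qval c p = 0) cusp_list = p # q # r # ps"
    using conic_frames[rule_format, OF assms] by (simp split: list.splits)
  have "{p, q, r} \<subseteq> set (filter (\<lambda>p. qval c p = 0) cusp_list)" by (simp add: ps)
  then have on: "qval c p = 0" "qval c q = 0" "qval c r = 0" by auto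
  show ?thesis
    using conic_frames[rule_format, OF assms] unfolding ps by (intro rational_conic[OF on]) auto
qed

lemma rational_lines:
  assumes "l \<in> set line_list"
  shows "\<exists>\<phi>. rational_curve (line_form l) \<phi> 1"
proof -
  obtain q r ps where ps: "filter (\<lambda>p. dot l p = 0) config_list = q # r # ps"
    using line_frames[rule_format, OF assms] by (simp split: list.splits)
  have "{p \<in> set config_list. dot l p = 0} = set (q # r # ps)"
    by (simp only: set_filter[symmetric] ps)
  then have "q \<in> {p \<in> set config_list. dot l p = 0}" "r \<in> {p \<in> set config_list. dot l p = 0}"
    by (simp_all only: list.set insert_iff) simp_all
  then have on: "dot l q = 0" "dot l r = 0" by simp_all
  obtain p where "dot l p \<noteq> 0" "dot (cross p q) r \<noteq> 0"
    using line_frames[rule_format, OF assms] unfolding ps by (auto simp: list_ex_iff)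
  then show ?thesis by (intro rational_line[OF on])
qed


section \<open>Points and curves of the projective plane\<close>

lemma form_rel_refl: "F \<noteq> 0 \<Longrightarrow> homogeneous d F \<Longrightarrow> form_rel F F"
  by (auto simp: form_rel_def intro!: exI[of _ "1::complex"])

lemma proj_rel_refl: "v \<noteq> 0 \<Longrightarrow> proj_rel v v"
  by (auto simp: proj_rel_def intro!: exI[of _ "1::complex"])

lemma curve_cases:
  obtains F d where "C = abs_curve F" "F \<noteq> 0" "homogeneous d F"
proof -
  have "form_rel (rep_curve C) (rep_curve C)" "C = abs_curve (rep_curve C)"
    by (rule Quotient_rep_reflp[OF Quotient_curve]) (rule Quotient_abs_rep[OF Quotient_curve, symmetric])
  then show ?thesis using that by (auto simp: form_rel_def)
qed

lemma point_cases:
  obtains v where "P = abs_point v" "v \<noteq> 0"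
proof -
  have "proj_rel (rep_point P) (rep_point P)" "P = abs_point (rep_point P)"
    by (rule Quotient_rep_reflp[OF Quotient_point]) (rule Quotient_abs_rep[OF Quotient_point, symmetric])
  then show ?thesis using that by (auto simp: proj_rel_def)
qed

lemma abs_point_eq_iff: "u \<noteq> 0 \<Longrightarrow> v \<noteq> 0 \<Longrightarrow> abs_point u = abs_point v \<longleftrightarrow> proj_rel u v"
  using Quotient_rel[OF Quotient_point, of u v] proj_rel_refl by auto

lemma curve_degree_abs: "F \<noteq> 0 \<Longrightarrow> homogeneous d F \<Longrightarrow> curve_degree (abs_curve F) = d"
  using curve_degree.abs_eq[OF form_rel_refl] total_degree_homogeneous by simp

lemma irreducible_curve_abs: "F \<noteq> 0 \<Longrightarrow> homogeneous d F \<Longrightarrow> irreducible_curve (abs_curve F) \<longleftrightarrow> irreducible F"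
  by (rule irreducible_curve.abs_eq[OF form_rel_refl])

lemma on_curve_abs:
  "v \<noteq> 0 \<Longrightarrow> F \<noteq> 0 \<Longrightarrow> homogeneous d F \<Longrightarrow> on_curve (abs_point v) (abs_curve F) \<longleftrightarrow> eval3 F v = 0"
  by (rule on_curve.abs_eq[OF proj_rel_refl form_rel_refl])

lemma mult_at_abs:
  "v \<noteq> 0 \<Longrightarrow> F \<noteq> 0 \<Longrightarrow> homogeneous d F \<Longrightarrow> mult_at (abs_point v) (abs_curve F) = mult3 F v"
  by (rule mult_at.abs_eq[OF proj_rel_refl form_rel_refl])

lemma mult_at_eq_0_iff: "mult_at P C = 0 \<longleftrightarrow> \<not> on_curve P C"
  by (cases P rule: point_cases; cases C rule: curve_cases)
    (simp add: mult_at_abs on_curve_abs mult3_eq_0_iff)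

lemma plus_curve_abs:
  "F \<noteq> 0 \<Longrightarrow> homogeneous d F \<Longrightarrow> G \<noteq> 0 \<Longrightarrow> homogeneous e G \<Longrightarrow> abs_curve F + abs_curve G = abs_curve (F * G)"
  by (rule plus_curve.abs_eq[OF form_rel_refl form_rel_refl])

lemma mult_at_add: "mult_at P (C + D) = mult_at P C + mult_at P D"
proof -
  obtain v where P: "P = abs_point v" "v \<noteq> 0" by (rule point_cases)
  obtain F d where C: "C = abs_curve F" "F \<noteq> 0" "homogeneous d F" by (rule curve_cases)
  obtain G e where D: "D = abs_curve G" "G \<noteq> 0" "homogeneous e G" by (rule curve_cases)
  have "F * G \<noteq> 0" using C D by simp
  then show ?thesis
    using C D P mult_at_abs[OF P(2) \<open>F * G \<noteq> 0\<close> homogeneous_mult[OF C(3) D(3)]]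
    by (simp add: plus_curve_abs mult_at_abs mult3_mult)
qed

lemma mult_at_zero: "mult_at P 0 = 0"
proof -
  obtain v where P: "P = abs_point v" "v \<noteq> 0" by (rule point_cases)
  show ?thesis
    unfolding P zero_curve_def using mult_at_abs[OF P(2) one_neq_zero homogeneous_one] mult3_eq_0_iff[of 1 v]
    by simp
qed

lemma mult_at_sum: "mult_at P (\<Sum>C\<in>A. f C) = (\<Sum>C\<in>A. mult_at P (f C))"
  by (induction A rule: infinite_finite_induct) (simp_all add: mult_at_zero mult_at_add)

text \<open>
  A unit is a factor of the form 1 of degree 0, hence itself a form of degree 0.
\<close>
lemma unit_form_const:
  assumes "U dvd 1" obtains a where "a \<noteq> 0" "U = const3 a"
proof -
  obtain V where V: "1 = U * V" using assms by (rule dvdE)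
  obtain a b where "homogeneous a U" "a + b = 0"
    using homogeneous_factors[of 0 U V] homogeneous_one V by auto
  then have "homogeneous 0 U" by simp
  then obtain c where c: "U = const3 c" by (rule homogeneous_0_const)
  then have "c \<noteq> 0" using V by (auto simp: const3_def)
  with c show ?thesis by (rule that[rotated])
qed

context rational_curve
begin

lemma curve_bezout:
  assumes Q: "homogeneous d' Q" and C: "irreducible_curve C" "C \<noteq> abs_curve Q"
    and S: "finite S" "\<And>P. P \<in> S \<Longrightarrow> on_curve P (abs_curve Q)"
  shows "(\<Sum>P\<in>S. mult_at P C) \<le> e * curve_degree C"
proof -
  obtain F d where F: "C = abs_curve F" "F \<noteq> 0" "homogeneous d F" by (rule curve_cases)
  have ndvd: "\<not> Q dvd F"
  proof
    assume "Q dvd F"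
    then obtain U where U: "F = Q * U" by (rule dvdE)
    have "irreducible F" using C(1) F by (simp add: irreducible_curve_abs)
    then have "U dvd 1" using irreducibleD[OF _ U] not_dvd_one by blast
    then obtain a where a: "a \<noteq> 0" "U = const3 a" by (rule unit_form_const)
    then have "form_rel Q F"
      using F Q U nonzero by (auto simp: form_rel_def const3_def mult.commute)
    then have "abs_curve Q = C"
      unfolding F using Quotient_rel[OF Quotient_curve] by blast
    with C(2) show False by simp
  qed
  have rep: "abs_point (rep_point P) = P" "rep_point P \<noteq> 0" for P
    using Quotient_rep_reflp[OF Quotient_point, of P] Quotient_abs_rep[OF Quotient_point, of P]
    by (auto simp: proj_rel_def)
  have inj: "inj_on rep_point S" by (rule inj_onI) (metis rep(1))
  have "(\<Sum>P\<in>S. mult_at P C) = (\<Sum>x\<in>rep_point ` S. mult3 F x)"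
    unfolding sum.reindex[OF inj] comp_def
    using mult_at_abs[OF rep(2) F(2,3)] by (simp add: F(1) rep(1))
  also have "\<dots> \<le> e * d"
  proof (rule bezout[OF F(3) ndvd])
    show "finite (rep_point ` S)" using S(1) by simp
    fix x assume "x \<in> rep_point ` S"
    then show "x \<noteq> 0" "eval3 Q x = 0"
      using rep S(2) on_curve_abs[OF rep(2) nonzero Q] by auto
  next
    fix x y assume "x \<in> rep_point ` S" "y \<in> rep_point ` S" "proj_rel x y"
    then show "x = y" using abs_point_eq_iff rep by (metis imageE)
  qed
  also have "d = curve_degree C" using F by (simp add: curve_degree_abs)
  finally show ?thesis .
qed

end

section \<open>The singular points of the conic arrangement\<close>

definition pt :: "eis triple \<Rightarrow> point" where "pt p = abs_point (cvec p)"

definition conic :: "eis sextuple \<Rightarrow> curve" where "conic c = abs_curve (conic_form c)"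

definition line :: "eis triple \<Rightarrow> curve" where "line l = abs_curve (line_form l)"

lemma config_nonzero: "\<forall>p\<in>set config_list. p \<noteq> (0, 0, 0)"
  by code_simp

lemma cvec_nonzero: "p \<noteq> (0, 0, 0) \<Longrightarrow> cvec p \<noteq> 0"
  by (cases p) (auto simp: vec_eq_iff forall_3)

lemma cross_proportional:
  assumes "cvec q = k *s cvec p" shows "cross p q = (0, 0, 0)"
proof -
  obtain x y z x' y' z' where pq: "p = (x, y, z)" "q = (x', y', z')" by (cases p; cases q)
  have "cx x' = k * cx x" "cx y' = k * cx y" "cx z' = k * cx z"
    using assms by (simp_all add: pq vec_eq_iff forall_3)
  then have "cx (y * z' - z * y') = 0" "cx (z * x' - x * z') = 0" "cx (x * y' - y * x') = 0"
    by (simp_all del: cx_eq_0_iff)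
  then show ?thesis by (simp add: pq del: cx_hom)
qed

lemma inj_pt: "inj_on pt (set config_list)"
proof (rule inj_onI)
  fix p q assume p: "p \<in> set config_list" and q: "q \<in> set config_list" and eq: "pt p = pt q"
  then have "proj_rel (cvec p) (cvec q)"
    using abs_point_eq_iff cvec_nonzero config_nonzero by (simp add: pt_def)
  then obtain k where "cvec q = k *s cvec p" unfolding proj_rel_def by blast
  then have "cross p q = (0, 0, 0)" by (rule cross_proportional)
  then show "p = q" using config_distinct p q by blast
qed

lemma conic_form_nonzero: "c \<in> set conic_list \<Longrightarrow> conic_form c \<noteq> 0"
  using rational_conics rational_curve.nonzero by blast

lemma line_form_nonzero: "l \<in> set line_list \<Longrightarrow> line_form l \<noteq> 0"
  using rational_lines rational_curve.nonzero by blast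

lemma on_conic:
  assumes "p \<in> set config_list" "c \<in> set conic_list"
  shows "on_curve (pt p) (conic c) \<longleftrightarrow> qval c p = 0"
proof -
  have "cvec p \<noteq> 0" using assms(1) config_nonzero cvec_nonzero by blast
  from on_curve_abs[OF this conic_form_nonzero[OF assms(2)] homogeneous_conic_form]
  show ?thesis by (simp only: pt_def conic_def eval3_conic_form cx_eq_0_iff)
qed

lemma on_line:
  assumes "p \<in> set config_list" "l \<in> set line_list"
  shows "on_curve (pt p) (line l) \<longleftrightarrow> dot l p = 0"
proof -
  have "cvec p \<noteq> 0" using assms(1) config_nonzero cvec_nonzero by blast
  from on_curve_abs[OF this line_form_nonzero[OF assms(2)] homogeneous_line_form]
  show ?thesis by (simp only: pt_def line_def eval3_line_form cx_eq_0_iff)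
qed

lemma conic_properties:
  assumes "c \<in> set conic_list"
  shows conic_irreducible: "irreducible_curve (conic c)" and conic_degree: "curve_degree (conic c) = 2"
proof -
  obtain \<phi> where "rational_curve (conic_form c) \<phi> 2" using rational_conics[OF assms] ..
  then interpret rational_curve "conic_form c" \<phi> 2 .
  show "irreducible_curve (conic c)" "curve_degree (conic c) = 2"
    using irreducible_Q irreducible_curve_abs[OF nonzero homogeneous_conic_form]
      curve_degree_abs[OF nonzero homogeneous_conic_form] by (simp_all add: conic_def)
qed

lemma line_properties:
  assumes "l \<in> set line_list"
  shows line_irreducible: "irreducible_curve (line l)" and line_degree: "curve_degree (line l) = 1"
proof -
  obtain \<phi> where "rational_curve (line_form l) \<phi> 1" using rational_lines[OF assms] ..
  then interpret rational_curve "line_form l" \<phi> 1 .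
  show "irreducible_curve (line l)" "curve_degree (line l) = 1"
    using irreducible_Q irreducible_curve_abs[OF nonzero homogeneous_line_form]
      curve_degree_abs[OF nonzero homogeneous_line_form] by (simp_all add: line_def)
qed

lemma conic_bezout:
  assumes "c \<in> set conic_list" "irreducible_curve C" "C \<noteq> conic c"
    and "finite S" "\<And>P. P \<in> S \<Longrightarrow> on_curve P (conic c)"
  shows "(\<Sum>P\<in>S. mult_at P C) \<le> 2 * curve_degree C"
proof -
  obtain \<phi> where "rational_curve (conic_form c) \<phi> 2" using rational_conics[OF assms(1)] ..
  then interpret rational_curve "conic_form c" \<phi> 2 .
  show ?thesis
    by (rule curve_bezout[OF homogeneous_conic_form]) (use assms in \<open>auto simp: conic_def\<close>)
qed

lemma line_bezout:
  assumes "l \<in> set line_list" "irreducible_curve C" "C \<noteq> line l"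
    and "finite S" "\<And>P. P \<in> S \<Longrightarrow> on_curve P (line l)"
  shows "(\<Sum>P\<in>S. mult_at P C) \<le> curve_degree C"
proof -
  obtain \<phi> where "rational_curve (line_form l) \<phi> 1" using rational_lines[OF assms(1)] ..
  then interpret rational_curve "line_form l" \<phi> 1 .
  have "(\<Sum>P\<in>S. mult_at P C) \<le> 1 * curve_degree C"
    by (rule curve_bezout[OF homogeneous_line_form]) (use assms in \<open>auto simp: line_def\<close>)
  then show ?thesis by simp
qed

lemma mult_at_conic:
  assumes "c \<in> set conic_list"
  shows "mult_at P (conic c) = (if on_curve P (conic c) then 1 else 0)"
proof -
  obtain v where P: "P = abs_point v" "v \<noteq> 0" by (rule point_cases)
  have nz: "conic_form c \<noteq> 0" by (rule conic_form_nonzero[OF assms])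
  obtain u where "polar c v u \<noteq> 0" using conic_smooth conic_frames assms P(2) by blast
  then have "\<not> mult3 (conic_form c) v \<ge> 2"
    using mult3_ge2_iff[OF nz] taylor1_conic_form by auto
  then have "mult_at P (conic c) \<le> 1"
    unfolding P conic_def mult_at_abs[OF P(2) nz homogeneous_conic_form] by simp
  then show ?thesis using mult_at_eq_0_iff[of P "conic c"] by (auto simp: le_Suc_eq)
qed

lemma mult_at_line:
  assumes "l \<in> set line_list"
  shows "mult_at P (line l) = (if on_curve P (line l) then 1 else 0)"
proof -
  obtain v where P: "P = abs_point v" "v \<noteq> 0" by (rule point_cases)
  have nz: "line_form l \<noteq> 0" by (rule line_form_nonzero[OF assms])
  obtain u where "eval3 (line_form l) u \<noteq> 0" using eval3_eq_zero_imp nz by blast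
  then have "\<not> mult3 (line_form l) v \<ge> 2"
    using mult3_ge2_iff[OF nz] taylor1_line_form by auto
  then have "mult_at P (line l) \<le> 1"
    unfolding P line_def mult_at_abs[OF P(2) nz homogeneous_line_form] by simp
  then show ?thesis using mult_at_eq_0_iff[of P "line l"] by (auto simp: le_Suc_eq)
qed

lemma card_filter: "distinct xs \<Longrightarrow> card {x \<in> set xs. R x} = length (filter R xs)"
  by (metis distinct_card distinct_filter set_filter)

lemma distinct_cusps: "distinct cusp_list" and distinct_nodes: "distinct node_list"
  and distinct_conics: "distinct conic_list" and distinct_lines: "distinct line_list"
  using distinct_lists by auto

lemma inj_conic: "inj_on conic (set conic_list)"
proof (rule inj_onI, rule ccontr)
  fix c c' assume c: "c \<in> set conic_list" "c' \<in> set conic_list" and eq: "conic c = conic c'" and ne: "c \<noteq> c'"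
  have "qval c p = 0 \<longleftrightarrow> qval c' p = 0" if "p \<in> set config_list" for p
    using on_conic[OF that c(1)] on_conic[OF that c(2)] eq by simp
  then have "filter (\<lambda>p. qval c p = 0 \<and> qval c' p = 0) config_list = filter (\<lambda>p. qval c p = 0) config_list"
    by (intro filter_cong refl) blast
  then show False
    using conic_pairs[rule_format, OF c ne] conic_counts[rule_format, OF c(1)] by simp
qed

definition chilean :: "curve set" where "chilean = conic ` set conic_list"

lemma card_chilean: "card chilean = 12"
  unfolding chilean_def using card_image[OF inj_conic] distinct_card[OF distinct_conics] lengths by simp

text \<open>
  Two of the conics have four of the 21 points in common, and a fifth common point would contradict
  Bezout's theorem.
\<close>
lemma Sing_chilean: "Sing chilean = pt ` set config_list"
proof
  show "Sing chilean \<subseteq> pt ` set config_list"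
  proof
    fix P assume "P \<in> Sing chilean"
    then obtain c c' where c: "c \<in> set conic_list" "c' \<in> set conic_list" "conic c \<noteq> conic c'"
      and on: "on_curve P (conic c)" "on_curve P (conic c')"
      unfolding Sing_def chilean_def by (auto simp: singular_point_def mult_at_conic split: if_splits)
    define S where "S = pt ` {p \<in> set config_list. qval c p = 0 \<and> qval c' p = 0}"
    have "finite S" by (simp add: S_def)
    have "inj_on pt {p \<in> set config_list. qval c p = 0 \<and> qval c' p = 0}"
      by (rule inj_on_subset[OF inj_pt]) auto
    then have "card S = 4"
      unfolding S_def using conic_pairs c by (subst card_image) (auto simp only: card_filter[OF distinct_lists(1)])
    have mult: "(\<Sum>R\<in>insert P S. mult_at R (conic c')) = card (insert P S)"
    proof -
      have "mult_at R (conic c') = 1" if "R \<in> insert P S" for R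
        using that on(2) on_conic[OF _ c(2)] by (auto simp: mult_at_conic[OF c(2)] S_def)
      then show ?thesis by simp
    qed
    have "(\<Sum>R\<in>insert P S. mult_at R (conic c')) \<le> 2 * curve_degree (conic c')"
      using c on(1) on_conic[OF _ c(1)] \<open>finite S\<close>
      by (intro conic_bezout[OF c(1) conic_irreducible[OF c(2)]]) (auto simp: S_def)
    then have "card (insert P S) \<le> 4" using mult conic_degree[OF c(2)] by simp
    then have "P \<in> S" using \<open>card S = 4\<close> \<open>finite S\<close> by (simp add: card_insert_if split: if_splits)
    then show "P \<in> pt ` set config_list" by (auto simp: S_def)
  qed
  show "pt ` set config_list \<subseteq> Sing chilean"
  proof
    fix P assume "P \<in> pt ` set config_list"
    then obtain p where p: "P = pt p" "p \<in> set config_list" by blast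
    have "card {c \<in> set conic_list. qval c p = 0} \<ge> 2"
      using p(2) conics_through by (auto simp: card_filter[OF distinct_conics])
    then obtain T where T: "T \<subseteq> {c \<in> set conic_list. qval c p = 0}" "card T = 2"
      by (rule obtain_subset_with_card_n) blast
    obtain c c' where "T = {c, c'}" and ne: "c \<noteq> c'" using T(2) unfolding card_2_iff by blast
    then have c: "c \<in> set conic_list" "qval c p = 0" "c' \<in> set conic_list" "qval c' p = 0" "c \<noteq> c'"
      using T(1) by blast+
    then have "conic c \<noteq> conic c'" using inj_conic by (auto dest: inj_onD)
    moreover have "on_curve P (conic c)" "on_curve P (conic c')" using p c on_conic by auto
    ultimately show "P \<in> Sing chilean"
      unfolding Sing_def chilean_def using c by blast
  qed
qed

lemma mult_at_chilean:
  assumes "p \<in> set config_list"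
  shows "mult_at (pt p) (\<Sum>C\<in>chilean. C) = length (filter (\<lambda>c. qval c p = 0) conic_list)"
proof -
  have "mult_at (pt p) (\<Sum>C\<in>chilean. C) = (\<Sum>c\<in>set conic_list. mult_at (pt p) (conic c))"
    unfolding mult_at_sum chilean_def by (simp add: sum.reindex[OF inj_conic])
  also have "\<dots> = (\<Sum>c\<in>set conic_list. if qval c p = 0 then 1 else 0)"
    using assms by (intro sum.cong) (auto simp: mult_at_conic on_conic)
  also have "\<dots> = card {c \<in> set conic_list. qval c p = 0}"
    by (simp add: sum.If_cases Int_def)
  finally show ?thesis by (simp add: card_filter[OF distinct_conics])
qed

lemma bilin_cvec_qgrad: "polar c (cvec p) v = bilin (cvec (qgrad c p)) v"
  by (cases c; cases p) (simp add: polar_def bilin_def sum_3 algebra_simps)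

text \<open>
  At a common point of two curves that lies on no further component, the tangent cone of the whole
  arrangement is the union of the two tangent lines.
\<close>
lemma taylor2_transversal:
  assumes "eval3 F p = 0" "eval3 G p = 0"
  shows "taylor 2 (F * (G * H)) p v = taylor 1 F p v * taylor 1 G p v * eval3 H p"
  using assms by (simp add: taylor_mult numeral_2_eq_2 taylor_0)

lemma node_chilean:
  assumes p: "p \<in> set node_list"
  shows "is_node (pt p) (\<Sum>C\<in>chilean. C)"
proof -
  have pc: "p \<in> set config_list" using p by simp
  have cp: "cvec p \<noteq> 0" using config_nonzero pc cvec_nonzero by blast
  have "card {c \<in> set conic_list. qval c p = 0} = 2"
    using p conics_through by (simp add: card_filter[OF distinct_conics])
  then obtain c c' where "{c \<in> set conic_list. qval c p = 0} = {c, c'}" and ne: "c \<noteq> c'"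
    by (auto simp: card_2_iff)
  then have c: "c \<in> set conic_list" "qval c p = 0" "c' \<in> set conic_list" "qval c' p = 0" by auto
  have nec: "conic c \<noteq> conic c'" using inj_conic c ne by (auto dest: inj_onD)
  define R where "R = (\<Sum>C\<in>chilean - {conic c, conic c'}. C)"
  have sum: "(\<Sum>C\<in>chilean. C) = conic c + (conic c' + R)"
  proof -
    have fin: "finite chilean" by (simp add: chilean_def)
    have "(\<Sum>C\<in>chilean. C) = conic c + (\<Sum>C\<in>chilean - {conic c}. C)"
      using c fin by (intro sum.remove) (auto simp: chilean_def)
    also have "(\<Sum>C\<in>chilean - {conic c}. C) = conic c' + (\<Sum>C\<in>chilean - {conic c} - {conic c'}. C)"
      using c nec fin by (intro sum.remove) (auto simp: chilean_def)
    also have "chilean - {conic c} - {conic c'} = chilean - {conic c, conic c'}" by auto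
    finally show ?thesis by (simp add: R_def)
  qed
  have mult2: "mult_at (pt p) (\<Sum>C\<in>chilean. C) = 2"
    using mult_at_chilean[OF pc] conics_through(2) p by simp
  moreover have "mult_at (pt p) (conic c) = 1" "mult_at (pt p) (conic c') = 1"
    using c pc by (simp_all add: mult_at_conic on_conic)
  ultimately have R0: "mult_at (pt p) R = 0" unfolding sum mult_at_add by simp
  obtain H d where H: "R = abs_curve H" "H \<noteq> 0" "homogeneous d H" by (rule curve_cases)
  have nz: "conic_form c \<noteq> 0" "conic_form c' \<noteq> 0"
    using conic_form_nonzero c by blast+
  let ?F = "conic_form c * (conic_form c' * H)"
  have hom: "homogeneous (2 + d) (conic_form c' * H)" "homogeneous (2 + (2 + d)) ?F"
    by (intro homogeneous_mult homogeneous_conic_form H)+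
  have F0: "conic_form c' * H \<noteq> 0" "?F \<noteq> 0" using nz H by simp_all
  have sumF: "(\<Sum>C\<in>chilean. C) = abs_curve ?F"
    unfolding sum H(1) conic_def
    using plus_curve_abs[OF nz(2) homogeneous_conic_form H(2,3)]
      plus_curve_abs[OF nz(1) homogeneous_conic_form F0(1) hom(1)] by simp
  define h where "h = eval3 H (cvec p)"
  have "h \<noteq> 0"
    using R0 mult_at_abs[OF cp H(2,3)] mult3_eq_0_iff[OF H(2)] by (simp add: H(1) pt_def h_def)
  have "node3 ?F (cvec p)"
    unfolding node3_def
  proof (intro conjI exI allI)
    show "mult3 ?F (cvec p) = 2"
      using mult2 mult_at_abs[OF cp F0(2) hom(2)] unfolding sumF by (simp add: pt_def)
    fix v
    show "taylor 2 ?F (cvec p) v = bilin (h *s cvec (qgrad c p)) v * bilin (cvec (qgrad c' p)) v"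
      by (subst taylor2_transversal)
        (simp_all only: eval3_conic_form c cx_hom taylor1_conic_form bilin_cvec_qgrad bilin_scale
          h_def[symmetric] ac_simps)
  next
    fix k
    show "h *s cvec (qgrad c p) \<noteq> k *s cvec (qgrad c' p)"
    proof
      assume eq: "h *s cvec (qgrad c p) = k *s cvec (qgrad c' p)"
      have "cvec (qgrad c p) = (1 / h) *s (h *s cvec (qgrad c p))"
        using \<open>h \<noteq> 0\<close> by (simp add: vector_smult_assoc)
      also have "\<dots> = (k / h) *s cvec (qgrad c' p)" unfolding eq by (simp add: vector_smult_assoc)
      finally have "cross (qgrad c' p) (qgrad c p) = (0, 0, 0)" by (rule cross_proportional)
      then show False using conics_transversal p c ne by metis
    qed
  qed
  then show ?thesis
    unfolding sumF pt_def using is_node.abs_eq[OF proj_rel_refl[OF cp] form_rel_refl[OF F0(2) hom(2)]] by simp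
qed

lemma is_node_mult: "is_node P C \<Longrightarrow> mult_at P C = 2"
  by transfer (simp add: node3_def)

lemma multiplicity_8_points: "{P \<in> Sing chilean. mult_at P (\<Sum>C\<in>chilean. C) = 8} = pt ` set cusp_list"
  unfolding Sing_chilean using mult_at_chilean conics_through by (auto simp: image_iff)

lemma node_points: "{P \<in> Sing chilean. is_node P (\<Sum>C\<in>chilean. C)} = pt ` set node_list"
  unfolding Sing_chilean
  using mult_at_chilean conics_through node_chilean is_node_mult by (fastforce simp: image_iff)

lemma card_pt_image: "set xs \<subseteq> set config_list \<Longrightarrow> distinct xs \<Longrightarrow> card (pt ` set xs) = length xs"
  using card_image[OF inj_on_subset[OF inj_pt]] distinct_card by metis

section \<open>The Seshadri constant\<close>

lemma sum_mult_line:
  assumes "l \<in> set line_list"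
  shows "(\<Sum>P\<in>Sing chilean. mult_at P (line l)) = 5"
proof -
  have "(\<Sum>P\<in>Sing chilean. mult_at P (line l)) = (\<Sum>p\<in>set config_list. if dot l p = 0 then 1 else 0)"
    unfolding Sing_chilean sum.reindex[OF inj_pt] comp_def
    using assms by (intro sum.cong) (auto simp only: mult_at_line on_line)
  also have "\<dots> = card {p \<in> set config_list. dot l p = 0}"
    by (simp only: sum.If_cases finite_set Int_def mem_Collect_eq sum_constant mult_1_right sum.neutral_const add_0_right of_nat_id)
  finally show ?thesis
    using line_counts(1) assms by (simp only: card_filter[OF distinct_lists(1)])
qed

lemma sum_mult_conic:
  assumes "c \<in> set conic_list"
  shows "(\<Sum>P\<in>Sing chilean. mult_at P (conic c)) = 8"
proof -
  have "(\<Sum>P\<in>Sing chilean. mult_at P (conic c)) = (\<Sum>p\<in>set config_list. if qval c p = 0 then 1 else 0)"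
    unfolding Sing_chilean sum.reindex[OF inj_pt] comp_def
    using assms by (intro sum.cong) (auto simp only: mult_at_conic on_conic)
  also have "\<dots> = card {p \<in> set config_list. qval c p = 0}"
    by (simp only: sum.If_cases finite_set Int_def mem_Collect_eq sum_constant mult_1_right sum.neutral_const add_0_right of_nat_id)
  finally show ?thesis
    using conic_counts assms by (simp only: card_filter[OF distinct_lists(1)] filter_append length_append)
qed

text \<open>
  Let \<open>C\<close> have degree \<open>d\<close>, and let \<open>K\<close> and \<open>N\<close> be the sums of its multiplicities at the cusps
  and at the nodes.  Bezout's theorem, summed over the conics and over the lines, gives
  \<open>8 K + 2 N \<le> 24 d\<close> and \<open>K + 3 N \<le> 9 d\<close>, whence \<open>11 (K + N) \<le> 51 d\<close>.  Only the conics and lines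
  themselves escape this argument; their multiplicities add up to 8 and 5.
\<close>
lemma sum_mult_le:
  assumes C: "irreducible_curve C"
  shows "(\<Sum>P\<in>Sing chilean. mult_at P C) \<le> 5 * curve_degree C"
proof (cases "C \<in> conic ` set conic_list \<union> line ` set line_list")
  case True
  then show ?thesis
    using sum_mult_conic conic_degree sum_mult_line line_degree by auto
next
  case False
  define m where "m p = mult_at (pt p) C" for p
  let ?d = "curve_degree C"
  have swap: "(\<Sum>c\<in>set cs. \<Sum>p | p \<in> set config_list \<and> I c p. m p)
      = (\<Sum>p\<in>set config_list. length (filter (\<lambda>c. I c p) cs) * m p)" if "distinct cs"
    for cs :: "'c list" and I
    by (subst sum.swap_restrict) (simp_all only: finite_set sum_constant card_filter[OF that] of_nat_id)
  have split: "(\<Sum>p\<in>set config_list. f p) = (\<Sum>p\<in>set cusp_list. f p) + (\<Sum>p\<in>set node_list. f p)" for f :: "eis triple \<Rightarrow> nat"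
    unfolding set_append using distinct_lists(1) by (intro sum.union_disjoint) auto
  have reindex: "(\<Sum>p\<in>A. m p) = (\<Sum>P\<in>pt ` A. mult_at P C)" if "A \<subseteq> set config_list" for A
    by (simp add: sum.reindex[OF inj_on_subset[OF inj_pt that]] m_def)
  have "(\<Sum>c\<in>set conic_list. \<Sum>p | p \<in> set config_list \<and> qval c p = 0. m p) \<le> (\<Sum>c\<in>set conic_list. 2 * ?d)"
  proof (rule sum_mono)
    fix c assume c: "c \<in> set conic_list"
    have "(\<Sum>P\<in>pt ` {p. p \<in> set config_list \<and> qval c p = 0}. mult_at P C) \<le> 2 * ?d"
      using False c on_conic[OF _ c] by (intro conic_bezout[OF c C]) auto
    then show "(\<Sum>p | p \<in> set config_list \<and> qval c p = 0. m p) \<le> 2 * ?d"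
      by (subst reindex) auto
  qed
  also have "\<dots> = 24 * ?d" using distinct_card[OF distinct_conics] lengths by simp
  also have "(\<Sum>c\<in>set conic_list. \<Sum>p | p \<in> set config_list \<and> qval c p = 0. m p)
     = (\<Sum>p\<in>set cusp_list. 8 * m p) + (\<Sum>p\<in>set node_list. 2 * m p)"
    unfolding swap[OF distinct_conics] split using conics_through by (intro arg_cong2[where f = "(+)"] sum.cong) simp_all
  finally have conics: "8 * sum m (set cusp_list) + 2 * sum m (set node_list) \<le> 24 * ?d"
    by (simp add: sum_distrib_left)
  have "(\<Sum>l\<in>set line_list. \<Sum>p | p \<in> set config_list \<and> dot l p = 0. m p) \<le> (\<Sum>l\<in>set line_list. ?d)"
  proof (rule sum_mono)
    fix l assume l: "l \<in> set line_list"
    have "(\<Sum>P\<in>pt ` {p. p \<in> set config_list \<and> dot l p = 0}. mult_at P C) \<le> ?d"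
      using False l on_line[OF _ l] by (intro line_bezout[OF l C]) auto
    then show "(\<Sum>p | p \<in> set config_list \<and> dot l p = 0. m p) \<le> ?d"
      by (subst reindex) auto
  qed
  also have "\<dots> = 9 * ?d" using distinct_card[OF distinct_lines] by (simp add: line_list_def units3_def)
  also have "(\<Sum>l\<in>set line_list. \<Sum>p | p \<in> set config_list \<and> dot l p = 0. m p)
     = (\<Sum>p\<in>set cusp_list. 1 * m p) + (\<Sum>p\<in>set node_list. 3 * m p)"
    unfolding swap[OF distinct_lines] split using line_counts(2,3) by (intro arg_cong2[where f = "(+)"] sum.cong) simp_all
  finally have lines: "sum m (set cusp_list) + 3 * sum m (set node_list) \<le> 9 * ?d"
    by (simp add: sum_distrib_left)
  have "(\<Sum>P\<in>Sing chilean. mult_at P C) = sum m (set cusp_list) + sum m (set node_list)"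
    unfolding Sing_chilean reindex[OF order_refl, symmetric] by (rule split)
  then show ?thesis using conics lines by linarith
qed

lemma seshadri_chilean: "seshadri (Sing chilean) = 1 / 5"
  unfolding seshadri_def
proof (rule cInf_eq_minimum)
  let ?l = "(1, - 1, 0) :: eis triple"
  have l: "?l \<in> set line_list" by code_simp
  have "(1, 1, 1) \<in> set config_list" "dot ?l (1, 1, 1) = 0" by code_simp+
  then have "\<exists>P\<in>Sing chilean. on_curve P (line ?l)"
    unfolding Sing_chilean using on_line[OF _ l] by blast
  then show "1 / 5 \<in> {real (curve_degree C) / real (\<Sum>P\<in>Sing chilean. mult_at P C) | C.
     irreducible_curve C \<and> (\<exists>P\<in>Sing chilean. on_curve P C)}"
    using line_irreducible[OF l] line_degree[OF l] sum_mult_line[OF l]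
    by (intro CollectI exI[of _ "line ?l"]) simp
next
  fix x assume "x \<in> {real (curve_degree C) / real (\<Sum>P\<in>Sing chilean. mult_at P C) | C.
     irreducible_curve C \<and> (\<exists>P\<in>Sing chilean. on_curve P C)}"
  then obtain C P where x: "x = real (curve_degree C) / real (\<Sum>P\<in>Sing chilean. mult_at P C)"
    and C: "irreducible_curve C" and P: "P \<in> Sing chilean" "on_curve P C" by blast
  have "finite (Sing chilean)" by (simp add: Sing_chilean)
  then have "(\<Sum>P\<in>Sing chilean. mult_at P C) \<noteq> 0"
    using P mult_at_eq_0_iff by auto
  moreover have "real (\<Sum>P\<in>Sing chilean. mult_at P C) \<le> 5 * real (curve_degree C)"
    using sum_mult_le[OF C] by linarith
  ultimately show "1 / 5 \<le> x" unfolding x by (simp add: field_simps del: of_nat_sum)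
qed


section \<open>The cubic and the sextic\<close>

definition cubic_form :: poly3 where
  "cubic_form = var3 1 ^ 3 + var3 2 ^ 3 + var3 3 ^ 3 + 3 * (var3 1 * (var3 2 * var3 3))"

definition dual_form :: poly3 where
  "dual_form = var3 1 ^ 6 + var3 2 ^ 6 + var3 3 ^ 6
     - 6 * (var3 1 ^ 3 * var3 2 ^ 3 + var3 2 ^ 3 * var3 3 ^ 3 + var3 3 ^ 3 * var3 1 ^ 3)
     - 6 * (var3 1 ^ 4 * (var3 2 * var3 3) + var3 2 ^ 4 * (var3 3 * var3 1) + var3 3 ^ 4 * (var3 1 * var3 2))
     - 15 * (var3 1 ^ 2 * (var3 2 ^ 2 * var3 3 ^ 2))"

definition cubic_val :: "'a::comm_ring_1 \<Rightarrow> 'a \<Rightarrow> 'a \<Rightarrow> 'a" where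
  "cubic_val x y z = x ^ 3 + y ^ 3 + z ^ 3 + 3 * (x * (y * z))"

definition dual_val :: "'a::comm_ring_1 \<Rightarrow> 'a \<Rightarrow> 'a \<Rightarrow> 'a" where
  "dual_val x y z = x ^ 6 + y ^ 6 + z ^ 6 - 6 * (x ^ 3 * y ^ 3 + y ^ 3 * z ^ 3 + z ^ 3 * x ^ 3)
     - 6 * (x ^ 4 * (y * z) + y ^ 4 * (z * x) + z ^ 4 * (x * y)) - 15 * (x ^ 2 * (y ^ 2 * z ^ 2))"

text \<open>
  One sixth of the partial derivative of the sextic with respect to the first variable; the other
  two arise by cyclic permutation.
\<close>
definition dual_partial :: "complex \<Rightarrow> complex \<Rightarrow> complex \<Rightarrow> complex" where
  "dual_partial x y z = x ^ 5 - 3 * x ^ 2 * (y ^ 3 + z ^ 3) - y * z * (4 * x ^ 3 + y ^ 3 + z ^ 3) - 5 * x * y ^ 2 * z ^ 2"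

lemma eval3_cubic: "eval3 cubic_form v = cubic_val (v $ 1) (v $ 2) (v $ 3)"
  by (simp add: cubic_form_def cubic_val_def)

lemma eval3_dual: "eval3 dual_form v = dual_val (v $ 1) (v $ 2) (v $ 3)"
  by (simp add: dual_form_def dual_val_def)

lemma homogeneous_var_power: "homogeneous n (var3 i ^ n)"
  using homogeneous_power[OF homogeneous_var, of n] by simp

lemma homogeneous_numeral_mult: "homogeneous d F \<Longrightarrow> homogeneous d (numeral k * F)"
  using homogeneous_mult[OF homogeneous_numeral] by force

lemma homogeneous_cubic: "homogeneous 3 cubic_form"
proof -
  have "homogeneous (1 + (1 + 1)) (var3 1 * (var3 2 * var3 3))"
    by (intro homogeneous_mult homogeneous_var)
  then have "homogeneous 3 (var3 1 * (var3 2 * var3 3))" by (simp add: eval_nat_numeral)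
  then show ?thesis
    unfolding cubic_form_def
    by (intro homogeneous_add homogeneous_numeral_mult homogeneous_var_power)
qed

lemma homogeneous_dual: "homogeneous 6 dual_form"
proof -
  have 1: "homogeneous 6 (var3 i ^ 3 * var3 j ^ 3)" for i j
    using homogeneous_mult[OF homogeneous_var_power[of 3 i] homogeneous_var_power[of 3 j]] by simp
  have 2: "homogeneous 6 (var3 i ^ 4 * (var3 j * var3 k))" for i j k
    using homogeneous_mult[OF homogeneous_var_power[of 4 i] homogeneous_mult[OF homogeneous_var[of j] homogeneous_var[of k]]]
    by simp
  have 3: "homogeneous 6 (var3 i ^ 2 * (var3 j ^ 2 * var3 k ^ 2))" for i j k
    using homogeneous_mult[OF homogeneous_var_power[of 2 i]
        homogeneous_mult[OF homogeneous_var_power[of 2 j] homogeneous_var_power[of 2 k]]] by simp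
  show ?thesis
    unfolding dual_form_def
    by (intro homogeneous_add homogeneous_diff homogeneous_numeral_mult homogeneous_var_power 1 2 3)
qed

lemma cubic_nonzero: "cubic_form \<noteq> 0" and dual_nonzero: "dual_form \<noteq> 0"
proof -
  have "eval3 cubic_form (vector [1, 0, 0]) \<noteq> 0" "eval3 dual_form (vector [1, 0, 0]) \<noteq> 0"
    by (simp_all add: eval3_cubic eval3_dual cubic_val_def dual_val_def)
  then show "cubic_form \<noteq> 0" "dual_form \<noteq> 0" by auto
qed

lemma taylor_add_diff:
  "taylor k (F + G) p v = taylor k F p v + taylor k G p v"
  "taylor k (F - G) p v = taylor k F p v - taylor k G p v"
  by (simp_all add: taylor_def along_conv_ev eval_poly.ev_simps)

lemma taylor_numeral: "taylor k (numeral n) p v = (if k = 0 then numeral n else 0)"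
  by (simp add: taylor_def along_conv_ev eval_poly.ev_simps coeff_pCons split: nat.split)

lemma taylor_var_power: "taylor k (var3 i ^ n) p v = of_nat (n choose k) * v $ i ^ k * p $ i ^ (n - k)"
proof (cases "k \<le> n")
  case True
  then show ?thesis
    by (simp add: taylor_def along_conv_ev eval_poly.ev_simps coeff_linear_poly_power)
next
  case False
  have "degree ([:p $ i, v $ i:] ^ n) \<le> degree [:p $ i, v $ i:] * n" by (rule degree_power_le)
  also have "\<dots> \<le> n" by simp
  finally show ?thesis
    using False by (simp add: taylor_def along_conv_ev eval_poly.ev_simps coeff_eq_0)
qed

lemma taylor_var: "taylor k (var3 i) p v = (if k = 0 then p $ i else if k = 1 then v $ i else 0)"
  by (simp add: taylor_def along_conv_ev coeff_pCons split: nat.split)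

lemmas taylor_rules = taylor_add_diff taylor_mult taylor_numeral taylor_var_power taylor_var

lemma taylor1_cubic: "taylor 1 cubic_form p v =
    3 * ((p $ 1 ^ 2 + p $ 2 * p $ 3) * v $ 1 + (p $ 2 ^ 2 + p $ 1 * p $ 3) * v $ 2 + (p $ 3 ^ 2 + p $ 1 * p $ 2) * v $ 3)"
  by (simp add: cubic_form_def taylor_rules algebra_simps power2_eq_square)

lemma taylor1_dual: "taylor 1 dual_form p v =
    6 * (dual_partial (p $ 1) (p $ 2) (p $ 3) * v $ 1 + dual_partial (p $ 2) (p $ 3) (p $ 1) * v $ 2
      + dual_partial (p $ 3) (p $ 1) (p $ 2) * v $ 3)"
  by (simp add: dual_form_def dual_partial_def taylor_rules) (simp add: algebra_simps eval_nat_numeral)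

lemma cubic_smooth:
  fixes x y z :: complex
  assumes "x ^ 2 + y * z = 0" "y ^ 2 + x * z = 0" "z ^ 2 + x * y = 0"
  shows "x = 0 \<and> y = 0 \<and> z = 0"
proof -
  have "x ^ 3 = - (x * y * z)" "y ^ 3 = - (x * y * z)" "z ^ 3 = - (x * y * z)"
    using assms by algebra+
  moreover have "2 * (x * y * z) ^ 2 = 0" using assms by algebra
  then have "x * y * z = 0" by simp
  ultimately show ?thesis by simp
qed

section \<open>Duality\<close>

text \<open>
  The cofactor is the quotient of the sextic in the partial derivatives by the cubic.
\<close>
lemma dual_of_tangent:
  fixes x y z :: complex
  assumes "cubic_val x y z = 0"
  shows "dual_val (x ^ 2 + y * z) (y ^ 2 + x * z) (z ^ 2 + x * y) = 0"
proof -
  have "dual_val (x ^ 2 + y * z) (y ^ 2 + x * z) (z ^ 2 + x * y) = cubic_val x y z *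
    (x ^ 9 + y ^ 9 + z ^ 9 - 13 * (y^3*z^6 + y^6*z^3 + x^3*z^6 + x^3*y^6 + x^6*z^3 + x^6*y^3)
     - 3 * (x*y*z^7 + x*y^7*z + x^7*y*z) - 54 * (x*y^4*z^4 + x^4*y*z^4 + x^4*y^4*z)
     - 57 * (x^2*y^2*z^5 + x^2*y^5*z^2 + x^5*y^2*z^2) - 95 * (x^3*y^3*z^3))"
    unfolding dual_val_def cubic_val_def by algebra
  then show ?thesis using assms by simp
qed

text \<open>
  The cubic \<open>p0 x^3 + 3 p1 x^2 y + 3 p2 x y^2 + p3 y^3\<close> has discriminant \<open>H1^2 - 4 H0 H2\<close> up to
  a constant, which is the discriminant of its Hessian \<open>H0 x^2 + H1 x y + H2 y^2\<close>.  If it vanishes,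
  the double root \<open>(H1, - 2 H0)\<close> of the Hessian is a double root of the cubic, unless \<open>H0\<close> and \<open>H1\<close>
  are both zero; then the cubic is the cube of a linear form or has the double root \<open>(1, 0)\<close>.
\<close>
lemma binary_cubic_double_root:
  fixes p0 p1 p2 p3 :: complex
  assumes disc: "p0^2*p3^2 - 6*p0*p1*p2*p3 + 4*p0*p2^3 + 4*p1^3*p3 - 3*p1^2*p2^2 = 0"
  obtains x y where "x \<noteq> 0 \<or> y \<noteq> 0" "p0*x^2 + 2*p1*x*y + p2*y^2 = 0" "p1*x^2 + 2*p2*x*y + p3*y^2 = 0"
proof -
  define H0 H1 H2 where "H0 = p0*p2 - p1^2" and "H1 = p0*p3 - p1*p2" and "H2 = p1*p3 - p2^2"
  note H = H0_def H1_def H2_def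
  show ?thesis
  proof (cases "H0 = 0 \<and> H1 = 0")
    case False
    then have "H1 \<noteq> 0 \<or> - 2 * H0 \<noteq> 0" by auto
    moreover have "p0*H1^2 + 2*p1*H1*(- 2 * H0) + p2*(- 2 * H0)^2 = 0"
      "p1*H1^2 + 2*p2*H1*(- 2 * H0) + p3*(- 2 * H0)^2 = 0"
      using disc unfolding H by algebra+
    ultimately show ?thesis by (rule that)
  next
    case True
    then have H01: "p0*p2 = p1^2" "p0*p3 = p1*p2" by (simp_all add: H)
    show ?thesis
    proof (cases "p0 = 0")
      case False
      have "p0 * (p1*(- p1)^2 + 2*p2*(- p1)*p0 + p3*p0^2) = 0" and *: "p0*(- p1)^2 + 2*p1*(- p1)*p0 + p2*p0^2 = 0"
        using H01 by algebra+
      then have "p1*(- p1)^2 + 2*p2*(- p1)*p0 + p3*p0^2 = 0" using False by (simp only: mult_eq_0_iff) simp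
      with * show ?thesis using False that by blast
    next
      case True
      then have "p1 = 0" using H01 by simp
      then show ?thesis using True by (intro that[of 1 0]) simp_all
    qed
  qed
qed

text \<open>
  A line \<open>a x + b y + c z = 0\<close> with \<open>c \<noteq> 0\<close> is parametrized by
  \<open>(c x, c y, - (a x + b y))\<close>.  The restriction of the cubic to it has, up to a constant, the discriminant
  \<open>c^6\<close> times the sextic, so a zero of the sextic gives a double root, that is, a point where the gradient of the
  cubic is proportional to the line.
\<close>
lemma tangent_of_dual_aux:
  fixes a b c :: complex
  assumes D: "dual_val a b c = 0" and c: "c \<noteq> 0"
  obtains x y z k where "x \<noteq> 0 \<or> y \<noteq> 0 \<or> z \<noteq> 0" "k \<noteq> 0" "cubic_val x y z = 0"
    "x ^ 2 + y * z = k * a" "y ^ 2 + x * z = k * b" "z ^ 2 + x * y = k * c"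
proof -
  define p0 p1 p2 p3 where "p0 = c^3 - a^3" and "p1 = - (a^2*b + a*c^2)" and "p2 = - (a*b^2 + b*c^2)" and "p3 = c^3 - b^3"
  note p = p0_def p1_def p2_def p3_def
  have "p0^2*p3^2 - 6*p0*p1*p2*p3 + 4*p0*p2^3 + 4*p1^3*p3 - 3*p1^2*p2^2 = c^6 * dual_val a b c"
    unfolding p dual_val_def by algebra
  then have "p0^2*p3^2 - 6*p0*p1*p2*p3 + 4*p0*p2^3 + 4*p1^3*p3 - 3*p1^2*p2^2 = 0" using D by simp
  then obtain x y where xy: "x \<noteq> 0 \<or> y \<noteq> 0" "p0*x^2 + 2*p1*x*y + p2*y^2 = 0" "p1*x^2 + 2*p2*x*y + p3*y^2 = 0"
    by (rule binary_cubic_double_root)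
  define X Y Z where "X = c * x" and "Y = c * y" and "Z = - (a * x + b * y)"
  note XYZ = X_def Y_def Z_def
  define k where "k = (Z ^ 2 + X * Y) / c"
  have kc: "Z ^ 2 + X * Y = k * c" using c by (simp add: k_def)
  have "c * (X ^ 2 + Y * Z) = (Z ^ 2 + X * Y) * a" "c * (Y ^ 2 + X * Z) = (Z ^ 2 + X * Y) * b"
    using xy(2,3) unfolding p XYZ by algebra+
  then have ka: "X ^ 2 + Y * Z = k * a" and kb: "Y ^ 2 + X * Z = k * b"
    using c by (simp_all add: k_def field_simps)
  \<comment> \<open>If \<open>k\<close> were zero, all partial derivatives would vanish at a point of a smooth cubic.\<close>
  have nz: "X \<noteq> 0 \<or> Y \<noteq> 0" using xy(1) c by (auto simp: XYZ)
  have "k \<noteq> 0"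
  proof
    assume "k = 0"
    then show False using cubic_smooth[of X Y Z] ka kb kc nz by simp
  qed
  moreover have "cubic_val X Y Z = X * (X ^ 2 + Y * Z) + Y * (Y ^ 2 + X * Z) + Z * (Z ^ 2 + X * Y)"
    unfolding cubic_val_def by algebra
  then have "cubic_val X Y Z = k * (a * X + b * Y + c * Z)"
    unfolding ka kb kc by (simp add: algebra_simps)
  then have "cubic_val X Y Z = 0" by (simp add: XYZ algebra_simps)
  ultimately show ?thesis using that ka kb kc nz by blast
qed

lemma tangent_of_dual:
  fixes a b c :: complex
  assumes D: "dual_val a b c = 0" and nz: "a \<noteq> 0 \<or> b \<noteq> 0 \<or> c \<noteq> 0"
  obtains x y z k where "x \<noteq> 0 \<or> y \<noteq> 0 \<or> z \<noteq> 0" "k \<noteq> 0" "cubic_val x y z = 0"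
    "x ^ 2 + y * z = k * a" "y ^ 2 + x * z = k * b" "z ^ 2 + x * y = k * c"
proof -
  have sym: "dual_val b c a = dual_val a b c" "dual_val c a b = dual_val a b c"
    unfolding dual_val_def by algebra+
  have symc: "cubic_val y z x = cubic_val x y z" "cubic_val z x y = cubic_val x y z" for x y z :: complex
    unfolding cubic_val_def by algebra+
  consider "c \<noteq> 0" | "a \<noteq> 0" | "b \<noteq> 0" using nz by blast
  then show ?thesis
  proof cases
    case 1
    show ?thesis by (rule tangent_of_dual_aux[OF D 1]) (rule that)
  next
    case 2
    have "dual_val b c a = 0" using D sym by simp
    from tangent_of_dual_aux[OF this 2] obtain x y z k where *: "x \<noteq> 0 \<or> y \<noteq> 0 \<or> z \<noteq> 0" "k \<noteq> 0"
      "cubic_val x y z = 0" "x ^ 2 + y * z = k * b" "y ^ 2 + x * z = k * c" "z ^ 2 + x * y = k * a" .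
    moreover have "cubic_val z x y = 0" using *(3) symc by metis
    ultimately show ?thesis by (intro that[of z x y k]) (auto simp: mult.commute)
  next
    case 3
    have "dual_val c a b = 0" using D sym by simp
    from tangent_of_dual_aux[OF this 3] obtain x y z k where *: "x \<noteq> 0 \<or> y \<noteq> 0 \<or> z \<noteq> 0" "k \<noteq> 0"
      "cubic_val x y z = 0" "x ^ 2 + y * z = k * c" "y ^ 2 + x * z = k * a" "z ^ 2 + x * y = k * b" .
    moreover have "cubic_val y z x = 0" using *(3) symc by metis
    ultimately show ?thesis by (intro that[of y z x k]) (auto simp: mult.commute)
  qed
qed

text \<open>
  Biduality: at the tangent line of the cubic at \<open>p\<close> the gradient of the sextic is proportional to
  \<open>p\<close>.  The factor has degree 9 in \<open>p\<close> and is, up to a constant, the cube of the Hessian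
  determinant, which modulo the cubic is a multiple of \<open>x y z\<close>.  So the gradient vanishes only at tangents in flexes.
\<close>
lemma dual_partial_at_tangent:
  fixes x y z :: complex
  assumes "cubic_val x y z = 0"
  shows "dual_partial (x ^ 2 + y * z) (y ^ 2 + x * z) (z ^ 2 + x * y) = 16 * x * (x * y * z) ^ 3"
proof -
  have "dual_partial (x ^ 2 + y * z) (y ^ 2 + x * z) (z ^ 2 + x * y) = 16 * x * (x * y * z) ^ 3 + cubic_val x y z *
    (x^7 - 4 * (y^2*z^5 + y^5*z^2) - (x*z^6 + x*y^6) - 14 * (x*y^3*z^3) - 12 * (x^2*y*z^4 + x^2*y^4*z)
     - 23 * (x^3*y^2*z^2) - 8 * (x^4*z^3 + x^4*y^3) - 2 * (x^5*y*z))"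
    unfolding dual_partial_def cubic_val_def by algebra
  then show ?thesis using assms by simp
qed

lemma cube_root_of_unity:
  fixes u :: complex
  assumes "u ^ 3 = 1" shows "\<exists>e\<in>set units3. u = cx e"
proof -
  have "(u - 1) * ((u - omega) * (u - omega * omega)) = 0"
    using assms omega_square by algebra
  then have "u = 1 \<or> u = omega \<or> u = omega * omega" by auto
  moreover have "cx zeta = omega" by (simp add: zeta_def)
  ultimately show ?thesis by (auto simp: units3_def)
qed

text \<open>
  A singular point of the sextic is a tangent at a point where \<open>x y z = 0\<close>, hence at one of the
  nine flexes.
\<close>
lemma dual_singular_is_cusp_point:
  assumes v: "v \<noteq> 0" and on: "eval3 dual_form v = 0" and sing: "\<And>u. taylor 1 dual_form v u = 0"
  shows "\<exists>q\<in>set cusp_list. \<exists>k. k \<noteq> 0 \<and> v = k *s cvec q"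
proof -
  have "v $ 1 \<noteq> 0 \<or> v $ 2 \<noteq> 0 \<or> v $ 3 \<noteq> 0" using v by (auto simp: vec_eq_iff forall_3)
  then obtain x y z k where xyz: "x \<noteq> 0 \<or> y \<noteq> 0 \<or> z \<noteq> 0" and k: "k \<noteq> 0" and E: "cubic_val x y z = 0"
    and l: "x ^ 2 + y * z = k * v $ 1" "y ^ 2 + x * z = k * v $ 2" "z ^ 2 + x * y = k * v $ 3"
    using on tangent_of_dual unfolding eval3_dual by metis
  have scale: "dual_partial (k * a) (k * b) (k * c) = k ^ 5 * dual_partial a b c" for a b c
    unfolding dual_partial_def by algebra
  have symc: "cubic_val y z x = 0" "cubic_val z x y = 0"
    using E unfolding cubic_val_def by algebra+
  have "dual_partial (v $ 1) (v $ 2) (v $ 3) = 0" "dual_partial (v $ 2) (v $ 3) (v $ 1) = 0"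
    "dual_partial (v $ 3) (v $ 1) (v $ 2) = 0"
    using sing[of "vector [1, 0, 0]"] sing[of "vector [0, 1, 0]"] sing[of "vector [0, 0, 1]"]
    by (simp_all add: taylor1_dual del: One_nat_def)
  then have partials: "dual_partial (k * v $ 1) (k * v $ 2) (k * v $ 3) = 0"
    "dual_partial (k * v $ 2) (k * v $ 3) (k * v $ 1) = 0" "dual_partial (k * v $ 3) (k * v $ 1) (k * v $ 2) = 0"
    by (simp_all add: scale)
  have l': "y ^ 2 + z * x = k * v $ 2" "z ^ 2 + y * x = k * v $ 3" "x ^ 2 + z * y = k * v $ 1"
    using l by (simp_all add: mult.commute)
  have "16 * x * (x * y * z) ^ 3 = 0" "16 * y * (y * z * x) ^ 3 = 0" "16 * z * (z * x * y) ^ 3 = 0"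
    using dual_partial_at_tangent[OF E] dual_partial_at_tangent[OF symc(1)] dual_partial_at_tangent[OF symc(2)]
    unfolding l l' partials by simp_all
  then have "x = 0 \<or> y = 0 \<or> z = 0" using xyz by auto
  have cuspI: ?thesis if "e \<in> set units3" "q \<in> {(- 1, e, e * e), (e * e, - 1, e), (e, e * e, - 1)}"
    "j \<noteq> 0" "k *s v = j *s cvec q" for e q j
  proof -
    have "q \<in> set cusp_list" using that(1,2) by (auto simp: cusp_list_def)
    moreover have "v = (j / k) *s cvec q"
    proof -
      have "v = (1 / k) *s (k *s v)" using k by (simp add: vector_smult_assoc)
      also have "\<dots> = (j / k) *s cvec q" unfolding that(4) by (simp add: vector_smult_assoc)
      finally show ?thesis .
    qed
    moreover have "j / k \<noteq> 0" using k that(3) by simp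
    ultimately show ?thesis by blast
  qed
  have unit: "\<exists>e\<in>set units3. s = - cx e * t \<and> cx e ^ 3 = 1" if "s ^ 3 + t ^ 3 = 0" "t \<noteq> 0" for s t :: complex
  proof -
    have "(- s) ^ 3 = t ^ 3" using that(1) by algebra
    then have "(- s / t) ^ 3 = 1" unfolding power_divide using that(2) by simp
    then obtain e where "e \<in> set units3" "- s / t = cx e" using cube_root_of_unity by blast
    moreover from this have "- s = cx e * t" using that(2) by (simp add: field_simps)
    then have "s = - cx e * t" by (metis minus_minus mult_minus_left)
    ultimately show ?thesis using \<open>(- s / t) ^ 3 = 1\<close> by auto
  qed
  from \<open>x = 0 \<or> y = 0 \<or> z = 0\<close> consider "x = 0" | "y = 0" | "z = 0" by blast
  then show ?thesis
  proof cases
    case 1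
    then have "z \<noteq> 0" "y ^ 3 + z ^ 3 = 0" using E xyz by (auto simp: cubic_val_def)
    then obtain e where e: "e \<in> set units3" "y = - cx e * z" "cx e ^ 3 = 1" using unit by blast
    have "cx e \<noteq> 0" using e(3) by auto
    then show ?thesis
      using l e(2,3) 1 \<open>z \<noteq> 0\<close>
      by (intro cuspI[OF e(1), of "(- 1, e, e * e)" "z ^ 2 * cx e"] vec3_eqI)
        (simp_all del: cx_eq_0_iff, algebra+)
  next
    case 2
    then have "x \<noteq> 0" "z ^ 3 + x ^ 3 = 0" using E xyz by (auto simp: cubic_val_def algebra_simps)
    then obtain e where e: "e \<in> set units3" "z = - cx e * x" "cx e ^ 3 = 1" using unit by blast
    have "cx e \<noteq> 0" using e(3) by auto
    then show ?thesis
      using l e(2,3) 2 \<open>x \<noteq> 0\<close>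
      by (intro cuspI[OF e(1), of "(e * e, - 1, e)" "x ^ 2 * cx e"] vec3_eqI)
        (simp_all del: cx_eq_0_iff, algebra+)
  next
    case 3
    then have "y \<noteq> 0" "x ^ 3 + y ^ 3 = 0" using E xyz by (auto simp: cubic_val_def)
    then obtain e where e: "e \<in> set units3" "x = - cx e * y" "cx e ^ 3 = 1" using unit by blast
    have "cx e \<noteq> 0" using e(3) by auto
    then show ?thesis
      using l e(2,3) 3 \<open>y \<noteq> 0\<close>
      by (intro cuspI[OF e(1), of "(e, e * e, - 1)" "y ^ 2 * cx e"] vec3_eqI)
        (simp_all del: cx_eq_0_iff, algebra+)
  qed
qed

section \<open>The cusps of the sextic\<close>

lemma cusp3_symmetry:
  assumes AB: "A ** B = mat 1" and inv: "\<And>x. eval3 F (A *v x) = eval3 F x" and cusp: "cusp3 F p"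
  shows "cusp3 F (A *v p)"
proof -
  have AB': "A *v (B *v x) = x" for x by (simp add: matrix_vector_mul_assoc AB)
  have along: "along F (A *v p) (A *v v) = along F p v" for v
  proof (subst poly_eq_poly_eq_iff[symmetric], rule ext)
    fix t
    have "A *v p + t *s (A *v v) = A *v (p + t *s v)"
      by (simp add: matrix_vector_right_distrib vector_scalar_commute)
    then show "poly (along F (A *v p) (A *v v)) t = poly (along F p v) t"
      by (simp add: poly_along inv)
  qed
  then have taylor: "taylor k F (A *v p) v = taylor k F p (B *v v)" for k v
    using along[of "B *v v"] by (simp add: AB' taylor_def)
  have "B ** A = mat 1" using AB by (simp add: matrix_left_right_inverse)
  then have BA: "B *v (A *v v) = v" for v by (simp add: matrix_vector_mul_assoc)
  obtain a v where a: "mult3 F p = 2" "\<And>v. taylor 2 F p v = (bilin a v)\<^sup>2" "bilin a v = 0" "taylor 3 F p v \<noteq> 0"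
    using cusp by (auto simp: cusp3_def)
  define a' :: "complex ^ 3" where "a' = (\<chi> j. \<Sum>i\<in>UNIV. a $ i * B $ i $ j)"
  have a': "bilin a' v = bilin a (B *v v)" for v
    by (simp add: bilin_def a'_def matrix_vector_mult_def sum_3 algebra_simps)
  have "(\<exists>v. taylor k F (A *v p) v \<noteq> 0) = (\<exists>v. taylor k F p v \<noteq> 0)" for k
    unfolding taylor by (metis BA)
  then have "mult3 F (A *v p) = 2" using a(1) by (simp add: mult3_def)
  moreover have "\<forall>v. taylor 2 F (A *v p) v = (bilin a' v)\<^sup>2"
    by (simp add: taylor a(2) a')
  moreover have "bilin a' (A *v v) = 0" "taylor 3 F (A *v p) (A *v v) \<noteq> 0"
    using a(3,4) by (simp_all add: a' taylor BA)
  ultimately show ?thesis unfolding cusp3_def by blast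
qed

lemma dual_cusp_base: "cusp3 dual_form (vector [- 1, 1, 1])"
proof -
  let ?p = "vector [- 1, 1, 1] :: complex ^ 3"
  have t2: "taylor 2 dual_form ?p v = (bilin (vector [0, 6, - 6]) v)\<^sup>2" for v
    by (simp add: dual_form_def taylor_rules bilin_def sum_3 eval_nat_numeral algebra_simps)
  have t3: "taylor 3 dual_form ?p (vector [1, 0, 0]) \<noteq> 0"
    by (simp add: dual_form_def taylor_rules eval_nat_numeral)
  have t1: "taylor 1 dual_form ?p v = 0" for v
    unfolding taylor1_dual by (simp add: dual_partial_def)
  have t0: "eval3 dual_form ?p = 0" by (simp add: eval3_dual dual_val_def)
  have "mult3 dual_form ?p = 2"
  proof (rule mult3_eqI)
    show "taylor k dual_form ?p v = 0" if "k < 2" for k v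
      using that t0 t1 by (cases "k = 0") (auto simp: taylor_0 less_Suc_eq numeral_2_eq_2)
    show "taylor 2 dual_form ?p (vector [0, 1, 0]) \<noteq> 0"
      by (simp add: t2 bilin_def sum_3)
  qed
  moreover have "bilin (vector [0, 6, - 6]) (vector [1, 0, 0]) = 0" by (simp add: bilin_def sum_3)
  ultimately show ?thesis unfolding cusp3_def using t2 t3 by blast
qed

text \<open>
  The diagonal matrices \<open>(1, u, u^2)\<close> and the cyclic shift preserve the sextic and permute the nine
  points transitively.
\<close>
lemma dual_cusps:
  assumes "q \<in> set cusp_list" shows "cusp3 dual_form (cvec q)"
proof -
  obtain e where e: "e \<in> set units3" and q: "q \<in> {(- 1, e, e * e), (e * e, - 1, e), (e, e * e, - 1)}"
    using assms by (auto simp: cusp_list_def)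
  define u where "u = cx e"
  have "\<forall>e\<in>set units3. e * e * e = 1" by code_simp
  then have u: "u ^ 3 = 1"
    using e cx_hom(6)[of "e * e" e] by (simp add: u_def power3_eq_cube del: cx_hom(6)) (simp add: u_def)
  then have "u \<noteq> 0" by auto
  define A where "A = columns3 (vector [1, 0, 0]) (vector [0, u, 0]) (vector [0, 0, u * u])"
  define S where "S = columns3 (vector [0, 1, 0]) (vector [0, 0, 1]) (vector [1, 0, 0])"
  have A: "A *v x = vector [x $ 1, u * x $ 2, u * u * x $ 3]" for x
    unfolding A_def columns3_mult by (rule vec3_eqI) simp_all
  have S: "S *v x = vector [x $ 3, x $ 1, x $ 2]" for x
    unfolding S_def columns3_mult by (rule vec3_eqI) simp_all
  have "det A \<noteq> 0" "det S \<noteq> 0" using \<open>u \<noteq> 0\<close> by (simp_all add: A_def S_def det_columns3)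
  then obtain A' S' where inv: "A ** A' = mat 1" "S ** S' = mat 1"
    using det_nonzero_right_inverse by metis
  have "dual_val x (u * y) (u * u * z) = dual_val x y z" for x y z
    using u unfolding dual_val_def by algebra
  then have invA: "eval3 dual_form (A *v x) = eval3 dual_form x" for x by (simp add: A eval3_dual)
  have "dual_val z x y = dual_val x y z" for x y z :: complex unfolding dual_val_def by algebra
  then have invS: "eval3 dual_form (S *v x) = eval3 dual_form x" for x by (simp add: S eval3_dual)
  note base = cusp3_symmetry[OF inv(1) invA dual_cusp_base]
  note shifted = cusp3_symmetry[OF inv(2) invS base]
  note shifted2 = cusp3_symmetry[OF inv(2) invS shifted]
  from base shifted shifted2 show ?thesis
    using q by (auto simp: A S u_def)
qed

lemma taylor1_gradient: "taylor 1 F p v = bilin (grad F p) v"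
proof -
  have "taylor 1 F p v = (\<Sum>i\<in>UNIV. taylor 1 F p (axis i 1) * v $ i)"
  proof (induction F rule: poly3_induct)
    case (const a)
    show ?case by (simp add: taylor_def along_conv_ev)
  next
    case (var i)
    show ?case by (simp add: taylor_var axis_def if_distrib[of "\<lambda>x. x * _"] cong: if_cong)
  next
    case (add F G)
    then show ?case by (simp add: taylor_add_diff sum.distrib distrib_right)
  next
    case (mult F G)
    then show ?case by (simp add: taylor_mult taylor_0 sum.distrib sum_distrib_left algebra_simps)
  qed
  then show ?thesis by (simp add: bilin_def grad_conv_taylor)
qed

text \<open>
  A cusp is unibranch: if two factors passed through it, both would have the cuspidal tangent as
  tangent line, and then the cubic term \<open>f1 g2 + f2 g1\<close> of the product would vanish along it.
\<close>
lemma cusp_not_crossing: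
  assumes cusp: "cusp3 (F * G) p" and nz: "F \<noteq> 0" "G \<noteq> 0"
  shows "mult3 F p = 2 \<and> mult3 G p = 0 \<or> mult3 F p = 0 \<and> mult3 G p = 2"
proof (rule ccontr)
  assume neg: "\<not> ?thesis"
  obtain a v where a: "mult3 (F * G) p = 2" "\<And>v. taylor 2 (F * G) p v = (bilin a v)\<^sup>2" "bilin a v = 0"
    "taylor 3 (F * G) p v \<noteq> 0"
    using cusp by (auto simp: cusp3_def)
  have "mult3 F p + mult3 G p = 2" using a(1) mult3_mult[OF nz] by simp
  then have "mult3 F p = 1" "mult3 G p = 1" using neg by arith+
  then have 0: "eval3 F p = 0" "eval3 G p = 0"
    using mult3_eq_0_iff[OF nz(1), of p] mult3_eq_0_iff[OF nz(2), of p] by auto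
  let ?f = "taylor 1 F p" and ?g = "taylor 1 G p"
  have fg: "?f v * ?g v = (bilin a v)\<^sup>2" for v
    using a(2)[of v] by (simp add: taylor_mult numeral_2_eq_2 taylor_0 0)
  obtain w where "taylor 2 (F * G) p w \<noteq> 0" 
    using taylor_mult3_nonzero[of "F * G" p] nz a(1) by auto
  then have w: "bilin a w \<noteq> 0" by (simp add: a(2))
  have "?f v = 0 \<and> ?g v = 0"
  proof -
    \<comment> \<open>Adding \<open>v\<close>, on which \<open>bilin a\<close> vanishes, to \<open>w\<close> does not change the product \<open>f g\<close>;
      as one of \<open>f v\<close> and \<open>g v\<close> is zero, this forces the other to be zero as well.\<close>
    have sum: "?f (w + v) = ?f w + ?f v" "?g (w + v) = ?g w + ?g v" "bilin a (w + v) = bilin a w"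
      using a(3) by (simp_all add: taylor1_gradient bilin_def sum.distrib algebra_simps del: One_nat_def)
    have "(?f w + ?f v) * (?g w + ?g v) = (bilin a w)\<^sup>2"
      using fg[of "w + v"] by (simp only: sum)
    moreover have "?f v * ?g v = 0" using fg[of v] a(3) by simp
    ultimately show ?thesis using fg[of w] w by (auto simp: algebra_simps)
  qed
  then have "taylor 3 (F * G) p v = 0"
    by (simp add: taylor_mult eval_nat_numeral taylor_0 0)
  with a(4) show False by simp
qed

section \<open>Irreducibility of the sextic\<close>

lemma dual_nonzero_at_nodes: "\<forall>p\<in>set node_list. case p of (x, y, z) \<Rightarrow> dual_val x y z \<noteq> 0"
  by code_simp

lemma eval3_dual_cvec: "eval3 dual_form (cvec (x, y, z)) = cx (dual_val x y z)"
proof -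
  have power: "cx (x ^ n) = cx x ^ n" for x n by (induction n) simp_all
  show ?thesis by (simp add: eval3_dual dual_val_def power)
qed

text \<open>
  Each conic contains a node, and the sextic does not pass through the nodes.
\<close>
lemma conic_not_dvd_dual:
  assumes c: "c \<in> set conic_list" shows "\<not> conic_form c dvd dual_form"
proof
  assume "conic_form c dvd dual_form"
  then obtain G where G: "dual_form = conic_form c * G" by (rule dvdE)
  have "filter (\<lambda>p. qval c p = 0) node_list \<noteq> []"
    using conic_counts c by fastforce
  then obtain p where p: "p \<in> set node_list" "qval c p = 0"
    by (auto simp: filter_empty_conv)
  have "eval3 dual_form (cvec p) = 0" unfolding G by (simp add: eval3_conic_form p(2))
  moreover have "eval3 dual_form (cvec p) \<noteq> 0"
    using bspec[OF dual_nonzero_at_nodes p(1)] by (cases p) (simp only: eval3_dual_cvec cx_eq_0_iff prod.case not_False_eq_True)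
  ultimately show False by simp
qed

lemma factor_on_conic:
  assumes F: "homogeneous a F" "F dvd dual_form" and c: "c \<in> set conic_list"
  shows "(\<Sum>q | q \<in> set cusp_list \<and> qval c q = 0. mult3 F (cvec q)) \<le> 2 * a"
proof -
  obtain \<phi> where "rational_curve (conic_form c) \<phi> 2" using rational_conics[OF c] ..
  then interpret rational_curve "conic_form c" \<phi> 2 .
  let ?K = "{q. q \<in> set cusp_list \<and> qval c q = 0}"
  have nz: "cvec q \<noteq> 0" if "q \<in> set config_list" for q
    using that config_nonzero cvec_nonzero by blast
  have distinct: "p = q" if "p \<in> ?K" "q \<in> ?K" "proj_rel (cvec p) (cvec q)" for p q
  proof (rule inj_onD[OF inj_pt])
    show "pt p = pt q" using that abs_point_eq_iff[OF nz nz, of p q] by (simp add: pt_def)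
  qed (use that in auto)
  have inj: "inj_on cvec ?K"
  proof (rule inj_onI)
    fix p q assume pq: "p \<in> ?K" "q \<in> ?K" and eq: "cvec p = cvec q"
    have "cvec p \<noteq> 0" using pq(1) by (intro nz) simp
    then have "proj_rel (cvec p) (cvec q)" unfolding eq[symmetric] by (rule proj_rel_refl)
    then show "p = q" by (rule distinct[OF pq])
  qed
  have "(\<Sum>x\<in>cvec ` ?K. mult3 F x) \<le> 2 * a"
  proof (rule bezout[OF F(1)])
    show "\<not> conic_form c dvd F" using conic_not_dvd_dual[OF c] F(2) dvd_trans by blast
    show "finite (cvec ` ?K)" by simp
    show "x \<noteq> 0" "eval3 (conic_form c) x = 0" if "x \<in> cvec ` ?K" for x
      using that nz by (auto simp: eval3_conic_form simp del: cvec.simps)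
    show "x = y" if "x \<in> cvec ` ?K" "y \<in> cvec ` ?K" "proj_rel x y" for x y
      using that distinct by blast
  qed
  then show ?thesis by (simp add: sum.reindex[OF inj])
qed

text \<open>
  In a factorization \<open>F G\<close> with degrees \<open>a + b = 6\<close> each cusp is a double point of exactly one of the
  factors.  A conic contains six cusps, so Bezout's theorem for both factors is sharp, and \<open>F\<close>
  passes through exactly \<open>a\<close> of the six.  Let \<open>S\<close> be the set of cusps on \<open>F\<close>.  Counting the pairs
  of a conic through a cusp \<open>q\<close> and a point of \<open>S\<close> on it gives \<open>8 a = 5 |S|\<close>, or \<open>8 a = 5 |S| + 3\<close>
  if \<open>q\<close> belongs to \<open>S\<close>.  As \<open>q\<close> is arbitrary, \<open>S\<close> is empty or contains all cusps, and \<open>a\<close> is 0 or 6.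
\<close>
lemma dual_irreducible: "irreducible dual_form"
proof (rule irreducibleI)
  show "dual_form \<noteq> 0" by (rule dual_nonzero)
  show "\<not> dual_form dvd 1"
  proof
    assume "dual_form dvd 1"
    then obtain a where "dual_form = const3 a" by (rule unit_form_const)
    then have "homogeneous 0 dual_form" by (metis homogeneous_const)
    then show False using homogeneous_degree_unique[OF _ homogeneous_dual dual_nonzero] by fastforce
  qed
next
  fix F G assume FG: "dual_form = F * G"
  have nz: "F \<noteq> 0" "G \<noteq> 0" using FG dual_nonzero by auto
  have dvd: "F dvd dual_form" "G dvd dual_form" unfolding FG by simp_all
  have "homogeneous 6 (F * G)" "F * G \<noteq> 0" using homogeneous_dual dual_nonzero FG by simp_all
  then obtain a b where ab: "homogeneous a F" "homogeneous b G" "a + b = 6"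
    by (rule homogeneous_factors)
  have unit: "H dvd 1" if H: "homogeneous 0 H" "H \<noteq> 0" for H
  proof -
    obtain h where h: "H = const3 h" using homogeneous_0_const[OF H(1)] .
    then have "h \<noteq> 0" using H(2) const3_eq_0_iff by auto
    then have "1 = H * const3 (1 / h)" by (simp add: h const3_def mult_single)
    then show ?thesis by (rule dvdI)
  qed
  define S where "S = {q \<in> set cusp_list. mult3 F (cvec q) = 2}"
  have split: "mult3 F (cvec q) = (if q \<in> S then 2 else 0) \<and> mult3 G (cvec q) = (if q \<in> S then 0 else 2)"
    if "q \<in> set cusp_list" for q
    using cusp_not_crossing[OF _ nz, of "cvec q"] dual_cusps[OF that] that by (auto simp: S_def FG)
  have on_conic: "card {s \<in> S. qval c s = 0} = a" if c: "c \<in> set conic_list" for c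
  proof -
    let ?K = "{q. q \<in> set cusp_list \<and> qval c q = 0}"
    have K: "card ?K = 6" using conic_counts c by (simp add: card_filter[OF distinct_cusps])
    have SK: "{s \<in> S. qval c s = 0} = ?K \<inter> S" by (auto simp: S_def)
    have "(\<Sum>q\<in>?K. mult3 F (cvec q)) = (\<Sum>q\<in>?K. if q \<in> S then 2 else 0)"
      using split by (intro sum.cong) auto
    also have "\<dots> = 2 * card (?K \<inter> S)" by (simp add: sum.If_cases)
    finally have 1: "2 * card (?K \<inter> S) \<le> 2 * a"
      using factor_on_conic[OF ab(1) dvd(1) c] by simp
    have "(\<Sum>q\<in>?K. mult3 G (cvec q)) = (\<Sum>q\<in>?K. if q \<in> S then 0 else 2)"
      using split by (intro sum.cong) auto
    also have "\<dots> = 2 * card (?K \<inter> - S)" by (simp add: sum.If_cases)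
    finally have 2: "2 * card (?K \<inter> - S) \<le> 2 * b"
      using factor_on_conic[OF ab(2) dvd(2) c] by simp
    have "card (?K \<inter> S) + card (?K \<inter> - S) = card ?K"
      by (subst card_Un_disjoint[symmetric]) (auto intro: arg_cong[of _ _ card])
    with 1 2 K ab(3) show ?thesis unfolding SK by linarith
  qed
  have finS: "finite S" by (simp add: S_def)
  have count: "8 * a = 5 * card S + (if q \<in> S then 3 else 0)" if q: "q \<in> set cusp_list" for q
  proof -
    let ?C = "{c \<in> set conic_list. qval c q = 0}"
    have "card ?C = 8" using conics_through q by (simp add: card_filter[OF distinct_conics])
    have "8 * a = (\<Sum>c\<in>?C. card {s \<in> S. qval c s = 0})"
      using on_conic \<open>card ?C = 8\<close> by simp
    also have "\<dots> = (\<Sum>c\<in>?C. \<Sum>s | s \<in> S \<and> qval c s = 0. 1)" by simp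
    also have "\<dots> = (\<Sum>s\<in>S. \<Sum>c | c \<in> ?C \<and> qval c s = 0. 1)"
      using finS by (intro sum.swap_restrict) auto
    also have "\<dots> = (\<Sum>s\<in>S. 5 + (if s = q then 3 else 0))"
    proof (rule sum.cong[OF refl])
      fix s assume "s \<in> S"
      then have s: "s \<in> set cusp_list" by (simp add: S_def)
      have "{c \<in> ?C. qval c s = 0} = {c \<in> set conic_list. qval c q = 0 \<and> qval c s = 0}" by auto
      then show "(\<Sum>c | c \<in> ?C \<and> qval c s = 0. 1) = 5 + (if s = q then 3 else 0 :: nat)"
        using conics_through_two_cusps[rule_format, OF q s] conics_through(1) q
        by (auto simp: card_filter[OF distinct_conics])
    qed
    also have "\<dots> = 5 * card S + (if q \<in> S then 3 else 0)"
      using finS by (simp add: sum.distrib)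
    finally show ?thesis .
  qed
  have S: "S = {} \<or> S = set cusp_list"
  proof (rule ccontr)
    assume neg: "\<not> ?thesis"
    have "S \<subseteq> set cusp_list" unfolding S_def by blast
    with neg obtain q r where "q \<in> S" "r \<in> set cusp_list" "r \<notin> S" "q \<in> set cusp_list"
      by blast
    then show False using count[of q] count[of r] by simp
  qed
  have card: "card (set cusp_list) = 9" using distinct_card[OF distinct_cusps] lengths(1) by simp
  have "set cusp_list \<noteq> {}" using card by (intro notI) simp
  then obtain q where q: "q \<in> set cusp_list" unfolding ex_in_conv[symmetric] by (elim exE)
  from S have "a = 0 \<or> a = 6" using count[OF q] card q by auto
  then have "a = 0 \<or> b = 0" using ab(3) by auto
  then show "F dvd 1 \<or> G dvd 1" using unit ab nz by blast
qed


section \<open>The Hesse arrangement of conics\<close>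

definition cubic :: curve where "cubic = abs_curve cubic_form"

definition dual :: curve where "dual = abs_curve dual_form"

lemma smooth_cubic_cubic: "smooth_cubic cubic"
  unfolding smooth_cubic_def
proof (intro conjI allI notI)
  show "curve_degree cubic = 3"
    unfolding cubic_def by (rule curve_degree_abs[OF cubic_nonzero homogeneous_cubic])
  fix P assume "singular_point P cubic"
  moreover obtain v where P: "P = abs_point v" "v \<noteq> 0" by (rule point_cases)
  ultimately have "mult3 cubic_form v \<ge> 2"
    unfolding singular_point_def cubic_def P mult_at_abs[OF P(2) cubic_nonzero homogeneous_cubic] by simp
  then have "taylor 1 cubic_form v u = 0" for u
    using mult3_ge2_iff[OF cubic_nonzero] by blast
  from this[of "vector [1, 0, 0]"] this[of "vector [0, 1, 0]"] this[of "vector [0, 0, 1]"]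
  have "v $ 1 ^ 2 + v $ 2 * v $ 3 = 0" "v $ 2 ^ 2 + v $ 1 * v $ 3 = 0" "v $ 3 ^ 2 + v $ 1 * v $ 2 = 0"
    by (simp_all add: taylor1_cubic del: One_nat_def distrib_left_numeral)
  then have "v $ 1 = 0 \<and> v $ 2 = 0 \<and> v $ 3 = 0" by (rule cubic_smooth)
  then have "v = 0" by (intro vec3_eqI) simp_all
  with P(2) show False by simp
qed

lemma grad_cubic: "grad cubic_form p = 3 *s vector [p $ 1 ^ 2 + p $ 2 * p $ 3, p $ 2 ^ 2 + p $ 1 * p $ 3, p $ 3 ^ 2 + p $ 1 * p $ 2]"
  by (rule vec3_eqI) (simp_all add: grad_conv_taylor taylor1_cubic axis_def del: One_nat_def)

lemma is_tangent_abs: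
  "p \<noteq> 0 \<Longrightarrow> l \<noteq> 0 \<Longrightarrow> is_tangent cubic (abs_point p) (abs_point l) \<longleftrightarrow>
     eval3 cubic_form p = 0 \<and> (\<exists>c. c \<noteq> 0 \<and> grad cubic_form p = c *s l)"
  unfolding cubic_def
  by (rule is_tangent.abs_eq[OF form_rel_refl[OF cubic_nonzero homogeneous_cubic] proj_rel_refl proj_rel_refl])

lemma on_dual_iff: "l \<noteq> 0 \<Longrightarrow> on_curve (abs_point l) dual \<longleftrightarrow> eval3 dual_form l = 0"
  unfolding dual_def by (rule on_curve_abs[OF _ dual_nonzero homogeneous_dual])

lemma is_dual_curve_dual: "is_dual_curve cubic dual"
  unfolding is_dual_curve_def
proof
  show "irreducible_curve dual"
    unfolding dual_def irreducible_curve_abs[OF dual_nonzero homogeneous_dual] by (rule dual_irreducible)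
  have "on_curve L dual \<longleftrightarrow> (\<exists>P. is_tangent cubic P L)" for L
  proof -
    obtain l where L: "L = abs_point l" "l \<noteq> 0" by (rule point_cases)
    show ?thesis
    proof
      assume "on_curve L dual"
      then have "dual_val (l $ 1) (l $ 2) (l $ 3) = 0" using L on_dual_iff eval3_dual by simp
      moreover have "l $ 1 \<noteq> 0 \<or> l $ 2 \<noteq> 0 \<or> l $ 3 \<noteq> 0" using L(2) by (auto simp: vec_eq_iff forall_3)
      ultimately obtain x y z k where *: "x \<noteq> 0 \<or> y \<noteq> 0 \<or> z \<noteq> 0" "k \<noteq> 0" "cubic_val x y z = 0"
        "x ^ 2 + y * z = k * l $ 1" "y ^ 2 + x * z = k * l $ 2" "z ^ 2 + x * y = k * l $ 3"
        by (rule tangent_of_dual)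
      let ?p = "vector [x, y, z] :: complex ^ 3"
      have "?p \<noteq> 0" using *(1) by (auto simp: vec_eq_iff forall_3)
      moreover have "grad cubic_form ?p = (3 * k) *s l"
        by (rule vec3_eqI) (simp_all add: grad_cubic *)
      moreover have "eval3 cubic_form ?p = 0" by (simp add: eval3_cubic *(3))
      ultimately have "is_tangent cubic (abs_point ?p) L"
        unfolding L is_tangent_abs[OF \<open>?p \<noteq> 0\<close> L(2)] using *(2) by (intro conjI exI[of _ "3 * k"]) simp_all
      then show "\<exists>P. is_tangent cubic P L" ..
    next
      assume "\<exists>P. is_tangent cubic P L"
      then obtain P where "is_tangent cubic P L" ..
      moreover obtain p where P: "P = abs_point p" "p \<noteq> 0" by (rule point_cases)
      ultimately obtain c where p: "eval3 cubic_form p = 0" and c: "c \<noteq> 0" "grad cubic_form p = c *s l"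
        unfolding L P(1) is_tangent_abs[OF P(2) L(2)] by blast
      have "eval3 dual_form (vector [p $ 1 ^ 2 + p $ 2 * p $ 3, p $ 2 ^ 2 + p $ 1 * p $ 3, p $ 3 ^ 2 + p $ 1 * p $ 2]) = 0"
        using dual_of_tangent p by (simp add: eval3_dual eval3_cubic)
      then have "eval3 dual_form (grad cubic_form p) = 0"
        unfolding grad_cubic by (simp add: homogeneous_eval3[OF homogeneous_dual])
      then have "eval3 dual_form l = 0"
        using c by (simp add: homogeneous_eval3[OF homogeneous_dual])
      then show "on_curve L dual" using L on_dual_iff by simp
    qed
  qed
  then show "{l. on_curve l dual} = {l. \<exists>p. is_tangent cubic p l}" by blast
qed

lemma is_cusp_dual: "v \<noteq> 0 \<Longrightarrow> is_cusp (abs_point v) dual \<longleftrightarrow> cusp3 dual_form v"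
  unfolding dual_def
  by (rule is_cusp.abs_eq[OF proj_rel_refl form_rel_refl[OF dual_nonzero homogeneous_dual]])

lemma cusps_dual: "cusps dual = pt ` set cusp_list"
proof
  have nz: "cvec q \<noteq> 0" if "q \<in> set cusp_list" for q
    using that config_nonzero cvec_nonzero by auto
  show "pt ` set cusp_list \<subseteq> cusps dual"
    unfolding cusps_def pt_def using is_cusp_dual[OF nz] dual_cusps by auto
  show "cusps dual \<subseteq> pt ` set cusp_list"
  proof
    fix P assume "P \<in> cusps dual"
    moreover obtain v where P: "P = abs_point v" "v \<noteq> 0" by (rule point_cases)
    ultimately have "mult3 dual_form v \<ge> 2"
      using is_cusp_dual by (simp add: cusps_def cusp3_def)
    then have "eval3 dual_form v = 0" "\<And>u. taylor 1 dual_form v u = 0"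
      using mult3_ge2_iff[OF dual_nonzero] by blast+
    then obtain q k where q: "q \<in> set cusp_list" "k \<noteq> 0" "v = k *s cvec q"
      using dual_singular_is_cusp_point[OF P(2)] by blast
    then have "proj_rel (cvec q) v" using P(2) nz by (auto simp: proj_rel_def)
    then have "P = pt q" unfolding P pt_def using abs_point_eq_iff[OF nz[OF q(1)] P(2)] by simp
    then show "P \<in> pt ` set cusp_list" using q(1) by blast
  qed
qed

lemma card_cusps_on_conic:
  assumes c: "c \<in> set conic_list"
  shows "card {P \<in> cusps dual. on_curve P (conic c)} = 6"
proof -
  have "{P \<in> cusps dual. on_curve P (conic c)} = pt ` {q \<in> set cusp_list. qval c q = 0}"
    unfolding cusps_dual using on_conic[OF _ c] by auto
  moreover have "inj_on pt {q \<in> set cusp_list. qval c q = 0}" by (rule inj_on_subset[OF inj_pt]) auto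
  ultimately show ?thesis
    using conic_counts c by (simp add: card_image card_filter[OF distinct_cusps])
qed

text \<open>
  Suppose that an irreducible conic \<open>C\<close> contains exactly six cusps.  Two of the three others are
  missed by a conic of the arrangement, which contains all but one of the remaining seven and hence
  at least five of the six cusps on \<open>C\<close>.  Bezout's theorem makes the two conics equal.
\<close>
lemma chilean_eq: "chilean = {C. irreducible_conic C \<and> card {P \<in> cusps dual. on_curve P C} = 6}"
proof
  show "chilean \<subseteq> {C. irreducible_conic C \<and> card {P \<in> cusps dual. on_curve P C} = 6}"
    unfolding chilean_def irreducible_conic_def
    using conic_irreducible conic_degree card_cusps_on_conic by auto
  show "{C. irreducible_conic C \<and> card {P \<in> cusps dual. on_curve P C} = 6} \<subseteq> chilean"
  proof clarify
    fix C assume C: "irreducible_conic C" and card: "card {P \<in> cusps dual. on_curve P C} = 6"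
    let ?K = "cusps dual"
    have K: "finite ?K" "card ?K = 9"
      unfolding cusps_dual using card_pt_image[OF _ distinct_cusps] lengths by auto
    have "{P \<in> ?K. \<not> on_curve P C} = ?K - {P \<in> ?K. on_curve P C}" by auto
    then have "card {P \<in> ?K. \<not> on_curve P C} = 3"
      using card_Diff_subset[of "{P \<in> ?K. on_curve P C}" ?K] K card by simp
    then have "2 \<le> card {P \<in> ?K. \<not> on_curve P C}" by linarith
    then obtain T where T: "T \<subseteq> {P \<in> ?K. \<not> on_curve P C}" "card T = 2"
      using obtain_subset_with_card_n by metis
    from T(2) obtain P R where "T = {P, R}" "P \<noteq> R" unfolding card_2_iff by (elim exE conjE)
    with T(1) have PR: "P \<in> ?K" "R \<in> ?K" "P \<noteq> R" "\<not> on_curve P C" "\<not> on_curve R C" by simp_all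
    from PR(1,2) obtain p r where pr': "p \<in> set cusp_list" "r \<in> set cusp_list" "P = pt p" "R = pt r"
      unfolding cusps_dual by (elim imageE)
    with PR(3) have "p \<noteq> r" by blast
    note pr = pr' this
    have "\<exists>c\<in>set conic_list. qval c p \<noteq> 0 \<and> qval c r \<noteq> 0"
      using conics_through_two_cusps[rule_format, OF pr(1,2,5)] unfolding list_ex_iff by (rule conjunct2)
    then obtain c where c: "c \<in> set conic_list" "qval c p \<noteq> 0" "qval c r \<noteq> 0"
      by (elim bexE conjE)
    let ?A = "{P \<in> ?K. on_curve P C}" and ?B = "{P \<in> ?K. on_curve P (conic c)}"
    have off: "\<not> on_curve P (conic c)" "\<not> on_curve R (conic c)"
      using on_conic[OF _ c(1)] pr c by auto
    have "?A \<union> ?B \<subseteq> ?K - {P, R}" using PR off by auto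
    then have "card (?A \<union> ?B) \<le> card (?K - {P, R})" using K(1) by (intro card_mono) auto
    also have "\<dots> = 7" using K PR by (simp add: card_Diff_subset)
    finally have common: "card (?A \<inter> ?B) \<ge> 5"
      using card_Un_Int[of ?A ?B] K(1) card card_cusps_on_conic[OF c(1)] by simp
    have "C = conic c"
    proof (rule ccontr)
      assume "C \<noteq> conic c"
      then have "(\<Sum>P\<in>?A \<inter> ?B. mult_at P C) \<le> 2 * curve_degree C"
        using C K(1) c(1) by (intro conic_bezout) (auto simp: irreducible_conic_def)
      moreover have "(\<Sum>P\<in>?A \<inter> ?B. mult_at P C) \<ge> (\<Sum>P\<in>?A \<inter> ?B. 1)"
        using mult_at_eq_0_iff by (intro sum_mono) (auto simp: Suc_le_eq)
      ultimately show False using common C by (simp add: irreducible_conic_def)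
    qed
    then show "C \<in> chilean" using c(1) by (simp add: chilean_def)
  qed
qed

theorem mainTheorem2:
  shows "\<exists>CL :: curve set.
    hesse_conic_arrangement CL \<and>
    card CL = 12 \<and> (\<forall>C\<in>CL. irreducible_conic C) \<and>
    card (Sing CL) = 21 \<and>
    card {p \<in> Sing CL. mult_at p (\<Sum>C\<in>CL. C) = 8} = 9 \<and>
    card {p \<in> Sing CL. is_node p (\<Sum>C\<in>CL. C)} = 12 \<and>
    seshadri (Sing CL) = 1 / 5 \<and>
    (\<exists>l. is_line l \<and> (\<Sum>p\<in>Sing CL. mult_at p l) = 5)"
proof (intro exI[of _ chilean] conjI)
  have "curve_degree dual = 6"
    unfolding dual_def by (rule curve_degree_abs[OF dual_nonzero homogeneous_dual])
  moreover have "card (cusps dual) = 9"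
    unfolding cusps_dual using card_pt_image[OF _ distinct_cusps] lengths by simp
  ultimately show "hesse_conic_arrangement chilean"
    unfolding hesse_conic_arrangement_def
    using smooth_cubic_cubic is_dual_curve_dual chilean_eq by blast
  show "card chilean = 12" by (rule card_chilean)
  show "\<forall>C\<in>chilean. irreducible_conic C" by (simp add: chilean_eq)
  show "card (Sing chilean) = 21"
    unfolding Sing_chilean using card_pt_image[OF _ distinct_lists(1)] lengths by simp
  show "card {p \<in> Sing chilean. mult_at p (\<Sum>C\<in>chilean. C) = 8} = 9"
    unfolding multiplicity_8_points using card_pt_image[OF _ distinct_cusps] lengths by simp
  show "card {p \<in> Sing chilean. is_node p (\<Sum>C\<in>chilean. C)} = 12"
    unfolding node_points using card_pt_image[OF _ distinct_nodes] lengths by simp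
  show "seshadri (Sing chilean) = 1 / 5" by (rule seshadri_chilean)
  have "(1, - 1, 0) \<in> set line_list" by code_simp
  then show "\<exists>l. is_line l \<and> (\<Sum>p\<in>Sing chilean. mult_at p l) = 5"
    using line_degree sum_mult_line unfolding is_line_def by blast
qed

end
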